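(* Let $r\ge 3$ be an integer and $T>0$, and suppose that $(u,B)\in C([0,T];H^r([0,1]^2;\mathbb{R}^2\times\mathbb{R}^2))$, together with a pressure $p$, solves the ideal MHD equations $$\partial_t u+u\cdot\nabla u-B\cdot\nabla B+\nabla p=0,\qquad \partial_t B+u\cdot\nabla B-B\cdot\nabla u=0,\qquad \operatorname{div}u=\operatorname{div}B=0$$ on $[0,1]^2\times[0,T]$, and that $u^2|_{y=0,1}=B^2|_{y=0,1}=0$ for all $t\in[0,T]$. Then the mean of $B^1$ over the square is constant in time, i.e. $t\mapsto\int_{[0,1]^2}B^1(t,x,y)\,dx\,dy$ is constant on $[0,T]$.
   Context: Superscripts denote components: $u=(u^1,u^2)$, $B=(B^1,B^2)$; coordinates on $[0,1]^2$ are $(x,y)$. No boundary condition is imposed on the sides $x=0$ and $x=1$. *)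

theory Defs
  imports "HOL-Analysis.Analysis"
begin

section \<open>Test functions and distributions\<close>

text \<open>Derivatives of arbitrary order are indexed by words of basis directions instead of
  multi-indices: \<open>partials [v1, ..., vk] \<phi>\<close> is \<open>\<partial>_v1 ... \<partial>_vk \<phi>\<close>.\<close>

primrec partials :: "'a::euclidean_space list \<Rightarrow> ('a \<Rightarrow> real) \<Rightarrow> 'a \<Rightarrow> real" where
  "partials [] \<phi> = \<phi>"
| "partials (v # vs) \<phi> = (\<lambda>x. frechet_derivative (partials vs \<phi>) (at x) v)"

definition smooth :: "('a::euclidean_space \<Rightarrow> real) \<Rightarrow> bool" where
  "smooth \<phi> \<longleftrightarrow> (\<forall>vs \<in> lists Basis. \<forall>x. partials vs \<phi> differentiable (at x))"

definition test_function :: "'a::euclidean_space set \<Rightarrow> ('a \<Rightarrow> real) \<Rightarrow> bool" where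
  "test_function U \<phi> \<longleftrightarrow>
     smooth \<phi> \<and> compact (closure {x. \<phi> x \<noteq> 0}) \<and> closure {x. \<phi> x \<noteq> 0} \<subseteq> U"

definition distribution :: "'a::euclidean_space set \<Rightarrow> (('a \<Rightarrow> real) \<Rightarrow> real) \<Rightarrow> bool" where
  "distribution U p \<longleftrightarrow>
     (\<forall>\<phi> \<psi> a b. test_function U \<phi> \<longrightarrow> test_function U \<psi> \<longrightarrow>
        p (\<lambda>x. a * \<phi> x + b * \<psi> x) = a * p \<phi> + b * p \<psi>) \<and>
     (\<forall>\<Phi> \<phi> K. compact K \<longrightarrow> K \<subseteq> U \<longrightarrow>
        (\<forall>n::nat. test_function U (\<Phi> n) \<and> {x. \<Phi> n x \<noteq> 0} \<subseteq> K) \<longrightarrow> test_function U \<phi> \<longrightarrow>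
        (\<forall>vs \<in> lists Basis.
           uniform_limit UNIV (\<lambda>n. partials vs (\<Phi> n)) (partials vs \<phi>) sequentially) \<longrightarrow>
        (\<lambda>n. p (\<Phi> n)) \<longlonglongrightarrow> p \<phi>)"


section \<open>Sobolev spaces\<close>

text \<open>Elements of \<open>L\<^sup>2\<close> and \<open>H\<^sup>r\<close> are represented by functions on the whole ambient space whose
  values outside \<open>U\<close>, or on null sets, are irrelevant.\<close>

definition locally_integrable ::
  "'a::euclidean_space set \<Rightarrow> ('a \<Rightarrow> 'b::euclidean_space) \<Rightarrow> bool" where
  "locally_integrable U f \<longleftrightarrow> (\<forall>K. compact K \<longrightarrow> K \<subseteq> U \<longrightarrow> f absolutely_integrable_on K)"

definition square_integrable ::
  "'a::euclidean_space set \<Rightarrow> ('a \<Rightarrow> 'b::euclidean_space) \<Rightarrow> bool" where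
  "square_integrable U f \<longleftrightarrow> f \<in> borel_measurable (lebesgue_on U) \<and>
     integrable (lebesgue_on U) (\<lambda>x. (norm (f x))\<^sup>2)"

definition has_weak_deriv ::
  "'a::euclidean_space set \<Rightarrow> 'a list \<Rightarrow> ('a \<Rightarrow> 'b::euclidean_space) \<Rightarrow> ('a \<Rightarrow> 'b) \<Rightarrow> bool" where
  "has_weak_deriv U vs f g \<longleftrightarrow> locally_integrable U f \<and> locally_integrable U g \<and>
     (\<forall>\<phi>. test_function U \<phi> \<longrightarrow>
        (LINT x|lebesgue_on U. partials vs \<phi> x *\<^sub>R f x) =
        (- 1) ^ length vs *\<^sub>R (LINT x|lebesgue_on U. \<phi> x *\<^sub>R g x))"

text \<open>Weak derivatives are unique only up to null sets; an arbitrary representative is chosen.\<close>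

definition weak_deriv ::
  "'a::euclidean_space set \<Rightarrow> 'a list \<Rightarrow> ('a \<Rightarrow> 'b::euclidean_space) \<Rightarrow> 'a \<Rightarrow> 'b" where
  "weak_deriv U vs f = (SOME g. has_weak_deriv U vs f g)"

definition words :: "nat \<Rightarrow> 'a::euclidean_space list set" where
  "words r = {vs. set vs \<subseteq> Basis \<and> length vs \<le> r}"

definition sobolev_space ::
  "nat \<Rightarrow> 'a::euclidean_space set \<Rightarrow> ('a \<Rightarrow> 'b::euclidean_space) set" where
  "sobolev_space r U = {f. \<forall>vs \<in> words r. \<exists>g. has_weak_deriv U vs f g \<and> square_integrable U g}"

text \<open>Since the sum runs over words, a mixed derivative is counted once per ordering. This is the
  norm built from the full derivative tensors \<open>\<nabla>\<^sup>k f\<close>, \<open>k \<le> r\<close>; it is equivalent to the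
  norm built from multi-indices.\<close>

definition sobolev_norm ::
  "nat \<Rightarrow> 'a::euclidean_space set \<Rightarrow> ('a \<Rightarrow> 'b::euclidean_space) \<Rightarrow> real" where
  "sobolev_norm r U f =
     sqrt (\<Sum>vs \<in> words r. LINT x|lebesgue_on U. (norm (weak_deriv U vs f x))\<^sup>2)"

text \<open>The class \<open>C(I; H\<^sup>r(U))\<close>.\<close>

definition continuous_into_sobolev ::
  "real set \<Rightarrow> nat \<Rightarrow> 'a::euclidean_space set \<Rightarrow> (real \<Rightarrow> 'a \<Rightarrow> 'b::euclidean_space) \<Rightarrow> bool" where
  "continuous_into_sobolev I r U f \<longleftrightarrow>
     (\<forall>t\<in>I. f t \<in> sobolev_space r U) \<and>
     (\<forall>t\<in>I. ((\<lambda>s. sobolev_norm r U (\<lambda>x. f s x - f t x)) \<longlongrightarrow> 0) (at t within I))"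


section \<open>Ideal MHD on the unit square\<close>

abbreviation unit_square :: "(real \<times> real) set" where
  "unit_square \<equiv> {0..1} \<times> {0..1}"

abbreviation open_square :: "(real \<times> real) set" where
  "open_square \<equiv> {0<..<1} \<times> {0<..<1}"

abbreviation Dx :: "(real \<times> real \<Rightarrow> 'b::euclidean_space) \<Rightarrow> real \<times> real \<Rightarrow> 'b" where
  "Dx \<equiv> weak_deriv open_square [(1, 0)]"

abbreviation Dy :: "(real \<times> real \<Rightarrow> 'b::euclidean_space) \<Rightarrow> real \<times> real \<Rightarrow> 'b" where
  "Dy \<equiv> weak_deriv open_square [(0, 1)]"

definition advect ::
  "(real \<times> real \<Rightarrow> real \<times> real) \<Rightarrow> (real \<times> real \<Rightarrow> real \<times> real) \<Rightarrow> real \<times> real \<Rightarrow> real \<times> real" where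
  "advect v w z = fst (v z) *\<^sub>R Dx w z + snd (v z) *\<^sub>R Dy w z"

definition divergence_free :: "(real \<times> real \<Rightarrow> real \<times> real) \<Rightarrow> bool" where
  "divergence_free v \<longleftrightarrow>
     (AE z in lebesgue_on open_square. Dx (\<lambda>z. fst (v z)) z + Dy (\<lambda>z. snd (v z)) z = 0)"

text \<open>The evolution equations hold in the sense of distributions on \<open>(0,T) \<times> (0,1)\<^sup>2\<close>, which
  includes classical and strong solutions. The pressure is allowed to be any distribution: when
  \<open>u\<close> is merely continuous in time, \<open>\<nabla>p\<close> need not be a function (for example
  \<open>u = (a(t), 0)\<close>, \<open>B = 0\<close>, \<open>p = - a'(t) x\<close> with \<open>a\<close> continuous). Points of space-time are
  \<open>(t, z)\<close> with \<open>z = (x, y)\<close>.\<close>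

definition solves_ideal_MHD ::
  "real \<Rightarrow> (real \<Rightarrow> real \<times> real \<Rightarrow> real \<times> real) \<Rightarrow> (real \<Rightarrow> real \<times> real \<Rightarrow> real \<times> real) \<Rightarrow>
   ((real \<times> real \<times> real \<Rightarrow> real) \<Rightarrow> real) \<Rightarrow> bool" where
  "solves_ideal_MHD T u B p \<longleftrightarrow>
     distribution ({0<..<T} \<times> open_square) p \<and>
     (\<forall>\<phi>. test_function ({0<..<T} \<times> open_square) \<phi> \<longrightarrow>
        (LINT t|lebesgue_on {0<..<T}. LINT z|lebesgue_on open_square.
           - partials [(1, 0, 0)] \<phi> (t, z) *\<^sub>R u t z
           + \<phi> (t, z) *\<^sub>R (advect (u t) (u t) z - advect (B t) (B t) z))
        - (p (partials [(0, 1, 0)] \<phi>), p (partials [(0, 0, 1)] \<phi>)) = 0) \<and>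
     (\<forall>\<phi>. test_function ({0<..<T} \<times> open_square) \<phi> \<longrightarrow>
        (LINT t|lebesgue_on {0<..<T}. LINT z|lebesgue_on open_square.
           - partials [(1, 0, 0)] \<phi> (t, z) *\<^sub>R B t z
           + \<phi> (t, z) *\<^sub>R (advect (u t) (B t) z - advect (B t) (u t) z)) = 0) \<and>
     (\<forall>t\<in>{0..T}. divergence_free (u t) \<and> divergence_free (B t))"

text \<open>Boundary values of an \<open>H\<^sup>r\<close> class, \<open>r \<ge> 2\<close>, are those of its continuous representative on the
  closed square, which exists and is unique by the Sobolev embedding.\<close>

definition zero_at_top_and_bottom :: "(real \<times> real \<Rightarrow> real) \<Rightarrow> bool" where
  "zero_at_top_and_bottom f \<longleftrightarrow>
     (\<exists>g. continuous_on unit_square g \<and> (AE z in lebesgue_on open_square. f z = g z) \<and>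
          (\<forall>x\<in>{0..1}. g (x, 0) = 0 \<and> g (x, 1) = 0))"

end

(* Because u and B are divergence free, the first component of u . grad B - B . grad u is
   d_y (u^2 B^1 - B^2 u^1): the x-derivatives cancel, so its integral over the square only sees
   y = 0 and y = 1, where u^2 and B^2 vanish. At low regularity this integration by parts is done
   on vertical lines: a function with integrable weak y-derivative is, for almost every x, a primitive
   of that derivative. Testing the induction equation with theta(t) eta_n(x, y), where eta_n tends to 1
   on the square, then shows that the mean of B^1 has zero weak time derivative; being continuous in
   t, it is constant. *)
theory Submission
  imports Defs
begin

subsection \<open>Smooth cut-off functions\<close>

text \<open>Test functions vanish near the boundary of the square, so the constant 1 is not
  admissible and the mean is reached only as a limit. The limit is harmless because the weak
  equation moves only the time derivative onto the test function: nothing ever differentiates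
  \<open>\<eta> n\<close> in space, so cut-offs that are bounded by 1 and converge pointwise suffice
  and no boundary-layer estimate arises. The boundary values enter only through the limit term, in
  \<open>integral_induction_term_eq_0\<close>. Two conventions shape the rest. Weak derivatives are
  arbitrary choices up to null sets, so identities between them come from uniqueness, that is, from
  the fundamental lemma of the calculus of variations. And the boundary values are those of a
  continuous representative, which has to be matched line by line with a primitive known only almost
  everywhere. The arguments on lines use Borel representatives and \<open>lborel\<close>, since
  slices of Lebesgue measurable functions need not be measurable.\<close>

text \<open>The derivative is an existential witness, so closure under sums, products and affine
  substitution is a plain induction that never computes a \<open>frechet_derivative\<close>.
  \<open>smooth_if_times_differentiable\<close> converts back to \<open>smooth\<close>.\<close>

primrec times_differentiable :: "nat \<Rightarrow> (real \<Rightarrow> real) \<Rightarrow> bool" where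
  "times_differentiable 0 f \<longleftrightarrow> True"
| "times_differentiable (Suc n) f \<longleftrightarrow>
     (\<exists>f'. (\<forall>x. (f has_real_derivative f' x) (at x)) \<and> times_differentiable n f')"

lemma times_differentiable_SucD: "times_differentiable (Suc n) f \<Longrightarrow> times_differentiable n f"
  by (induction n arbitrary: f) auto

lemma times_differentiable_const: "times_differentiable n (\<lambda>x. c)"
  by (induction n arbitrary: c) (auto intro!: exI[of _ "\<lambda>x. 0"] derivative_eq_intros)

lemma times_differentiable_add:
  "times_differentiable n f \<Longrightarrow> times_differentiable n g \<Longrightarrow> times_differentiable n (\<lambda>x. f x + g x)"
proof (induction n arbitrary: f g)
  case (Suc n)
  then obtain f' g' where "\<forall>x. (f has_real_derivative f' x) (at x)" "times_differentiable n f'"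
    "\<forall>x. (g has_real_derivative g' x) (at x)" "times_differentiable n g'"
    by auto
  then show ?case
    using Suc.IH by (auto intro!: exI[of _ "\<lambda>x. f' x + g' x"] derivative_eq_intros)
qed simp

lemma times_differentiable_mult:
  "times_differentiable n f \<Longrightarrow> times_differentiable n g \<Longrightarrow> times_differentiable n (\<lambda>x. f x * g x)"
proof (induction n arbitrary: f g)
  case (Suc n)
  obtain f' g' where d: "\<forall>x. (f has_real_derivative f' x) (at x)" "times_differentiable n f'"
    "\<forall>x. (g has_real_derivative g' x) (at x)" "times_differentiable n g'"
    using Suc.prems by auto
  have "times_differentiable n f" "times_differentiable n g"
    using Suc.prems times_differentiable_SucD by blast+
  then have "times_differentiable n (\<lambda>x. f' x * g x + f x * g' x)"
    using d by (intro times_differentiable_add Suc.IH)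
  moreover have "\<forall>x. ((\<lambda>x. f x * g x) has_real_derivative f' x * g x + f x * g' x) (at x)"
    using d(1,3) by (auto intro!: derivative_eq_intros)
  ultimately show ?case by auto
qed simp

lemma times_differentiable_affine:
  "times_differentiable n f \<Longrightarrow> times_differentiable n (\<lambda>x. f (a * x + b))"
proof (induction n arbitrary: f)
  case (Suc n)
  then obtain f' where d: "\<forall>x. (f has_real_derivative f' x) (at x)" "times_differentiable n f'"
    by auto
  have "((\<lambda>x. f (a * x + b)) has_real_derivative a * f' (a * x + b)) (at x)" for x
    by (rule DERIV_chain'[of "\<lambda>x. a * x + b" a x UNIV f, THEN DERIV_cong])
       (auto intro!: derivative_eq_intros d(1)[rule_format])
  moreover have "times_differentiable n (\<lambda>x. a * f' (a * x + b))"
    using Suc.IH[OF d(2)] times_differentiable_mult[OF times_differentiable_const] by blast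
  ultimately show ?case
    unfolding times_differentiable.simps by (intro exI conjI allI)
qed simp

text \<open>The powers of \<open>t\<close> in the denominator make the family closed under
  differentiation up to linear combinations: the derivatives of the classical flat function
  \<open>flat 0\<close> all lie in the span of the \<open>flat k\<close>.\<close>

definition flat :: "nat \<Rightarrow> real \<Rightarrow> real" where
  "flat k t = (if t > 0 then exp (- 1 / t) / t ^ k else 0)"

lemma flat_tendsto_0: "(flat k \<longlongrightarrow> 0) (at 0)"
proof -
  have "((\<lambda>t::real. exp (- 1 / t) / t ^ k) \<longlongrightarrow> 0) (at_right 0)"
    by real_asymp
  then have "(flat k \<longlongrightarrow> 0) (at_right 0)"
    by (rule Lim_transform_eventually)
       (auto simp: flat_def eventually_at_right_less intro: eventually_mono[OF eventually_at_right_less])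
  moreover have "(flat k \<longlongrightarrow> 0) (at_left 0)"
    by (rule Lim_transform_eventually[of "\<lambda>x. 0"])
       (auto simp: flat_def eventually_at_filter)
  ultimately show ?thesis
    by (simp add: filterlim_at_split)
qed

lemma flat_has_derivative:
  "(flat k has_real_derivative flat (k + 2) t - real k * flat (k + 1) t) (at t)"
proof (cases t "0::real" rule: linorder_cases)
  case less
  have "((\<lambda>x. 0) has_real_derivative 0) (at t)" by simp
  then have "(flat k has_real_derivative 0) (at t)"
    by (rule has_field_derivative_transform_within_open[of _ _ _ "{..<0}"])
       (use less in \<open>auto simp: flat_def\<close>)
  then show ?thesis using less by (simp add: flat_def)
next
  case equal
  have "((\<lambda>h. (flat k (0 + h) - flat k 0) / h) \<longlongrightarrow> 0) (at 0)"
    \<comment> \<open>For \<open>h\<close> different from 0 the difference quotient of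
      \<open>flat k\<close> at 0 is exactly \<open>flat (Suc k) h\<close>.\<close>
    by (rule Lim_transform_eventually[OF flat_tendsto_0[of "Suc k"]])
       (auto simp: flat_def eventually_at_filter)
  then show ?thesis using equal by (simp add: DERIV_def flat_def)
next
  case greater
  have "((\<lambda>x. exp (- 1 / x) / x ^ k) has_real_derivative
      exp (- 1 / t) / t ^ (k + 2) - real k * (exp (- 1 / t) / t ^ (k + 1))) (at t)"
  proof (cases k)
    case 0
    then show ?thesis
      using greater by (auto intro!: derivative_eq_intros simp: field_simps power2_eq_square)
  next
    case (Suc m)
    have *: "((\<lambda>x. exp (- 1 / x) / x ^ Suc m) has_real_derivative
      (exp (- 1 / t) * (1 / t\<^sup>2) * t ^ Suc m - exp (- 1 / t) * (real (Suc m) * t ^ m)) / (t ^ Suc m * t ^ Suc m)) (at t)"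
      using greater by (intro derivative_eq_intros | simp add: power2_eq_square del: of_nat_Suc)+
    show ?thesis
      unfolding Suc
      by (rule DERIV_cong[OF *]) (use greater in \<open>simp add: field_simps power2_eq_square del: of_nat_Suc\<close>)
  qed
  then have "(flat k has_real_derivative
      exp (- 1 / t) / t ^ (k + 2) - real k * (exp (- 1 / t) / t ^ (k + 1))) (at t)"
    by (rule has_field_derivative_transform_within_open[of _ _ _ "{0<..}"])
       (use greater in \<open>auto simp: flat_def\<close>)
  then show ?thesis using greater by (simp add: flat_def)
qed

lemma times_differentiable_flat: "times_differentiable n (flat k)"
proof (induction n arbitrary: k)
  case (Suc n)
  have "times_differentiable n (\<lambda>t. flat (k + 2) t + (- real k) * flat (k + 1) t)"
    by (intro times_differentiable_add times_differentiable_mult times_differentiable_const Suc.IH)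
  then show ?case
    using flat_has_derivative[of k] by (auto intro!: exI[of _ "\<lambda>t. flat (k + 2) t - real k * flat (k + 1) t"])
qed simp

lemma frechet_derivative_real:
  "(f has_real_derivative d) (at x) \<Longrightarrow> frechet_derivative f (at x) h = d * h"
  using frechet_derivative_at[of f "(*) d" x] unfolding has_field_derivative_def by metis

lemma smooth_if_times_differentiable:
  assumes "\<And>n. times_differentiable n f"
  shows "smooth f"
proof -
  have "times_differentiable n (partials vs f)" if "vs \<in> lists Basis" for vs n
    using that
  proof (induction vs arbitrary: n)
    case (Cons v vs)
    then have "times_differentiable (Suc n) (partials vs f)" by auto
    then obtain f' where f': "\<And>x. (partials vs f has_real_derivative f' x) (at x)" "times_differentiable n f'"
      by auto
    have "partials (v # vs) f = f'"
      using Cons.hyps frechet_derivative_real[OF f'(1)] by auto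
    with f'(2) show ?case by simp
  qed (use assms in auto)
  from this[of _ "Suc 0"] show ?thesis
    unfolding smooth_def times_differentiable.simps has_field_derivative_def
    by (meson differentiableI)
qed

text \<open>Bounded pointwise convergence is all that is asked, as the sequence is only used under
  dominated convergence. The case \<open>a \<ge> b\<close> is included: the interval is then empty
  and every \<open>\<psi> n\<close> vanishes.\<close>

lemma bump_sequence:
  fixes a b :: real
  obtains \<psi> :: "nat \<Rightarrow> real \<Rightarrow> real" where
    "\<And>n. test_function {a<..<b} (\<psi> n)"
    "\<And>n x. 0 \<le> \<psi> n x" "\<And>n x. \<psi> n x \<le> 1"
    "\<And>x. (\<lambda>n. \<psi> n x) \<longlonglongrightarrow> indicator {a<..<b} x"
proof
  \<comment> \<open>The factors are \<open>flat 0 (n (x - a) - 1)\<close> and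
    \<open>flat 0 (n (b - x) - 1)\<close>, written as affine substitutions. The shift by 1 keeps the
    support inside \<open>{a + 1/n .. b - 1/n}\<close>, hence compact in the open interval; for
    \<open>n = 0\<close> it makes the function vanish. Inside the interval both arguments tend to
    infinity, where \<open>flat 0\<close> tends to 1.\<close>
  define \<psi> where "\<psi> n x = flat 0 (real n * x + (- real n * a - 1)) * flat 0 (- real n * x + (real n * b - 1))"
    for n x
  have "0 \<le> flat 0 x" "flat 0 x \<le> 1" for x
    by (auto simp: flat_def)
  then show "0 \<le> \<psi> n x" "\<psi> n x \<le> 1" for n x
    by (auto simp: \<psi>_def intro: mult_le_one)
  show "test_function {a<..<b} (\<psi> n)" for n
    unfolding test_function_def
  proof (intro conjI)
    show "smooth (\<psi> n)"
      unfolding \<psi>_def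
      by (intro smooth_if_times_differentiable times_differentiable_mult times_differentiable_affine times_differentiable_flat)
    have *: "{x. \<psi> n x \<noteq> 0} \<subseteq> {a + 1 / n .. b - 1 / n} \<and> ({x. \<psi> n x \<noteq> 0} = {} \<or> n > 0)"
    proof (cases "n = 0")
      case False
      then show ?thesis
        by (auto simp: \<psi>_def flat_def field_simps split: if_splits)
    qed (auto simp: \<psi>_def flat_def)
    then have **: "closure {x. \<psi> n x \<noteq> 0} \<subseteq> {a + 1 / n .. b - 1 / n}"
      by (intro closure_minimal) auto
    then show "compact (closure {x. \<psi> n x \<noteq> 0})"
      using compact_Icc bounded_subset closed_closure compact_eq_bounded_closed by meson
    show "closure {x. \<psi> n x \<noteq> 0} \<subseteq> {a<..<b}"
    proof (cases "n > 0")
      case True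
      then have "0 < 1 / real n" by simp
      then have "{a + 1 / n .. b - 1 / n} \<subseteq> {a<..<b}"
        by (smt (verit) atLeastAtMost_iff greaterThanLessThan_iff subsetI)
      with ** show ?thesis by blast
    qed (use * in auto)
  qed
  show "(\<lambda>n. \<psi> n x) \<longlonglongrightarrow> indicator {a<..<b} x" for x
  proof (cases "x \<in> {a<..<b}")
    case True
    have pos: "(\<lambda>n. flat 0 (real n * c - 1)) \<longlonglongrightarrow> 1" if "c > 0" for c
    proof -
      have "(\<lambda>n. exp (- 1 / (real n * c - 1))) \<longlonglongrightarrow> 1" using that by real_asymp
      moreover have "eventually (\<lambda>n. real n * c - 1 > 0) sequentially" using that by real_asymp
      ultimately show ?thesis
        by (elim Lim_transform_eventually eventually_mono) (auto simp: flat_def)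
    qed
    have "(\<lambda>n. flat 0 (real n * (x - a) - 1) * flat 0 (real n * (b - x) - 1)) \<longlonglongrightarrow> 1 * 1"
      using True by (intro tendsto_mult pos) auto
    then show ?thesis using True by (simp add: \<psi>_def algebra_simps)
  next
    case False
    have "\<psi> n x = 0" for n
    proof -
      have "real n * x \<le> real n * a \<or> real n * b \<le> real n * x"
        using False by (auto intro: mult_left_mono simp: not_less)
      then show ?thesis by (auto simp: \<psi>_def flat_def)
    qed
    then show ?thesis using False by simp
  qed
qed

subsection \<open>Calculus of test functions\<close>

lemma partials_append: "partials (us @ vs) \<phi> = partials us (partials vs \<phi>)"
  by (induction us) auto

lemma smooth_partials:
  assumes "smooth \<phi>" "vs \<in> lists Basis"
  shows "smooth (partials vs \<phi>)"
  unfolding smooth_def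
proof (intro ballI allI)
  fix us :: "'a list" and x assume "us \<in> lists Basis"
  then have "us @ vs \<in> lists Basis" using assms by auto
  then show "partials us (partials vs \<phi>) differentiable (at x)"
    using assms(1) by (simp only: smooth_def flip: partials_append)
qed

lemma smooth_imp_differentiable: "smooth \<phi> \<Longrightarrow> \<phi> differentiable (at x)"
  unfolding smooth_def by (metis lists.Nil partials.simps(1))

lemma continuous_on_partials:
  assumes "smooth \<phi>" "vs \<in> lists Basis"
  shows "continuous_on S (partials vs \<phi>)"
  using smooth_imp_differentiable[OF smooth_partials[OF assms]]
  by (intro continuous_at_imp_continuous_on) (auto intro: differentiable_imp_continuous_within)

lemma partials_eq_0_outside_support:
  assumes "x \<notin> closure {x. \<phi> x \<noteq> 0}"
  shows "partials vs \<phi> x = 0"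
  using assms
proof (induction vs arbitrary: x)
  case Nil
  then have "x \<notin> {x. \<phi> x \<noteq> 0}" using closure_subset by (metis (no_types) subsetD)
  then show ?case by simp
next
  case (Cons v vs)
  have "(partials vs \<phi> has_derivative (\<lambda>h. 0)) (at x)"
  proof (rule has_derivative_transform_within_open)
    show "((\<lambda>x. 0) has_derivative (\<lambda>h. 0)) (at x)" by simp
    show "open (- closure {x. \<phi> x \<noteq> 0})" by (intro open_Compl closed_closure)
  qed (use Cons in auto)
  then have "frechet_derivative (partials vs \<phi>) (at x) = (\<lambda>h. 0)"
    by (simp only: frechet_derivative_at[symmetric])
  then show ?case by simp
qed

lemma test_function_partials:
  assumes "test_function U \<phi>" "vs \<in> lists Basis"
  shows "test_function U (partials vs \<phi>)"
proof -
  have "{x. partials vs \<phi> x \<noteq> 0} \<subseteq> closure {x. \<phi> x \<noteq> 0}"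
    using partials_eq_0_outside_support by blast
  then have sub: "closure {x. partials vs \<phi> x \<noteq> 0} \<subseteq> closure {x. \<phi> x \<noteq> 0}"
    by (simp add: closure_minimal)
  moreover have "compact (closure {x. partials vs \<phi> x \<noteq> 0})"
    using sub assms(1) unfolding test_function_def
    by (meson bounded_subset closed_closure compact_eq_bounded_closed)
  ultimately show ?thesis
    using assms smooth_partials unfolding test_function_def by blast
qed

section \<open>Tensor products of test functions\<close>

lemma has_derivative_tensor:
  fixes f :: "'a::euclidean_space \<Rightarrow> real" and g :: "'b::euclidean_space \<Rightarrow> real"
  assumes f: "f differentiable (at (fst z))" and g: "g differentiable (at (snd z))"
  shows "((\<lambda>z. f (fst z) * g (snd z)) has_derivative
    (\<lambda>v. f (fst z) * frechet_derivative g (at (snd z)) (snd v) +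
      frechet_derivative f (at (fst z)) (fst v) * g (snd z))) (at z)"
proof -
  have "((\<lambda>z. f (fst z)) has_derivative (\<lambda>v. frechet_derivative f (at (fst z)) (fst v))) (at z)"
    by (rule has_derivative_compose[OF has_derivative_fst[OF has_derivative_ident]])
       (use f frechet_derivative_works in blast)
  moreover have "((\<lambda>z. g (snd z)) has_derivative (\<lambda>v. frechet_derivative g (at (snd z)) (snd v))) (at z)"
    by (rule has_derivative_compose[OF has_derivative_snd[OF has_derivative_ident]])
       (use g frechet_derivative_works in blast)
  ultimately show ?thesis by (rule has_derivative_mult)
qed

lemma partials_tensor:
  fixes f :: "'a::euclidean_space \<Rightarrow> real" and g :: "'b::euclidean_space \<Rightarrow> real"
  assumes f: "smooth f" and g: "smooth g"
  shows "partials [(u, 0)] (\<lambda>z. f (fst z) * g (snd z)) = (\<lambda>z. partials [u] f (fst z) * g (snd z))"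
    and "partials [(0, w)] (\<lambda>z. f (fst z) * g (snd z)) = (\<lambda>z. f (fst z) * partials [w] g (snd z))"
proof -
  have df: "f differentiable (at x)" and dg: "g differentiable (at y)" for x y
    using assms by (auto intro: smooth_imp_differentiable)
  have "frechet_derivative f (at x) 0 = 0" "frechet_derivative g (at y) 0 = 0" for x y
    using linear_0[OF linear_frechet_derivative[OF df]] linear_0[OF linear_frechet_derivative[OF dg]] by auto
  then show "partials [(u, 0)] (\<lambda>z. f (fst z) * g (snd z)) = (\<lambda>z. partials [u] f (fst z) * g (snd z))"
    "partials [(0, w)] (\<lambda>z. f (fst z) * g (snd z)) = (\<lambda>z. f (fst z) * partials [w] g (snd z))"
    by (auto simp: frechet_derivative_at[OF has_derivative_tensor[OF df dg], symmetric])
qed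

text \<open>A basis vector of the product space has the form \<open>(u, 0)\<close> or
  \<open>(0, w)\<close>, so each partial derivative hits one factor only. By induction every
  iterated partial derivative is again a tensor product of smooth functions, and such a product is
  differentiable.\<close>

lemma smooth_tensor:
  fixes f :: "'a::euclidean_space \<Rightarrow> real" and g :: "'b::euclidean_space \<Rightarrow> real"
  assumes "smooth f" "smooth g"
  shows "smooth (\<lambda>z. f (fst z) * g (snd z))"
proof -
  have "\<exists>f' g'. smooth f' \<and> smooth g' \<and>
      partials vs (\<lambda>z. f (fst z) * g (snd z)) = (\<lambda>z. f' (fst z) * g' (snd z))"
    if "vs \<in> lists Basis" for vs
    using that
  proof (induction vs)
    case Nil
    then show ?case using assms by auto
  next
    case (Cons v vs)
    then obtain f' g' where fg: "smooth f'" "smooth g'"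
      "partials vs (\<lambda>z. f (fst z) * g (snd z)) = (\<lambda>z. f' (fst z) * g' (snd z))" by auto
    have eq: "partials (v # vs) (\<lambda>z. f (fst z) * g (snd z)) = partials [v] (\<lambda>z. f' (fst z) * g' (snd z))"
      using fg(3) by simp
    from Cons.hyps consider u where "v = (u, 0)" "u \<in> Basis" | w where "v = (0, w)" "w \<in> Basis"
      by (auto simp: Basis_prod_def)
    then show ?case
    proof cases
      case 1
      have "partials (v # vs) (\<lambda>z. f (fst z) * g (snd z)) = (\<lambda>z. partials [u] f' (fst z) * g' (snd z))"
        using eq partials_tensor(1)[OF fg(1,2), of u] 1(1) by (simp only:)
      then show ?thesis
        using fg(1,2) 1(2) smooth_partials[of f' "[u]"] by (metis lists.Cons lists.Nil)
    next
      case 2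
      have "partials (v # vs) (\<lambda>z. f (fst z) * g (snd z)) = (\<lambda>z. f' (fst z) * partials [w] g' (snd z))"
        using eq partials_tensor(2)[OF fg(1,2), of w] 2(1) by (simp only:)
      then show ?thesis
        using fg(1,2) 2(2) smooth_partials[of g' "[w]"] by (metis lists.Cons lists.Nil)
    qed
  qed
  moreover have "(\<lambda>z. f' (fst z) * g' (snd z)) differentiable (at z)"
    if "smooth f'" "smooth g'" for f' :: "'a \<Rightarrow> real" and g' :: "'b \<Rightarrow> real" and z
    by (rule differentiableI[OF has_derivative_tensor]) (use that smooth_imp_differentiable in blast)+
  ultimately show ?thesis
    unfolding smooth_def[of "\<lambda>z. f (fst z) * g (snd z)"] by (intro ballI allI) fastforce
qed

lemma test_function_tensor:
  fixes f :: "'a::euclidean_space \<Rightarrow> real" and g :: "'b::euclidean_space \<Rightarrow> real"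
  assumes "test_function U f" "test_function V g"
  shows "test_function (U \<times> V) (\<lambda>z. f (fst z) * g (snd z))"
proof -
  let ?K = "closure {x. f x \<noteq> 0} \<times> closure {y. g y \<noteq> 0}"
  have "{z. f (fst z) * g (snd z) \<noteq> 0} \<subseteq> {x. f x \<noteq> 0} \<times> {y. g y \<noteq> 0}"
    by auto
  also have "\<dots> \<subseteq> ?K"
    by (intro Sigma_mono closure_subset)
  finally have "{z. f (fst z) * g (snd z) \<noteq> 0} \<subseteq> ?K" .
  then have sub: "closure {z. f (fst z) * g (snd z) \<noteq> 0} \<subseteq> ?K"
    by (simp add: closure_minimal closed_Times)
  moreover have "compact ?K"
    using assms unfolding test_function_def by (intro compact_Times) auto
  ultimately have "compact (closure {z. f (fst z) * g (snd z) \<noteq> 0})"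
    by (meson bounded_subset closed_closure compact_eq_bounded_closed)
  moreover have "?K \<subseteq> U \<times> V"
    using assms unfolding test_function_def by blast
  ultimately show ?thesis
    using sub assms smooth_tensor unfolding test_function_def by blast
qed

section \<open>Linear combinations and primitives of test functions\<close>

lemma test_function_mono: "test_function U \<phi> \<Longrightarrow> U \<subseteq> V \<Longrightarrow> test_function V \<phi>"
  unfolding test_function_def by blast

lemma test_function_lincomb:
  assumes "test_function U \<phi>" "test_function U \<psi>"
  shows "test_function U (\<lambda>x. a * \<phi> x + b * \<psi> x)"
proof -
  have diff: "partials vs \<phi> differentiable (at x)" "partials vs \<psi> differentiable (at x)"
    if "vs \<in> lists Basis" for vs x
    using assms that unfolding test_function_def smooth_def by auto
  have deriv: "((\<lambda>x. a * partials vs \<phi> x + b * partials vs \<psi> x) has_derivative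
      (\<lambda>h. a * frechet_derivative (partials vs \<phi>) (at x) h + b * frechet_derivative (partials vs \<psi>) (at x) h)) (at x)"
    if "vs \<in> lists Basis" for vs x
    using diff[OF that, of x] unfolding frechet_derivative_works
    by (intro has_derivative_add has_derivative_mult_right)
  have eq: "partials vs (\<lambda>x. a * \<phi> x + b * \<psi> x) = (\<lambda>x. a * partials vs \<phi> x + b * partials vs \<psi> x)"
    if "vs \<in> lists Basis" for vs
    using that
  proof (induction vs)
    case (Cons v vs)
    then show ?case
      by (auto simp: frechet_derivative_at[OF deriv, symmetric])
  qed simp
  have "smooth (\<lambda>x. a * \<phi> x + b * \<psi> x)"
    unfolding smooth_def
  proof (intro ballI allI)
    fix vs :: "'a list" and x assume vs: "vs \<in> lists Basis"
    show "partials vs (\<lambda>x. a * \<phi> x + b * \<psi> x) differentiable (at x)"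
      unfolding eq[OF vs] by (rule differentiableI[OF deriv[OF vs]])
  qed
  moreover have sub: "closure {x. a * \<phi> x + b * \<psi> x \<noteq> 0} \<subseteq> closure {x. \<phi> x \<noteq> 0} \<union> closure {x. \<psi> x \<noteq> 0}"
    unfolding closure_Un[symmetric] by (rule closure_mono) auto
  moreover have "compact (closure {x. \<phi> x \<noteq> 0} \<union> closure {x. \<psi> x \<noteq> 0})"
    using assms unfolding test_function_def by auto
  then have "compact (closure {x. a * \<phi> x + b * \<psi> x \<noteq> 0})"
    using sub by (meson bounded_subset closed_closure compact_eq_bounded_closed)
  ultimately show ?thesis
    using assms unfolding test_function_def by blast
qed

text \<open>The primitive starting left of the support is constant to the right of it, with the mean
  of \<open>\<psi>\<close> as its value. Vanishing mean is therefore exactly what gives the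
  primitive compact support.\<close>

lemma test_function_antiderivative:
  fixes a b :: real
  assumes \<psi>: "test_function {a<..<b} \<psi>" and mean: "integral {a..b} \<psi> = 0"
  obtains \<Theta> where "test_function {a<..<b} \<Theta>" "\<And>x. (\<Theta> has_real_derivative \<psi> x) (at x)"
proof -
  define K where "K = closure {x. \<psi> x \<noteq> 0}"
  have K: "compact K" "K \<subseteq> {a<..<b}" and sm: "smooth \<psi>"
    using \<psi> by (auto simp: test_function_def K_def)
  have cont: "continuous_on S \<psi>" for S
    using continuous_on_partials[OF sm, of "[]"] by auto
  have zero: "\<psi> x = 0" if "x \<notin> K" for x
    using that closure_subset[of "{x. \<psi> x \<noteq> 0}"] unfolding K_def by blast
  \<comment> \<open>Starting at \<open>a - 1\<close> instead of \<open>a\<close> only leaves room: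
    points at or beyond the support lie in the interior of \<open>{a-1..x+1}\<close>, so the
    one-sided derivative there is two-sided.\<close>
  define \<Theta> where "\<Theta> x = integral {a-1..x} \<psi>" for x
  obtain c d where cd: "a < c" "d < b" "K \<subseteq> {c..d}"
  proof (cases "K = {}")
    case True
    \<comment> \<open>With empty support any \<open>c > a\<close> and \<open>d < b\<close> will do;
      neither \<open>c \<le> d\<close> nor \<open>a < b\<close> is available here.\<close>
    then show ?thesis using that[of "a + 1" "b - 1"] by auto
  next
    case False
    then obtain c d where "c \<in> K" "d \<in> K" "\<And>x. x \<in> K \<Longrightarrow> c \<le> x \<and> x \<le> d"
      using compact_attains_inf[OF K(1)] compact_attains_sup[OF K(1)] by metis
    then have "a < c" "d < b" "K \<subseteq> {c..d}" using K(2) by auto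
    then show ?thesis by (rule that)
  qed
  have int: "\<psi> integrable_on {x..y}" for x y
    by (rule integrable_continuous_interval[OF cont])
  have z: "integral {x..y} \<psi> = 0" if "y \<le> c \<or> d \<le> x" for x y
  proof -
    have "integral {x..y} \<psi> = integral {x..y} (\<lambda>x. 0)"
      by (rule integral_spike[of "{c, d}"]) (use that cd(3) in \<open>force intro!: zero[symmetric]\<close>)+
    then show ?thesis by simp
  qed
  have left: "\<Theta> x = 0" if "x \<le> c" for x
    unfolding \<Theta>_def using that by (intro z) auto
  have der: "(\<Theta> has_real_derivative \<psi> x) (at x)" for x
  proof (cases "x < c")
    case True
    have "((\<lambda>x. 0) has_real_derivative 0) (at x)" by simp
    then have "(\<Theta> has_real_derivative 0) (at x)"
      by (rule has_field_derivative_transform_within_open[of _ _ _ "{..<c}"])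
         (use True left in auto)
    moreover have "\<psi> x = 0" using True cd by (intro zero) auto
    ultimately show ?thesis by simp
  next
    case False
    have "(\<Theta> has_real_derivative \<psi> x) (at x within {a-1..x+1})"
      unfolding \<Theta>_def
      by (rule integral_has_real_derivative[OF cont]) (use False cd in auto)
    moreover have "x \<in> interior {a-1..x+1}"
      using False cd by (simp add: interior_atLeastAtMost_real)
    ultimately show ?thesis by (metis at_within_interior)
  qed
  have right: "\<Theta> x = 0" if "d \<le> x" for x
  proof (cases "x \<le> c")
    case False
    then have "a \<le> x" using cd by auto
    have "\<Theta> x = integral {a-1..a} \<psi> + integral {a..x} \<psi>"
      unfolding \<Theta>_def using \<open>a \<le> x\<close> by (subst Henstock_Kurzweil_Integration.integral_combine[OF _ _ int]) auto
    also have "\<dots> = integral {a..x} \<psi>" using cd by (simp add: z)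
    also have "\<dots> = integral {a..b} \<psi>"
    proof (cases "x \<le> b")
      case True
      then show ?thesis
        using Henstock_Kurzweil_Integration.integral_combine[OF \<open>a \<le> x\<close> _ int, of b] z[of b x] that by simp
    next
      case False
      show ?thesis
      proof (cases "a \<le> b")
        case True
        then show ?thesis
          using Henstock_Kurzweil_Integration.integral_combine[OF True _ int, of x] False z[of x b] cd by simp
      next
        case False
        then have "K = {}" using K(2) by auto
        then have "\<psi> = (\<lambda>x. 0)" using zero by auto
        then show ?thesis by simp
      qed
    qed
    finally show ?thesis using mean by simp
  qed (simp add: left)
  have "{x. \<Theta> x \<noteq> 0} \<subseteq> {c..d}"
    using left right by (smt (verit) atLeastAtMost_iff mem_Collect_eq subsetI)
  then have sub: "closure {x. \<Theta> x \<noteq> 0} \<subseteq> {c..d}" by (simp add: closure_minimal)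
  moreover have "{c..d} \<subseteq> {a<..<b}" using cd by auto
  moreover have "compact (closure {x. \<Theta> x \<noteq> 0})"
    using sub by (meson bounded_subset closed_closure compact_eq_bounded_closed compact_Icc)
  moreover have "smooth \<Theta>"
    unfolding smooth_def
  proof (intro ballI allI)
    fix vs :: "real list" and x assume vs: "vs \<in> lists Basis"
    show "partials vs \<Theta> differentiable (at x)"
    \<comment> \<open>\<open>partials\<close> applies the last letter of a word first, so splitting
      the word at its end turns \<open>\<Theta>\<close> into \<open>\<psi>\<close> and leaves a
      partial derivative of \<open>\<psi>\<close>.\<close>
    proof (cases vs rule: rev_cases)
      case Nil
      then show ?thesis using der[of x] by (auto simp: has_field_derivative_def intro: differentiableI)
    next
      case (snoc us v)
      have "partials vs \<Theta> = partials us (\<lambda>x. frechet_derivative \<Theta> (at x) v)"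
        by (simp add: snoc partials_append)
      also have "(\<lambda>x. frechet_derivative \<Theta> (at x) v) = \<psi>"
        using vs snoc frechet_derivative_real[OF der] by auto
      finally show ?thesis using sm vs snoc unfolding smooth_def by auto
    qed
  qed
  ultimately have "test_function {a<..<b} \<Theta>" unfolding test_function_def by blast
  with der that show ?thesis by blast
qed

subsection \<open>The fundamental lemma of the calculus of variations\<close>

text \<open>Open boxes are stable under intersection and generate the Borel sets, so by Dynkin
  induction the integral of \<open>f\<close> vanishes on every Borel set. A function with this
  property is zero almost everywhere.\<close>

lemma AE_eq_0_if_box_integrals_eq_0:
  fixes f :: "'a::euclidean_space \<Rightarrow> real"
  assumes f: "integrable lborel f" and zero: "\<And>a b. (LINT x:box a b|lborel. f x) = 0"
  shows "AE x in lborel. f x = 0"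
proof (rule sigma_finite_measure.density_zero[OF lborel.sigma_finite_measure_axioms f])
  have int: "set_integrable lborel A f" if "A \<in> sets borel" for A
    unfolding set_integrable_def using that f by (intro integrable_mult_indicator) auto
  let ?E = "range (\<lambda>(a, b). box a b :: 'a set)"
  have sets: "sets borel = sigma_sets UNIV ?E"
    by (simp add: borel_eq_box)
  \<comment> \<open>Complements need the integral over the whole space to vanish; it is the limit of
    the integrals over growing boxes.\<close>
  let ?A = "\<lambda>n::nat. box (- (real n *\<^sub>R One)) (real n *\<^sub>R One) :: 'a set"
  have "(\<lambda>n. LINT x:?A n|lborel. f x) \<longlonglongrightarrow> (LINT x:(\<Union>n. ?A n)|lborel. f x)"
  proof (rule set_integral_cont_up)
    show "incseq ?A"
      by (intro incseq_SucI) (auto simp: box_def intro: less_trans order_less_le_trans)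
  qed (auto intro: int)
  moreover have "(\<Union>n. ?A n) = UNIV" by (rule UN_box_eq_UNIV)
  ultimately have total: "(LINT x:UNIV|lborel. f x) = 0"
    by (simp add: zero LIMSEQ_const_iff)
  fix A :: "'a set" assume "A \<in> sets lborel"
  then have "A \<in> sigma_sets UNIV ?E" by (simp add: sets)
  then have "Int_stable ?E" "?E \<subseteq> Pow UNIV" "A \<in> sigma_sets UNIV ?E"
    by (auto simp: Int_stable_def box_Int_box)
  then show "(LINT x:A|lborel. f x) = 0"
  proof (induction rule: sigma_sets_induct_disjoint)
    case (basic A)
    then show ?case using zero by auto
  next
    case (compl A)
    then have A: "A \<in> sets borel" by (simp add: sets)
    then have "(LINT x:A \<union> (UNIV - A)|lborel. f x) = (LINT x:A|lborel. f x) + (LINT x:UNIV - A|lborel. f x)"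
      by (intro set_integral_Un int) auto
    then show ?case using compl total by simp
  next
    case (union A)
    then have A: "A i \<in> sets borel" for i using sets by blast
    have "(LINT x:(\<Union>i. A i)|lborel. f x) = (\<Sum>i. (LINT x:(A i)|lborel. f x))"
      using union(1) A by (intro lebesgue_integral_countable_add int) (auto simp: disjoint_family_on_def)
    then show ?case using union by simp
  qed (simp add: set_lebesgue_integral_def)
qed

text \<open>The Sobolev notions refer to the completed measure, whereas the arguments with
  generators of the Borel sets and with slices run on \<open>lborel\<close>; the representative
  joins the two.\<close>

lemma lebesgue_integrable_representative:
  fixes f :: "'a::euclidean_space \<Rightarrow> real"
  assumes f: "integrable lebesgue f"
  obtains g where "integrable lborel g" "AE x in lborel. f x = g x"
proof -
  have "f \<in> borel_measurable lebesgue" using f by auto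
  from completion_ex_borel_measurable_real[OF this] obtain g where
    g: "g \<in> borel_measurable lborel" "AE x in lborel. f x = g x" by auto
  have "integrable lebesgue g"
    using f g by (subst integrable_cong_AE[where g = f])
      (auto intro: measurable_completion AE_completion simp: eq_commute)
  then have "integrable lborel g"
    using g by (simp add: integrable_completion)
  with g that show ?thesis by blast
qed

lemma AE_lebesgue_eq_0_if_box_integrals_eq_0:
  fixes f :: "'a::euclidean_space \<Rightarrow> real"
  assumes f: "integrable lebesgue f" and zero: "\<And>a b. (LINT x:box a b|lebesgue. f x) = 0"
  shows "AE x in lebesgue. f x = 0"
proof -
  obtain g where g: "integrable lborel g" "AE x in lborel. f x = g x"
    using lebesgue_integrable_representative[OF f] .
  then have [measurable]: "g \<in> borel_measurable lborel" "g \<in> borel_measurable lebesgue"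
    "f \<in> borel_measurable lebesgue"
    using f by (auto intro: measurable_completion)
  have "(LINT x:box a b|lborel. g x) = 0" for a b
  proof -
    have "(LINT x:box a b|lborel. g x) = (LINT x:box a b|lebesgue. g x)"
      unfolding set_lebesgue_integral_def by (intro integral_completion[symmetric]) measurable
    also have "\<dots> = (LINT x:box a b|lebesgue. f x)"
      unfolding set_lebesgue_integral_def
    proof (rule integral_cong_AE)
      show "AE x in lebesgue. indicat_real (box a b) x *\<^sub>R g x = indicat_real (box a b) x *\<^sub>R f x"
        using g(2) by (intro AE_completion) (auto elim: eventually_mono)
    qed (auto intro!: borel_measurable_scaleR borel_measurable_indicator \<open>f \<in> borel_measurable lebesgue\<close> \<open>g \<in> borel_measurable lebesgue\<close> simp del: real_scaleR_def)
    finally show ?thesis using zero by simp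
  qed
  then have "AE x in lborel. g x = 0"
    by (rule AE_eq_0_if_box_integrals_eq_0[OF g(1)])
  with g(2) have "AE x in lborel. f x = 0" by eventually_elim simp
  then show ?thesis by (rule AE_completion)
qed

lemma bump_sequence_box:
  fixes p q :: "real \<times> real"
  obtains \<psi> :: "nat \<Rightarrow> real \<times> real \<Rightarrow> real" where
    "\<And>n. test_function (box p q) (\<psi> n)"
    "\<And>n x. 0 \<le> \<psi> n x" "\<And>n x. \<psi> n x \<le> 1"
    "\<And>x. (\<lambda>n. \<psi> n x) \<longlonglongrightarrow> indicator (box p q) x"
proof -
  have box: "box p q = {fst p<..<fst q} \<times> {snd p<..<snd q}"
    by (cases p; cases q) (auto simp: box_def Basis_prod_def)
  obtain \<alpha> where \<alpha>: "\<And>n. test_function {fst p<..<fst q} (\<alpha> n)"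
    "\<And>n x. 0 \<le> \<alpha> n x" "\<And>n x. \<alpha> n x \<le> (1::real)"
    "\<And>x. (\<lambda>n. \<alpha> n x) \<longlonglongrightarrow> indicator {fst p<..<fst q} x"
    using bump_sequence[of "fst p" "fst q"] by metis
  obtain \<beta> where \<beta>: "\<And>n. test_function {snd p<..<snd q} (\<beta> n)"
    "\<And>n x. 0 \<le> \<beta> n x" "\<And>n x. \<beta> n x \<le> (1::real)"
    "\<And>x. (\<lambda>n. \<beta> n x) \<longlonglongrightarrow> indicator {snd p<..<snd q} x"
    using bump_sequence[of "snd p" "snd q"] by metis
  show ?thesis
  proof (rule that[of "\<lambda>n z. \<alpha> n (fst z) * \<beta> n (snd z)"])
    show "test_function (box p q) (\<lambda>z. \<alpha> n (fst z) * \<beta> n (snd z))" for n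
      unfolding box by (rule test_function_tensor[OF \<alpha>(1) \<beta>(1)])
    show "(\<lambda>n. \<alpha> n (fst x) * \<beta> n (snd x)) \<longlonglongrightarrow> indicator (box p q) x" for x
      using tendsto_mult[OF \<alpha>(4)[of "fst x"] \<beta>(4)[of "snd x"]]
      by (auto simp: box indicator_def mem_Times_iff)
  qed (use \<alpha>(2,3) \<beta>(2,3) in \<open>auto intro: mult_le_one\<close>)
qed

lemma test_function_continuous: "test_function U \<phi> \<Longrightarrow> continuous_on S \<phi>"
  using continuous_on_partials[of \<phi> "[]"] by (simp add: test_function_def)

lemma test_function_measurable:
  "test_function U \<phi> \<Longrightarrow> \<phi> \<in> borel_measurable borel"
  by (intro borel_measurable_continuous_onI test_function_continuous)

lemma test_function_bounded:
  assumes "test_function U \<phi>"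
  obtains C where "\<And>x. \<bar>\<phi> x\<bar> \<le> C" "C > 0"
proof -
  let ?K = "closure {x. \<phi> x \<noteq> 0}"
  have "compact (\<phi> ` ?K)"
    using assms by (intro compact_continuous_image test_function_continuous[OF assms]) (simp add: test_function_def)
  then obtain C where C: "\<And>x. x \<in> ?K \<Longrightarrow> \<bar>\<phi> x\<bar> \<le> C"
    by (metis compact_imp_bounded bounded_iff imageI real_norm_def)
  have "\<bar>\<phi> x\<bar> \<le> max C 1" for x
  proof (cases "\<phi> x = 0")
    case False
    then have "x \<in> ?K" using closure_subset[of "{x. \<phi> x \<noteq> 0}"] by blast
    then show ?thesis using C[of x] by simp
  qed simp
  then show ?thesis using that[of "max C 1"] by simp
qed

lemma integrable_test_function_scaleR:
  fixes g :: "'a::euclidean_space \<Rightarrow> 'b::euclidean_space"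
  assumes \<phi>: "test_function U \<phi>" and g: "locally_integrable U g" and U: "open U"
  shows "integrable (lebesgue_on U) (\<lambda>x. \<phi> x *\<^sub>R g x)"
proof -
  let ?K = "closure {x. \<phi> x \<noteq> 0}"
  have K: "compact ?K" "?K \<subseteq> U" using \<phi> by (auto simp: test_function_def)
  then have int: "integrable lebesgue (\<lambda>x. indicat_real ?K x *\<^sub>R g x)"
    using g by (simp add: locally_integrable_def set_integrable_def)
  obtain C where C: "\<And>x. \<bar>\<phi> x\<bar> \<le> C" "C > 0"
    using test_function_bounded[OF \<phi>] by metis
  have "integrable lebesgue (\<lambda>x. \<phi> x *\<^sub>R (indicat_real ?K x *\<^sub>R g x))"
  proof (rule Bochner_Integration.integrable_bound)
    show "integrable lebesgue (\<lambda>x. C *\<^sub>R (indicat_real ?K x *\<^sub>R g x))"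
      using int by (rule integrable_scaleR_right)
    have "\<phi> \<in> borel_measurable lebesgue"
      using test_function_measurable[OF \<phi>] by (intro measurable_completion) simp
    then show "(\<lambda>x. \<phi> x *\<^sub>R (indicat_real ?K x *\<^sub>R g x)) \<in> borel_measurable lebesgue"
      using int by (intro borel_measurable_scaleR[OF _ borel_measurable_integrable])
    show "AE x in lebesgue. norm (\<phi> x *\<^sub>R (indicat_real ?K x *\<^sub>R g x)) \<le> norm (C *\<^sub>R (indicat_real ?K x *\<^sub>R g x))"
      using C by (intro AE_I2) (simp add: abs_mult mult_right_mono)
  qed
  moreover have "\<phi> x *\<^sub>R (indicat_real ?K x *\<^sub>R g x) = indicat_real U x *\<^sub>R (\<phi> x *\<^sub>R g x)" for x
    using closure_subset[of "{x. \<phi> x \<noteq> 0}"] K(2) by (auto simp: indicator_def)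
  ultimately have "integrable lebesgue (\<lambda>x. indicat_real U x *\<^sub>R (\<phi> x *\<^sub>R g x))"
    by (simp only:)
  then show ?thesis
    using U by (subst integrable_restrict_space) auto
qed

text \<open>On a closed box inside \<open>U\<close> the function is integrable, and bump functions
  of open subboxes converge boundedly to indicators, so all box integrals vanish there. Countably
  many closed boxes fill the open set \<open>U\<close>, which collects the null sets into
  one.\<close>

lemma fundamental_lemma_calculus_of_variations:
  fixes g :: "real \<times> real \<Rightarrow> real"
  assumes U: "open U" and g: "locally_integrable U g"
    and zero: "\<And>\<phi>. test_function U \<phi> \<Longrightarrow> (LINT x|lebesgue_on U. \<phi> x * g x) = 0"
  shows "AE x in lebesgue_on U. g x = 0"
proof -
  have ae: "AE x in lebesgue. x \<in> cbox p q \<longrightarrow> g x = 0" if "cbox p q \<subseteq> U" for p q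
  proof -
    have gK: "integrable lebesgue (\<lambda>x. indicat_real (cbox p q) x *\<^sub>R g x)"
      using g that by (simp add: locally_integrable_def set_integrable_def)
    have "integrable lebesgue (\<lambda>x. indicat_real (box p q) x *\<^sub>R (indicat_real (cbox p q) x *\<^sub>R g x))"
      by (rule integrable_mult_indicator[OF _ gK]) auto
    also have "(\<lambda>x. indicat_real (box p q) x *\<^sub>R (indicat_real (cbox p q) x *\<^sub>R g x)) = (\<lambda>x. indicat_real (box p q) x *\<^sub>R g x)"
      using box_subset_cbox[of p q] by (auto simp: indicator_def fun_eq_iff)
    finally have gi: "integrable lebesgue (\<lambda>x. indicat_real (box p q) x *\<^sub>R g x)" .
    have "(LINT x:box a b|lebesgue. indicat_real (box p q) x *\<^sub>R g x) = 0" for a b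
    proof -
      \<comment> \<open>Boxes reaching out of the closed box are cut back to it, since only bumps
        supported in \<open>U\<close> may be tested. The cut set is again a box, possibly
        empty.\<close>
      obtain c d where cd: "box a b \<inter> box p q = box c d"
        using box_Int_box by blast
      obtain \<psi> :: "nat \<Rightarrow> real \<times> real \<Rightarrow> real" where \<psi>: "\<And>n. test_function (box c d) (\<psi> n)"
        "\<And>n x. 0 \<le> \<psi> n x" "\<And>n x. \<psi> n x \<le> 1" "\<And>x. (\<lambda>n. \<psi> n x) \<longlonglongrightarrow> indicator (box c d) x"
        using bump_sequence_box[of c d] by metis
      have sub: "box c d \<subseteq> cbox p q" using cd box_subset_cbox[of p q] by blast
      have supp: "\<psi> n x = 0" if "x \<notin> cbox p q" for n x
        using \<psi>(1)[of n] that sub closure_subset[of "{x. \<psi> n x \<noteq> 0}"] unfolding test_function_def by blast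
      have "(\<lambda>n. LINT x|lebesgue. \<psi> n x *\<^sub>R (indicat_real (cbox p q) x *\<^sub>R g x)) \<longlonglongrightarrow>
          (LINT x|lebesgue. indicat_real (box c d) x *\<^sub>R (indicat_real (cbox p q) x *\<^sub>R g x))"
      proof (rule integral_dominated_convergence[where w = "\<lambda>x. norm (indicat_real (cbox p q) x *\<^sub>R g x)"])
        show "AE x in lebesgue. norm (\<psi> n x *\<^sub>R (indicat_real (cbox p q) x *\<^sub>R g x)) \<le> norm (indicat_real (cbox p q) x *\<^sub>R g x)" for n
          using \<psi>(2,3) by (intro AE_I2) (simp add: mult_left_le_one_le abs_mult)
        show "AE x in lebesgue. (\<lambda>n. \<psi> n x *\<^sub>R (indicat_real (cbox p q) x *\<^sub>R g x)) \<longlonglongrightarrow>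
            indicat_real (box c d) x *\<^sub>R (indicat_real (cbox p q) x *\<^sub>R g x)"
          using \<psi>(4) by (intro AE_I2 tendsto_scaleR) auto
        show "(\<lambda>x. \<psi> n x *\<^sub>R (indicat_real (cbox p q) x *\<^sub>R g x)) \<in> borel_measurable lebesgue" for n
          using test_function_measurable[OF \<psi>(1), of n]
          by (intro borel_measurable_scaleR measurable_completion borel_measurable_integrable[OF gK]) auto
        show "(\<lambda>x. indicat_real (box c d) x *\<^sub>R (indicat_real (cbox p q) x *\<^sub>R g x)) \<in> borel_measurable lebesgue"
          by (rule borel_measurable_scaleR[OF borel_measurable_indicator borel_measurable_integrable[OF gK]]) simp
      qed (use gK in auto)
      moreover have "(LINT x|lebesgue. \<psi> n x *\<^sub>R (indicat_real (cbox p q) x *\<^sub>R g x)) = 0" for n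
      proof -
        have "\<psi> n x *\<^sub>R (indicat_real (cbox p q) x *\<^sub>R g x) = indicat_real U x *\<^sub>R (\<psi> n x * g x)" for x
          using supp[of x n] that by (auto simp: indicator_def)
        then have "(LINT x|lebesgue. \<psi> n x *\<^sub>R (indicat_real (cbox p q) x *\<^sub>R g x)) =
            (LINT x|lebesgue. indicat_real U x *\<^sub>R (\<psi> n x * g x))"
          by (simp only:)
        also have "\<dots> = (LINT x|lebesgue_on U. \<psi> n x * g x)"
          using U by (subst integral_restrict_space) auto
        also have "\<dots> = 0"
          using sub that by (intro zero test_function_mono[OF \<psi>(1)]) auto
        finally show ?thesis .
      qed
      ultimately have "(LINT x|lebesgue. indicat_real (box c d) x *\<^sub>R (indicat_real (cbox p q) x *\<^sub>R g x)) = 0"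
        by (simp add: LIMSEQ_const_iff)
      moreover have "indicat_real (box c d) x *\<^sub>R (indicat_real (cbox p q) x *\<^sub>R g x) =
          indicat_real (box a b) x *\<^sub>R (indicat_real (box p q) x *\<^sub>R g x)" for x
        using sub by (auto simp: indicator_def simp flip: cd)
      ultimately show ?thesis unfolding set_lebesgue_integral_def by (simp only:)
    qed
    then have "AE x in lebesgue. indicat_real (box p q) x *\<^sub>R g x = 0"
      by (rule AE_lebesgue_eq_0_if_box_integrals_eq_0[OF gi])
    moreover have "AE x in lebesgue. x \<notin> cbox p q - box p q"
      by (intro AE_not_in) (simp add: negligible_iff_null_sets[symmetric] negligible_frontier_interval)
    ultimately show ?thesis
      by eventually_elim (auto simp: indicator_def)
  qed
  obtain \<D> where \<D>: "countable \<D>" "\<D> \<subseteq> Pow U" "\<And>X. X \<in> \<D> \<Longrightarrow> \<exists>a b. X = cbox a b" "\<Union>\<D> = U"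
    using open_countable_Union_open_cbox[OF U] by metis
  have "AE x in lebesgue. \<forall>X\<in>\<D>. x \<in> X \<longrightarrow> g x = 0"
    unfolding AE_ball_countable[OF \<D>(1)] using ae \<D>(2,3) by blast
  then have "AE x in lebesgue. x \<in> U \<longrightarrow> g x = 0"
    by eventually_elim (use \<D>(4) in blast)
  then show ?thesis
    using U by (subst AE_restrict_space_iff) auto
qed

subsection \<open>Weak derivatives\<close>

text \<open>\<open>weak_deriv\<close> is an arbitrary choice; this is how it gets identified with
  any derivative found by calculation. Vector values are reduced to their coordinates.\<close>

lemma has_weak_deriv_unique:
  fixes f :: "real \<times> real \<Rightarrow> 'b::euclidean_space"
  assumes U: "open U" and g: "has_weak_deriv U vs f g" and h: "has_weak_deriv U vs f h"
  shows "AE x in lebesgue_on U. g x = h x"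
proof -
  have gl: "locally_integrable U g" and hl: "locally_integrable U h"
    using g h by (auto simp: has_weak_deriv_def)
  have "AE x in lebesgue_on U. (g x - h x) \<bullet> b = 0" if "b \<in> Basis" for b
  proof (rule fundamental_lemma_calculus_of_variations[OF U])
    show "locally_integrable U (\<lambda>x. (g x - h x) \<bullet> b)"
      using gl hl unfolding locally_integrable_def
      by (auto intro!: absolutely_integrable_component set_integral_diff)
    fix \<phi> assume \<phi>: "test_function U \<phi>"
    have int: "integrable (lebesgue_on U) (\<lambda>x. \<phi> x *\<^sub>R g x)" "integrable (lebesgue_on U) (\<lambda>x. \<phi> x *\<^sub>R h x)"
      using integrable_test_function_scaleR[OF \<phi> _ U] gl hl by auto
    have w: "(LINT x|lebesgue_on U. partials vs \<phi> x *\<^sub>R f x) = (- 1) ^ length vs *\<^sub>R (LINT x|lebesgue_on U. \<phi> x *\<^sub>R k x)"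
      if "has_weak_deriv U vs f k" for k
      using that \<phi> unfolding has_weak_deriv_def by blast
    have eq: "(LINT x|lebesgue_on U. \<phi> x *\<^sub>R g x) = (LINT x|lebesgue_on U. \<phi> x *\<^sub>R h x)"
      using w[OF g, unfolded w[OF h]] by simp
    have "(LINT x|lebesgue_on U. \<phi> x * ((g x - h x) \<bullet> b)) = (LINT x|lebesgue_on U. (\<phi> x *\<^sub>R g x - \<phi> x *\<^sub>R h x) \<bullet> b)"
      by (simp add: inner_diff_left right_diff_distrib)
    also have "\<dots> = (LINT x|lebesgue_on U. \<phi> x *\<^sub>R g x - \<phi> x *\<^sub>R h x) \<bullet> b"
      using int by (intro integral_inner_left) auto
    also have "\<dots> = 0"
      using int eq by (simp add: Bochner_Integration.integral_diff)
    finally show "(LINT x|lebesgue_on U. \<phi> x * ((g x - h x) \<bullet> b)) = 0" .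
  qed
  then have "AE x in lebesgue_on U. \<forall>b\<in>Basis. (g x - h x) \<bullet> b = 0"
    by (subst AE_ball_countable) (auto intro: countable_finite)
  then show ?thesis
    by eventually_elim (metis euclidean_all_zero_iff right_minus_eq)
qed

lemma has_weak_deriv_weak_deriv:
  "has_weak_deriv U vs f g \<Longrightarrow> has_weak_deriv U vs f (weak_deriv U vs f)"
  unfolding weak_deriv_def by (rule someI[of "\<lambda>g. has_weak_deriv U vs f g"])

text \<open>The regularity hypothesis concerns the pair \<open>(u, B)\<close>, the equations the
  components of \<open>u\<close> and \<open>B\<close>. Coordinate projections, as bounded linear
  maps, transport weak derivatives from the former to the latter.\<close>

lemma has_weak_deriv_bounded_linear:
  fixes f :: "'a::euclidean_space \<Rightarrow> 'b::euclidean_space" and L :: "'b \<Rightarrow> 'c::euclidean_space"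
  assumes U: "open U" and vs: "vs \<in> lists Basis" and f: "has_weak_deriv U vs f g" and L: "bounded_linear L"
  shows "has_weak_deriv U vs (\<lambda>x. L (f x)) (\<lambda>x. L (g x))"
proof -
  interpret L: bounded_linear L by fact
  have fl: "locally_integrable U f" and gl: "locally_integrable U g"
    using f by (auto simp: has_weak_deriv_def)
  have loc: "locally_integrable U (\<lambda>x. L (h x))" if "locally_integrable U h" for h
    using that absolutely_integrable_linear[OF _ L] unfolding locally_integrable_def o_def by blast
  show ?thesis
    unfolding has_weak_deriv_def
  proof (intro conjI allI impI loc fl gl)
    fix \<phi> assume \<phi>: "test_function U \<phi>"
    have int: "integrable (lebesgue_on U) (\<lambda>x. partials vs \<phi> x *\<^sub>R f x)"
      "integrable (lebesgue_on U) (\<lambda>x. \<phi> x *\<^sub>R g x)"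
      using integrable_test_function_scaleR[OF _ _ U] \<phi> test_function_partials[OF \<phi> vs] fl gl by auto
    have "(LINT x|lebesgue_on U. partials vs \<phi> x *\<^sub>R L (f x)) = L (LINT x|lebesgue_on U. partials vs \<phi> x *\<^sub>R f x)"
      using integral_bounded_linear[OF L int(1)] by (simp add: L.scaleR)
    also have "\<dots> = (- 1) ^ length vs *\<^sub>R L (LINT x|lebesgue_on U. \<phi> x *\<^sub>R g x)"
      using f \<phi> unfolding has_weak_deriv_def by (simp add: L.scaleR)
    also have "L (LINT x|lebesgue_on U. \<phi> x *\<^sub>R g x) = (LINT x|lebesgue_on U. \<phi> x *\<^sub>R L (g x))"
      using integral_bounded_linear[OF L int(2)] by (simp add: L.scaleR)
    finally show "(LINT x|lebesgue_on U. partials vs \<phi> x *\<^sub>R L (f x)) =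
        (- 1) ^ length vs *\<^sub>R (LINT x|lebesgue_on U. \<phi> x *\<^sub>R L (g x))" .
  qed
qed

lemma has_weak_deriv_diff:
  fixes f g :: "'a::euclidean_space \<Rightarrow> 'b::euclidean_space"
  assumes U: "open U" and vs: "vs \<in> lists Basis"
    and f: "has_weak_deriv U vs f f'" and g: "has_weak_deriv U vs g g'"
  shows "has_weak_deriv U vs (\<lambda>x. f x - g x) (\<lambda>x. f' x - g' x)"
proof -
  have loc: "locally_integrable U f" "locally_integrable U f'" "locally_integrable U g" "locally_integrable U g'"
    using f g by (auto simp: has_weak_deriv_def)
  have diff: "locally_integrable U (\<lambda>x. h x - k x)"
    if "locally_integrable U h" "locally_integrable U k" for h k :: "'a \<Rightarrow> 'b"
    using that unfolding locally_integrable_def by (auto intro!: set_integral_diff)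
  show ?thesis
    unfolding has_weak_deriv_def
  proof (intro conjI allI impI diff loc)
    fix \<phi> assume \<phi>: "test_function U \<phi>"
    note int = integrable_test_function_scaleR[OF \<phi> _ U]
      integrable_test_function_scaleR[OF test_function_partials[OF \<phi> vs] _ U]
    show "(LINT x|lebesgue_on U. partials vs \<phi> x *\<^sub>R (f x - g x)) =
        (- 1) ^ length vs *\<^sub>R (LINT x|lebesgue_on U. \<phi> x *\<^sub>R (f' x - g' x))"
      using f g \<phi> int loc unfolding has_weak_deriv_def
      by (simp add: scaleR_diff_right Bochner_Integration.integral_diff[OF int(2) int(2)]
          Bochner_Integration.integral_diff[OF int(1) int(1)])
  qed
qed

subsection \<open>Slices of functions of two variables\<close>

lemmas integral_lborel_fst = lborel_pair.integral_fst'[unfolded lborel_prod]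
lemmas integrable_lborel_fst = lborel_pair.integrable_fst'[unfolded lborel_prod]
lemmas AE_integrable_lborel_fst = lborel_pair.AE_integrable_fst'[unfolded lborel_prod]
lemmas AE_lborel_pair = lborel_pair.AE_pair[unfolded lborel_prod]
lemmas Fubini_integrable_lborel = lborel_pair.Fubini_integrable[unfolded lborel_prod]

lemma integrable_tensor:
  fixes f g :: "real \<Rightarrow> real"
  assumes f: "integrable lborel f" and g: "integrable lborel g"
  shows "integrable lborel (\<lambda>z. f (fst z) * g (snd z))"
proof (rule Fubini_integrable_lborel)
  have [measurable]: "f \<in> borel_measurable borel" "g \<in> borel_measurable borel"
    using f g by auto
  show "(\<lambda>z. f (fst z) * g (snd z)) \<in> borel_measurable lborel"
    by (simp flip: borel_prod)
  show "integrable lborel (\<lambda>x. LINT y|lborel. norm (f (fst (x, y)) * g (snd (x, y))))"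
    using f g by (simp add: abs_mult)
qed (use g in auto)

lemma integral_tensor:
  fixes f g :: "real \<Rightarrow> real"
  assumes "integrable lborel f" "integrable lborel g"
  shows "(LINT z|lborel. f (fst z) * g (snd z)) = (LINT x|lborel. f x) * (LINT y|lborel. g y)"
  by (subst integral_lborel_fst[OF integrable_tensor[OF assms], symmetric]) simp

lemma AE_lborel_imp_ex_Ioo:
  fixes a b :: real
  assumes "AE x in lborel. P x" "a < b"
  shows "\<exists>x. a < x \<and> x < b \<and> P x"
proof (rule ccontr)
  assume "\<nexists>x. a < x \<and> x < b \<and> P x"
  then have "AE x in lborel. x \<notin> {a<..<b}"
    using assms(1) by (auto elim: eventually_mono)
  then have "{a<..<b} \<in> null_sets lborel"
    by (subst AE_iff_null_sets) auto
  then show False using assms(2) by (simp add: null_sets_def)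
qed

text \<open>The primitive starting at the bottom side \<open>y = 0\<close>. Writing it as an
  integral over the whole line with a cut-off integrand makes dominated convergence in
  \<open>y\<close> and joint measurability in a parameter directly applicable.\<close>

definition prim :: "(real \<Rightarrow> real) \<Rightarrow> real \<Rightarrow> real" where
  "prim k y = (LINT s|lborel. (if 0 < s \<and> s < y then k s else 0))"

lemma integrable_if:
  fixes k :: "real \<Rightarrow> real"
  assumes k: "integrable lborel k" and P: "Measurable.pred borel P"
  shows "integrable lborel (\<lambda>s. if P s then k s else 0)"
proof (rule Bochner_Integration.integrable_bound[OF k])
  have [measurable]: "k \<in> borel_measurable borel" using k by auto
  note [measurable] = P
  show "(\<lambda>s. if P s then k s else 0) \<in> borel_measurable lborel" by simp
qed auto

lemma abs_prim_le:
  assumes k: "integrable lborel k"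
  shows "\<bar>prim k y\<bar> \<le> (LINT s|lborel. \<bar>k s\<bar>)"
proof -
  have "\<bar>prim k y\<bar> \<le> (LINT s|lborel. \<bar>if 0 < s \<and> s < y then k s else 0\<bar>)"
    unfolding prim_def by (rule integral_abs_bound)
  also have "\<dots> \<le> (LINT s|lborel. \<bar>k s\<bar>)"
    using k by (intro integral_mono integrable_abs integrable_if) auto
  finally show ?thesis .
qed

lemma prim_tendsto:
  assumes k: "integrable lborel k" and y: "Y \<longlonglongrightarrow> y"
  shows "(\<lambda>n. prim k (Y n)) \<longlonglongrightarrow> prim k y"
  unfolding prim_def
proof (rule integral_dominated_convergence[where w = "\<lambda>s. \<bar>k s\<bar>"])
  have [measurable]: "k \<in> borel_measurable borel" using k by auto
  show "(\<lambda>s. if 0 < s \<and> s < y then k s else 0) \<in> borel_measurable lborel"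
    "(\<lambda>s. if 0 < s \<and> s < Y n then k s else 0) \<in> borel_measurable lborel" for n
    by simp_all
  \<comment> \<open>Away from the single point \<open>s = y\<close> the cut-off at
    \<open>Y n\<close> eventually agrees with the cut-off at \<open>y\<close>.\<close>
  have "AE s in lborel. s \<noteq> y" by (rule AE_lborel_singleton)
  then show "AE s in lborel. (\<lambda>n. if 0 < s \<and> s < Y n then k s else 0) \<longlonglongrightarrow> (if 0 < s \<and> s < y then k s else 0)"
  proof eventually_elim
    case (elim s)
    then consider "s < y" | "y < s" by linarith
    then have ev: "eventually (\<lambda>n. s < Y n \<longleftrightarrow> s < y) sequentially"
    proof cases
      case 1
      then show ?thesis using order_tendstoD(1)[OF y, of s] by (auto elim: eventually_mono)
    next
      case 2
      then show ?thesis using order_tendstoD(2)[OF y, of s] by (auto elim!: eventually_mono)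
    qed
    show ?case
      by (rule tendsto_eventually[OF eventually_mono[OF ev]]) auto
  qed
qed (use k in auto)

text \<open>Both sides of the almost everywhere identity are continuous up to the endpoints. A null
  set contains no interval, so there are sequences of good points tending to 0 and to 1 along which
  the identity passes to the limit.\<close>

lemma boundary_values_if_AE_eq_prim:
  fixes G k :: "real \<Rightarrow> real"
  assumes k: "integrable lborel k" and G: "continuous_on {0..1} G"
    and ae: "AE y in lborel. 0 < y \<and> y < 1 \<longrightarrow> G y = c + prim k y"
  shows "G 0 = c" "G 1 = c + prim k 1"
proof -
  have lim: "G y = c + prim k y"
    if Y: "\<And>n. 0 < Y n \<and> Y n < 1 \<and> G (Y n) = c + prim k (Y n)" "Y \<longlonglongrightarrow> y" "y \<in> {0..1}" for Y :: "nat \<Rightarrow> real" and y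
  proof -
    have "(\<lambda>n. G (Y n)) \<longlonglongrightarrow> G y"
      using G Y(2,3) by (rule continuous_on_tendsto_compose) (use Y(1) in \<open>auto simp: less_imp_le\<close>)
    moreover have "(\<lambda>n. G (Y n)) \<longlonglongrightarrow> c + prim k y"
      using Y(1) prim_tendsto[OF k Y(2)] by (auto intro: tendsto_intros)
    ultimately show ?thesis using LIMSEQ_unique by blast
  qed
  have "\<exists>y. 0 < y \<and> y < 1 / real (Suc n) \<and> (0 < y \<and> y < 1 \<longrightarrow> G y = c + prim k y)" for n
    using AE_lborel_imp_ex_Ioo[OF ae, of 0 "1 / real (Suc n)"] by simp
  then obtain Y where Y: "\<And>n. 0 < Y n \<and> Y n < 1 / real (Suc n) \<and> (0 < Y n \<and> Y n < 1 \<longrightarrow> G (Y n) = c + prim k (Y n))"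
    by metis
  have le1: "1 / real (Suc n) \<le> 1" for n by simp
  have Y': "0 < Y n \<and> Y n < 1 \<and> G (Y n) = c + prim k (Y n)" for n
    using Y[of n] le1[of n] by (auto simp del: of_nat_Suc intro: less_le_trans)
  have "Y \<longlonglongrightarrow> 0"
    by (rule tendsto_sandwich[of "\<lambda>n. 0" _ _ "\<lambda>n. 1 / real (Suc n)"])
       (use Y LIMSEQ_inverse_real_of_nat in \<open>auto simp: less_imp_le inverse_eq_divide simp del: of_nat_Suc\<close>)
  then have "G 0 = c + prim k 0"
    using Y' by (intro lim[of Y]) auto
  moreover have "prim k 0 = 0"
  proof -
    have "(\<lambda>s::real. if 0 < s \<and> s < 0 then k s else 0) = (\<lambda>s. 0)" by (auto simp: fun_eq_iff)
    then show ?thesis by (simp add: prim_def)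
  qed
  ultimately show "G 0 = c" by simp
  have "\<exists>y. 1 - 1 / real (Suc n) < y \<and> y < 1 \<and> (0 < y \<and> y < 1 \<longrightarrow> G y = c + prim k y)" for n
    using AE_lborel_imp_ex_Ioo[OF ae, of "1 - 1 / real (Suc n)" 1] by simp
  then obtain Z where Z: "\<And>n. 1 - 1 / real (Suc n) < Z n \<and> Z n < 1 \<and> (0 < Z n \<and> Z n < 1 \<longrightarrow> G (Z n) = c + prim k (Z n))"
    by metis
  have lim1: "(\<lambda>n. 1 - 1 / real (Suc n)) \<longlonglongrightarrow> 1"
    by real_asymp
  have "Z \<longlonglongrightarrow> 1"
    by (rule tendsto_sandwich[OF _ _ lim1 tendsto_const]) (use Z in \<open>auto intro!: always_eventually less_imp_le simp del: of_nat_Suc\<close>)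
  moreover have "0 < Z n \<and> Z n < 1 \<and> G (Z n) = c + prim k (Z n)" for n
  proof -
    have "0 < Z n" using Z[of n] le1[of n] by linarith
    then show ?thesis using Z[of n] by blast
  qed
  ultimately show "G 1 = c + prim k 1"
    by (intro lim[of Z]) auto
qed

text \<open>The triangles \<open>s < y\<close> and \<open>y < s\<close> fill the plane up to a null set.\<close>

lemma integral_prim_product:
  assumes h: "integrable lborel h" "\<And>y. y \<notin> {0<..<1} \<Longrightarrow> h y = 0"
    and k: "integrable lborel k" "\<And>y. y \<notin> {0<..<1} \<Longrightarrow> k y = 0"
  shows "integrable lborel (\<lambda>y. prim h y * k y + prim k y * h y)"
    and "(LINT y|lborel. prim h y * k y + prim k y * h y) = (LINT y|lborel. h y) * (LINT y|lborel. k y)"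
proof -
  have [measurable]: "h \<in> borel_measurable borel" "k \<in> borel_measurable borel"
    using h k by auto
  let ?P = "\<lambda>z. k (fst z) * h (snd z)"
  \<comment> \<open>For the primitives \<open>H = prim h\<close> and \<open>K = prim k\<close> the
    claim says that \<open>(HK)'\<close> integrates to \<open>H 1 * K 1\<close>. Each of the two
    summands is the integral of \<open>?P\<close> over one of the triangles; the lower limit 0 in
    \<open>prim\<close> cuts nothing off, because \<open>h\<close> and \<open>k\<close> vanish
    outside the unit interval.\<close>
  have P: "integrable lborel ?P" by (rule integrable_tensor[OF k(1) h(1)])
  have PA: "integrable lborel (\<lambda>z. if snd z < fst z then ?P z else 0)"
    by (rule Bochner_Integration.integrable_bound[OF P]) (auto simp flip: borel_prod)
  have PB: "integrable lborel (\<lambda>z. if fst z < snd z then ?P z else 0)"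
    by (rule Bochner_Integration.integrable_bound[OF P]) (auto simp flip: borel_prod)
  have "(\<lambda>s. if snd (y, s) < fst (y, s) then ?P (y, s) else 0) = (\<lambda>s. k y * (if 0 < s \<and> s < y then h s else 0))" for y
    using h(2) by (auto simp: fun_eq_iff)
  then have A: "(LINT s|lborel. (if snd (y, s) < fst (y, s) then ?P (y, s) else 0)) = prim h y * k y" for y
    by (simp only: prim_def) simp
  have "(\<lambda>s. if s < y then k s * h y else 0) = (\<lambda>s. (if 0 < s \<and> s < y then k s else 0) * h y)" for y
    using k(2) by (auto simp: fun_eq_iff)
  then have B: "(LINT s|lborel. (if s < y then k s * h y else 0)) = prim k y * h y" for y
    by (simp only: prim_def) simp
  have iA: "integrable lborel (\<lambda>y. prim h y * k y)"
    using integrable_lborel_fst[OF PA] unfolding A .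
  have "(LINT y|lborel. prim h y * k y) = (LINT z|lborel. (if snd z < fst z then ?P z else 0))"
    using integral_lborel_fst[OF PA] unfolding A .
  moreover have swapB: "integrable (lborel \<Otimes>\<^sub>M lborel) (\<lambda>(s, y). if s < y then k s * h y else 0)"
    using PB by (simp add: lborel_prod case_prod_unfold)
  have iB: "integrable lborel (\<lambda>y. prim k y * h y)"
    using lborel_pair.integrable_snd[OF swapB] unfolding B .
  have "(LINT y|lborel. prim k y * h y) = (LINT z|lborel. (if fst z < snd z then ?P z else 0))"
    using lborel_pair.integral_snd[OF swapB] unfolding B by (simp add: lborel_prod case_prod_unfold)
  ultimately have "(LINT y|lborel. prim h y * k y + prim k y * h y) =
      (LINT z|lborel. (if snd z < fst z then ?P z else 0) + (if fst z < snd z then ?P z else 0))"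
    using iA iB PA PB by simp
  also have "\<dots> = (LINT x|lborel. LINT y|lborel.
      (if snd (x, y) < fst (x, y) then ?P (x, y) else 0) + (if fst (x, y) < snd (x, y) then ?P (x, y) else 0))"
    by (rule integral_lborel_fst[symmetric]) (intro Bochner_Integration.integrable_add PA PB)
  also have "\<dots> = (LINT x|lborel. LINT y|lborel. ?P (x, y))"
  proof (rule Bochner_Integration.integral_cong[OF refl])
    fix x :: real
    have "AE y in lborel. y \<noteq> x" by (rule AE_lborel_singleton)
    then have ae: "AE y in lborel. (if snd (x, y) < fst (x, y) then ?P (x, y) else 0) +
        (if fst (x, y) < snd (x, y) then ?P (x, y) else 0) = ?P (x, y)"
      by eventually_elim auto
    show "(LINT y|lborel. (if snd (x, y) < fst (x, y) then ?P (x, y) else 0) +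
        (if fst (x, y) < snd (x, y) then ?P (x, y) else 0)) = (LINT y|lborel. ?P (x, y))"
      using ae unfolding fst_conv snd_conv by (intro integral_cong_AE) simp_all
  qed
  also have "\<dots> = (LINT y|lborel. h y) * (LINT y|lborel. k y)" by simp
  finally show "(LINT y|lborel. prim h y * k y + prim k y * h y) = (LINT y|lborel. h y) * (LINT y|lborel. k y)" .
  show "integrable lborel (\<lambda>y. prim h y * k y + prim k y * h y)"
    using iA iB by simp
qed

text \<open>Integration by parts in the form of Fubini: integrate \<open>k s * \<psi> y\<close> over
  the triangle \<open>s < y\<close>. Over \<open>s\<close> first it gives
  \<open>\<psi> y * prim k y\<close>; over \<open>y\<close> first it gives
  \<open>k s * (\<Theta> 1 - \<Theta> s)\<close>, and \<open>\<Theta> 1 = 0\<close>. So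
  \<open>k\<close> may be merely integrable.\<close>

lemma integral_parts_prim:
  assumes \<Theta>: "test_function {0<..<1} \<Theta>" "\<And>x. (\<Theta> has_real_derivative \<psi> x) (at x)"
    and \<psi>: "continuous_on UNIV \<psi>" and k: "integrable lborel k" "\<And>y. y \<notin> {0<..<1} \<Longrightarrow> k y = 0"
  shows "(LINT y|lborel. \<Theta> y * k y) = - (LINT y|lborel. indicator {0<..<1} y * \<psi> y * prim k y)"
proof -
  have [measurable]: "k \<in> borel_measurable borel" "\<psi> \<in> borel_measurable borel"
    using k \<psi> by (auto intro: borel_measurable_continuous_onI)
  have \<Theta>0: "\<Theta> x = 0" if "x \<notin> {0<..<1}" for x
    using \<Theta>(1) that closure_subset[of "{x. \<Theta> x \<noteq> 0}"] unfolding test_function_def by blast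
  let ?\<psi> = "\<lambda>y. indicator {0<..<1} y * \<psi> y"
  have i\<psi>: "integrable lborel ?\<psi>"
  proof -
    have "set_integrable lborel {0..1} \<psi>"
      unfolding set_integrable_def
      by (intro borel_integrable_compact) (auto intro: continuous_on_subset[OF \<psi>])
    then have "set_integrable lborel {0<..<1} \<psi>"
      by (rule set_integrable_subset) auto
    then show ?thesis by (simp add: set_integrable_def)
  qed
  let ?P = "\<lambda>z. k (fst z) * ?\<psi> (snd z)"
  have P: "integrable lborel ?P" by (rule integrable_tensor[OF k(1) i\<psi>])
  have PB: "integrable lborel (\<lambda>z. if fst z < snd z then ?P z else 0)"
    by (rule Bochner_Integration.integrable_bound[OF P]) (auto simp flip: borel_prod)
  then have PB': "integrable (lborel \<Otimes>\<^sub>M lborel) (\<lambda>(s, y). if s < y then k s * ?\<psi> y else 0)"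
    by (simp add: lborel_prod case_prod_unfold)
  have B: "(LINT s|lborel. (if s < y then k s * ?\<psi> y else 0)) = ?\<psi> y * prim k y" for y
  proof -
    have "(\<lambda>s. if s < y then k s * ?\<psi> y else 0) = (\<lambda>s. (if 0 < s \<and> s < y then k s else 0) * ?\<psi> y)"
      using k(2) by (auto simp: fun_eq_iff)
    then show ?thesis by (simp only: prim_def) simp
  qed
  have A: "(LINT y|lborel. (if s < y then k s * ?\<psi> y else 0)) = - (\<Theta> s * k s)" for s
  proof (cases "s \<in> {0<..<1}")
    case True
    have "(LINT y|lborel. indicat_real {s..1} y *\<^sub>R \<psi> y) = \<Theta> 1 - \<Theta> s"
      by (rule integral_FTC_atLeastAtMost)
         (use True \<Theta>(2) in \<open>auto intro: continuous_on_subset[OF \<psi>] simp: has_real_derivative_iff_has_vector_derivative[symmetric]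
            intro: has_field_derivative_at_within\<close>)
    also have "\<dots> = - \<Theta> s" by (simp add: \<Theta>0)
    finally have e: "(LINT y|lborel. indicat_real {s..1} y *\<^sub>R \<psi> y) = - \<Theta> s" .
    have "(LINT y|lborel. (if s < y then k s * ?\<psi> y else 0)) = (LINT y|lborel. k s * (indicat_real {s..1} y *\<^sub>R \<psi> y))"
    proof (rule integral_cong_AE)
      have "AE y in lborel. y \<noteq> s" "AE y in lborel. y \<noteq> 1" by (auto intro: AE_lborel_singleton)
      then show "AE y in lborel. (if s < y then k s * ?\<psi> y else 0) = k s * (indicat_real {s..1} y *\<^sub>R \<psi> y)"
        by eventually_elim (use True in \<open>auto simp: indicator_def\<close>)
    qed simp_all
    then show ?thesis using e by simp
  qed (use k(2) \<Theta>0 in \<open>auto cong: if_cong\<close>)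
  have "(LINT y|lborel. ?\<psi> y * prim k y) = (LINT z|lborel. (if fst z < snd z then ?P z else 0))"
    using lborel_pair.integral_snd[OF PB'] unfolding B by (simp add: lborel_prod case_prod_unfold)
  also have "\<dots> = (LINT s|lborel. LINT y|lborel. (if s < y then k s * ?\<psi> y else 0))"
    using integral_lborel_fst[OF PB] by (simp only: fst_conv snd_conv)
  also have "\<dots> = - (LINT s|lborel. \<Theta> s * k s)" unfolding A by simp
  finally show ?thesis by simp
qed

subsection \<open>Absolute continuity on lines\<close>

lemma integrable_bounded_mult:
  fixes f b :: "'a \<Rightarrow> real"
  assumes f: "integrable M f" and b: "b \<in> borel_measurable M" "\<And>x. \<bar>b x\<bar> \<le> C"
  shows "integrable M (\<lambda>x. b x * f x)"
proof (rule Bochner_Integration.integrable_bound)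
  show "integrable M (\<lambda>x. C * f x)" using f by simp
  show "AE x in M. norm (b x * f x) \<le> norm (C * f x)"
    using b(2) by (intro AE_I2) (auto simp: abs_mult intro!: mult_right_mono intro: order_trans[OF _ abs_ge_self])
qed (use f b in auto)

section \<open>Integrals of test functions\<close>

lemma test_function_integrable:
  fixes \<phi> :: "'a::euclidean_space \<Rightarrow> real"
  assumes "test_function U \<phi>"
  shows "integrable lborel \<phi>"
proof -
  let ?K = "closure {x. \<phi> x \<noteq> 0}"
  have "integrable lborel (\<lambda>x. indicat_real ?K x *\<^sub>R \<phi> x)"
    using assms by (intro borel_integrable_compact test_function_continuous[OF assms]) (simp add: test_function_def)
  moreover have "(\<lambda>x. indicat_real ?K x *\<^sub>R \<phi> x) = \<phi>"
    using closure_subset[of "{x. \<phi> x \<noteq> 0}"] by (auto simp: fun_eq_iff indicator_def)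
  ultimately show ?thesis by simp
qed

lemma test_function_eq_0: "test_function U \<phi> \<Longrightarrow> x \<notin> U \<Longrightarrow> \<phi> x = 0"
  using closure_subset[of "{x. \<phi> x \<noteq> 0}"] unfolding test_function_def by blast

lemma test_function_integral_Icc:
  fixes \<psi> :: "real \<Rightarrow> real"
  assumes \<psi>: "test_function {a<..<b} \<psi>"
  shows "integral {a..b} \<psi> = (LINT x|lborel. \<psi> x)"
proof -
  have "(\<psi> has_integral (LINT x|lborel. \<psi> x)) UNIV"
    by (rule has_integral_integral_lborel[OF test_function_integrable[OF \<psi>]])
  then have "((\<lambda>x. if x \<in> {a..b} then \<psi> x else 0) has_integral (LINT x|lborel. \<psi> x)) UNIV"
    by (rule has_integral_cong[THEN iffD1, rotated]) (use test_function_eq_0[OF \<psi>] in force)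
  then show ?thesis
    by (intro integral_unique) (simp only: has_integral_restrict_UNIV)
qed

lemma integrable_indicator_Ioo [simp]:
  fixes c d :: real
  shows "integrable lborel (indicat_real {c<..<d})"
  by (cases "c \<le> d") (auto intro!: integrable_real_indicator)

lemma test_functions_tendsto_indicator_integral:
  fixes \<beta> :: "nat \<Rightarrow> real \<Rightarrow> real"
  assumes \<beta>: "\<And>n. test_function {c<..<d} (\<beta> n)" "\<And>n x. 0 \<le> \<beta> n x" "\<And>n x. \<beta> n x \<le> 1"
    "\<And>x. (\<lambda>n. \<beta> n x) \<longlonglongrightarrow> indicator {c<..<d} x" and cd: "c \<le> d"
  shows "(\<lambda>n. LINT x|lborel. \<beta> n x) \<longlonglongrightarrow> d - c" "\<bar>LINT x|lborel. \<beta> n x\<bar> \<le> d - c"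
proof -
  have i: "integrable lborel (indicat_real {c<..<d})" by simp
  have le: "\<beta> n x \<le> indicator {c<..<d} x" for n x
    using \<beta>(3) test_function_eq_0[OF \<beta>(1)] by (auto simp: indicator_def)
  have v: "(LINT x|lborel. indicat_real {c<..<d} x) = d - c"
    using cd by simp
  have "(\<lambda>n. LINT x|lborel. \<beta> n x) \<longlonglongrightarrow> (LINT x|lborel. indicat_real {c<..<d} x)"
    by (rule integral_dominated_convergence[where w = "indicat_real {c<..<d}"])
       (use \<beta>(2,4) le i test_function_measurable[OF \<beta>(1)] in auto)
  then show "(\<lambda>n. LINT x|lborel. \<beta> n x) \<longlonglongrightarrow> d - c" unfolding v .
  have "0 \<le> (LINT x|lborel. \<beta> n x)" using \<beta>(2) by simp
  moreover have "(LINT x|lborel. \<beta> n x) \<le> (LINT x|lborel. indicat_real {c<..<d} x)"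
    by (intro integral_mono i test_function_integrable[OF \<beta>(1)] le)
  ultimately show "\<bar>LINT x|lborel. \<beta> n x\<bar> \<le> d - c" unfolding v by simp
qed

text \<open>Extends the hypothesis from smooth test functions to indicators: an interval in
  \<open>x\<close>, times an interval in \<open>y\<close> corrected by a multiple of the full
  interval so that the mean in \<open>y\<close> is zero.\<close>

lemma mean_zero_test_limit:
  fixes w :: "real \<times> real \<Rightarrow> real"
  assumes w: "integrable lborel w"
    and zero: "\<And>\<alpha> \<psi>. test_function {0<..<1} \<alpha> \<Longrightarrow> test_function {0<..<1} \<psi> \<Longrightarrow> (LINT y|lborel. \<psi> y) = 0 \<Longrightarrow>
      (LINT z|lborel. (\<alpha> (fst z) * \<psi> (snd z)) * w z) = 0"
    and ab: "{a<..<b} \<subseteq> {0<..<1}" and cd: "0 \<le> c" "c \<le> d" "d \<le> 1"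
  shows "(LINT z|lborel. (indicator {a<..<b} (fst z) * (indicator {c<..<d} (snd z) - (d - c) * indicator {0<..<1} (snd z))) * w z) = 0"
proof -
  obtain \<alpha> where \<alpha>: "\<And>n. test_function {a<..<b} (\<alpha> n)"
    "\<And>n x. 0 \<le> \<alpha> n x" "\<And>n x. \<alpha> n x \<le> (1::real)" "\<And>x. (\<lambda>n. \<alpha> n x) \<longlonglongrightarrow> indicator {a<..<b} x"
    using bump_sequence[of a b] by metis
  obtain \<beta> where \<beta>: "\<And>n. test_function {c<..<d} (\<beta> n)"
    "\<And>n x. 0 \<le> \<beta> n x" "\<And>n x. \<beta> n x \<le> (1::real)" "\<And>x. (\<lambda>n. \<beta> n x) \<longlonglongrightarrow> indicator {c<..<d} x"
    using bump_sequence[of c d] by metis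
  obtain \<gamma> where \<gamma>: "\<And>n. test_function {0<..<1::real} (\<gamma> n)"
    "\<And>n x. 0 \<le> \<gamma> n x" "\<And>n x. \<gamma> n x \<le> (1::real)" "\<And>x. (\<lambda>n. \<gamma> n x) \<longlonglongrightarrow> indicator {0<..<1} x"
    using bump_sequence[of 0 1] by metis
  define B where "B n = (LINT y|lborel. \<beta> n y)" for n
  define C where "C n = (LINT y|lborel. \<gamma> n y)" for n
  have B: "B \<longlonglongrightarrow> d - c" "\<bar>B n\<bar> \<le> 1" for n
    using test_functions_tendsto_indicator_integral(1)[OF \<beta> cd(2)]
      test_functions_tendsto_indicator_integral(2)[OF \<beta> cd(2), of n] cd
    unfolding B_def by auto
  have C: "C \<longlonglongrightarrow> 1" "\<bar>C n\<bar> \<le> 1" for n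
    using test_functions_tendsto_indicator_integral(1)[OF \<gamma>]
      test_functions_tendsto_indicator_integral(2)[OF \<gamma>, of n]
    unfolding C_def by auto
  \<comment> \<open>Cross-multiplying by the two means makes the mean of \<open>\<psi> n\<close>
    exactly zero without dividing by \<open>C n\<close>, which may vanish for small
    \<open>n\<close>.\<close>
  define \<psi> where "\<psi> n y = C n * \<beta> n y + (- B n) * \<gamma> n y" for n y
  have \<alpha>t: "test_function {0<..<1} (\<alpha> n)" for n
    by (rule test_function_mono[OF \<alpha>(1) ab])
  have \<beta>t: "test_function {0<..<1} (\<beta> n)" for n
    by (rule test_function_mono[OF \<beta>(1)]) (use cd in auto)
  have \<psi>t: "test_function {0<..<1} (\<psi> n)" for n
    unfolding \<psi>_def by (rule test_function_lincomb[OF \<beta>t \<gamma>(1)])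
  have "(LINT y|lborel. \<psi> n y) = 0" for n
    unfolding \<psi>_def using test_function_integrable[OF \<beta>t[of n]] test_function_integrable[OF \<gamma>(1)[of n]]
    by (simp add: B_def C_def)
  then have z: "(LINT z|lborel. (\<alpha> n (fst z) * \<psi> n (snd z)) * w z) = 0" for n
    by (rule zero[OF \<alpha>t \<psi>t])
  have \<psi>2: "\<bar>\<psi> n y\<bar> \<le> 2" for n y
  proof -
    have "\<bar>C n * \<beta> n y\<bar> \<le> 1 * 1" "\<bar>B n * \<gamma> n y\<bar> \<le> 1 * 1"
      using B(2)[of n] C(2)[of n] \<beta>(2,3)[of n y] \<gamma>(2,3)[of n y]
      unfolding abs_mult by (intro mult_mono; simp)+
    then show ?thesis unfolding \<psi>_def by linarith
  qed
  have [measurable]: "\<alpha> n \<in> borel_measurable borel" "\<psi> n \<in> borel_measurable borel" for n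
    using test_function_measurable \<alpha>(1) \<psi>t by blast+
  have [measurable]: "w \<in> borel_measurable (borel \<Otimes>\<^sub>M borel)"
    using w by (simp add: borel_prod)
  have "(\<lambda>n. LINT z|lborel. (\<alpha> n (fst z) * \<psi> n (snd z)) * w z) \<longlonglongrightarrow>
    (LINT z|lborel. (indicator {a<..<b} (fst z) * (indicator {c<..<d} (snd z) - (d - c) * indicator {0<..<1} (snd z))) * w z)"
  proof (rule integral_dominated_convergence[where w = "\<lambda>z. 2 * \<bar>w z\<bar>"])
    show "AE z in lborel. norm (\<alpha> n (fst z) * \<psi> n (snd z) * w z) \<le> 2 * \<bar>w z\<bar>" for n
    proof (intro AE_I2)
      fix z
      have "\<bar>\<alpha> n (fst z)\<bar> * \<bar>\<psi> n (snd z)\<bar> \<le> 1 * 2"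
        using \<alpha>(2,3)[of n "fst z"] \<psi>2[of n "snd z"] by (intro mult_mono) auto
      then show "norm (\<alpha> n (fst z) * \<psi> n (snd z) * w z) \<le> 2 * \<bar>w z\<bar>"
        unfolding real_norm_def abs_mult by (intro mult_right_mono) auto
    qed
    show "AE z in lborel. (\<lambda>n. \<alpha> n (fst z) * \<psi> n (snd z) * w z) \<longlonglongrightarrow>
      (indicator {a<..<b} (fst z) * (indicator {c<..<d} (snd z) - (d - c) * indicator {0<..<1} (snd z))) * w z"
    proof (intro AE_I2 tendsto_mult \<alpha>(4) tendsto_const)
      fix y :: "real \<times> real"
      have "(\<lambda>n. C n * \<beta> n (snd y) + (- B n) * \<gamma> n (snd y)) \<longlonglongrightarrow>
        1 * indicator {c<..<d} (snd y) + (- (d - c)) * indicator {0<..<1} (snd y)"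
        by (intro tendsto_add tendsto_mult tendsto_minus B C \<beta>(4) \<gamma>(4))
      then show "(\<lambda>n. \<psi> n (snd y)) \<longlonglongrightarrow> indicator {c<..<d} (snd y) - (d - c) * indicator {0<..<1} (snd y)"
        by (simp add: \<psi>_def algebra_simps)
    qed
  qed (use w in \<open>auto simp flip: borel_prod\<close>)
  then show ?thesis by (simp add: z LIMSEQ_const_iff)
qed

text \<open>A du Bois-Reymond lemma in \<open>y\<close> with parameter \<open>x\<close>: \<open>w\<close> does not depend on \<open>y\<close>.\<close>

lemma AE_eq_mean_if_test_zero:
  fixes w :: "real \<times> real \<Rightarrow> real"
  assumes w: "integrable lborel w" and supp: "\<And>z. z \<notin> open_square \<Longrightarrow> w z = 0"
    and zero: "\<And>\<alpha> \<psi>. test_function {0<..<1} \<alpha> \<Longrightarrow> test_function {0<..<1} \<psi> \<Longrightarrow> (LINT y|lborel. \<psi> y) = 0 \<Longrightarrow>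
      (LINT z|lborel. (\<alpha> (fst z) * \<psi> (snd z)) * w z) = 0"
  shows "AE z in lborel. z \<in> open_square \<longrightarrow> w z = (LINT y|lborel. w (fst z, y))"
proof -
  let ?I = "indicat_real {0<..<1::real}"
  define m where "m x = (LINT y|lborel. w (x, y))" for x
  have m: "integrable lborel m"
    unfolding m_def by (rule integrable_lborel_fst[OF w])
  have m0: "m x = 0" if "x \<notin> {0<..<1}" for x
  proof -
    have "(\<lambda>y. w (x, y)) = (\<lambda>y. 0)" using supp that by (auto simp: fun_eq_iff)
    then show ?thesis by (simp add: m_def)
  qed
  have [measurable]: "w \<in> borel_measurable (borel \<Otimes>\<^sub>M borel)" "m \<in> borel_measurable borel"
    using w m by (auto simp: borel_prod)
  have im: "integrable lborel (\<lambda>z. m (fst z) * ?I (snd z))"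
    by (rule integrable_tensor[OF m integrable_indicator_Ioo])
  \<comment> \<open>The slice mean \<open>m\<close>, extended constantly in \<open>y\<close> across
    the square, has the same integral as \<open>w\<close> over every box; the difference is
    therefore zero almost everywhere.\<close>
  have "AE z in lborel. w z - m (fst z) * ?I (snd z) = 0"
  proof (rule AE_eq_0_if_box_integrals_eq_0)
    show "integrable lborel (\<lambda>z. w z - m (fst z) * ?I (snd z))"
      using w im by simp
    fix p q :: "real \<times> real"
    \<comment> \<open>Both functions vanish outside the open square, so the box is first clipped to
      it.\<close>
    define a b where "a = max (fst p) 0" and "b = min (fst q) 1"
    define c d where "c = max (snd p) 0" and "d = min (snd q) 1"
    have ind: "indicat_real (box p q) z *\<^sub>R (w z - m (fst z) * ?I (snd z)) =
        (indicator {a<..<b} (fst z) * indicator {c<..<d} (snd z)) * (w z - m (fst z) * ?I (snd z))" for z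
    proof (cases "z \<in> open_square")
      case True
      then show ?thesis
        by (cases p; cases q; cases z) (auto simp: a_def b_def c_def d_def box_def Basis_prod_def indicator_def)
    next
      case False
      then have "w z = 0" "m (fst z) * ?I (snd z) = 0"
        using supp m0[of "fst z"] by (auto simp: mem_Times_iff indicator_def)
      then show ?thesis by simp
    qed
    show "(LINT z:box p q|lborel. w z - m (fst z) * ?I (snd z)) = 0"
    proof (cases "c \<le> d")
      \<comment> \<open>For \<open>d < c\<close> the clipped interval is empty and
        \<open>d - c\<close> is not its length, so the computation with lengths below would not
        apply.\<close>
      case False
      then have "{c<..<d} = {}" by auto
      then show ?thesis unfolding set_lebesgue_integral_def ind by simp
    next
      case True
      have ab: "{a<..<b} \<subseteq> {0<..<1}" and cd: "0 \<le> c" "d \<le> 1"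
        by (auto simp: a_def b_def c_def d_def)
      let ?A = "indicat_real {a<..<b}" and ?C = "indicat_real {c<..<d}"
      have [simp]: "?A x * ?C y \<le> 1" "\<bar>?A x\<bar> \<le> 1" for x y
        by (auto simp: indicator_def)
      have i1: "integrable lborel (\<lambda>z. (?A (fst z) * ?C (snd z)) * w z)"
        by (rule integrable_bounded_mult[OF w, of _ 1]) (simp_all flip: borel_prod)
      have i2: "integrable lborel (\<lambda>z. ?A (fst z) * w z)"
        by (rule integrable_bounded_mult[OF w, of _ 1]) (simp_all flip: borel_prod)
      have eq: "(?A (fst z) * (?C (snd z) - (d - c) * ?I (snd z))) * w z =
          (?A (fst z) * ?C (snd z)) * w z - (d - c) * (?A (fst z) * w z)" for z
        using supp[of z] ab by (cases "z \<in> open_square") (auto simp: mem_Times_iff algebra_simps)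
      have "(LINT z|lborel. (?A (fst z) * ?C (snd z)) * w z - (d - c) * (?A (fst z) * w z)) = 0"
        unfolding eq[symmetric] by (rule mean_zero_test_limit[OF w zero ab cd(1) True cd(2)])
      then have e1: "(LINT z|lborel. (?A (fst z) * ?C (snd z)) * w z) = (d - c) * (LINT z|lborel. ?A (fst z) * w z)"
        using i1 i2 by (simp add: Bochner_Integration.integral_diff)
      have e2: "(LINT z|lborel. ?A (fst z) * w z) = (LINT x|lborel. ?A x * m x)"
        using integral_lborel_fst[OF i2] by (simp add: m_def)
      have iAm: "integrable lborel (\<lambda>x. ?A x * m x)"
        by (rule integrable_bounded_mult[OF m, of _ 1]) simp_all
      have e3: "(LINT z|lborel. (?A (fst z) * m (fst z)) * ?C (snd z)) = (LINT x|lborel. ?A x * m x) * (d - c)"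
        using integral_tensor[OF iAm, of ?C] True by simp
      have i3: "integrable lborel (\<lambda>z. (?A (fst z) * m (fst z)) * ?C (snd z))"
        by (rule integrable_tensor[OF iAm]) simp
      have CI: "?C y * ?I y = ?C y" for y
        using cd by (auto simp: indicator_def)
      have "(?A (fst z) * ?C (snd z)) * (w z - m (fst z) * ?I (snd z)) =
          (?A (fst z) * ?C (snd z)) * w z - (?A (fst z) * m (fst z)) * (?C (snd z) * ?I (snd z))" for z :: "real \<times> real"
        by (simp only: algebra_simps)
      then have "(LINT z:box p q|lborel. w z - m (fst z) * ?I (snd z)) =
          (LINT z|lborel. (?A (fst z) * ?C (snd z)) * w z - (?A (fst z) * m (fst z)) * ?C (snd z))"
        unfolding set_lebesgue_integral_def ind CI by (simp only:)
      also have "\<dots> = 0"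
        unfolding Bochner_Integration.integral_diff[OF i1 i3] e1 e2 e3 by simp
      finally show ?thesis .
    qed
  qed
  then show ?thesis
    by eventually_elim (auto simp: m_def)
qed

text \<open>Let \<open>H\<close> be the primitive of \<open>h\<close> in \<open>y\<close> on each
  vertical line. Integrating by parts on lines shows that \<open>w = f - H\<close> is orthogonal to
  \<open>\<alpha> x * \<psi> y\<close> whenever \<open>\<psi>\<close> has mean zero, because such a
  \<open>\<psi>\<close> is the derivative of a test function. Hence \<open>w\<close> depends on
  \<open>x\<close> alone, and this is the constant of integration \<open>d x\<close>.\<close>

lemma weak_deriv_absolutely_continuous_on_lines:
  fixes f h :: "real \<times> real \<Rightarrow> real"
  assumes f: "integrable lborel f" "\<And>z. z \<notin> open_square \<Longrightarrow> f z = 0"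
    and h: "integrable lborel h" "\<And>z. z \<notin> open_square \<Longrightarrow> h z = 0"
    and weak: "\<And>\<phi>. test_function open_square \<phi> \<Longrightarrow>
      (LINT z|lborel. partials [(0, 1)] \<phi> z * f z) = - (LINT z|lborel. \<phi> z * h z)"
  shows "\<exists>d. AE x in lborel. AE y in lborel. 0 < x \<and> x < 1 \<and> 0 < y \<and> y < 1 \<longrightarrow>
    f (x, y) = d x + prim (\<lambda>s. h (x, s)) y"
proof -
  let ?I = "indicat_real {0<..<1::real}"
  have [measurable]: "f \<in> borel_measurable (borel \<Otimes>\<^sub>M borel)" "h \<in> borel_measurable (borel \<Otimes>\<^sub>M borel)"
    using f h by (auto simp: borel_prod)
  have hx: "AE x in lborel. integrable lborel (\<lambda>y. h (x, y))"
    by (rule AE_integrable_lborel_fst[OF h(1)])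
  define N where "N x = (LINT y|lborel. \<bar>h (x, y)\<bar>)" for x
  have N: "integrable lborel N"
    unfolding N_def by (rule integrable_lborel_fst[OF integrable_abs[OF h(1)]])
  \<comment> \<open>The cut-off to the square is needed for integrability: for
    \<open>y \<ge> 1\<close> the bare primitive stays at the total integral of the slice instead of
    returning to 0.\<close>
  define H where "H z = ?I (fst z) * ?I (snd z) * prim (\<lambda>s. h (fst z, s)) (snd z)" for z
  have "(\<lambda>z. LINT s|lborel. (if 0 < s \<and> s < snd z then h (fst z, s) else 0)) \<in> borel_measurable (borel \<Otimes>\<^sub>M borel :: (real \<times> real) measure)"
    by (rule lborel.borel_measurable_lebesgue_integral) measurable
  then have H_meas[measurable]: "H \<in> borel_measurable (borel \<Otimes>\<^sub>M borel)"
    unfolding H_def prim_def by measurable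
  have H_le: "\<bar>H (x, y)\<bar> \<le> N x * ?I y" if "integrable lborel (\<lambda>y. h (x, y))" for x y
    using abs_prim_le[OF that, of y] by (auto simp: H_def N_def indicator_def)
  have iNy: "integrable lborel (\<lambda>y. N x * ?I y)" for x
    by simp
  have Hx: "integrable lborel (\<lambda>y. H (x, y))" if "integrable lborel (\<lambda>y. h (x, y))" for x
    by (rule Bochner_Integration.integrable_bound[OF iNy[of x]])
       (use H_le[OF that] in \<open>auto intro: order_trans[OF _ abs_ge_self]\<close>)
  have H: "integrable lborel H"
  proof (rule Fubini_integrable_lborel)
    show "H \<in> borel_measurable lborel" using H_meas by (simp add: borel_prod)
    show "AE x in lborel. integrable lborel (\<lambda>y. H (x, y))"
      using hx by eventually_elim (rule Hx)
    show "integrable lborel (\<lambda>x. LINT y|lborel. norm (H (x, y)))"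
    proof (rule Bochner_Integration.integrable_bound[OF N])
      show "(\<lambda>x. LINT y|lborel. norm (H (x, y))) \<in> borel_measurable lborel"
        by (rule lborel.borel_measurable_lebesgue_integral) measurable
      show "AE x in lborel. norm (LINT y|lborel. norm (H (x, y))) \<le> norm (N x)"
        using hx
      proof eventually_elim
        case (elim x)
        have "(LINT y|lborel. \<bar>H (x, y)\<bar>) \<le> (LINT y|lborel. N x * ?I y)"
          by (rule integral_mono[OF integrable_abs[OF Hx[OF elim]] iNy H_le[OF elim]])
        also have "\<dots> = N x" by simp
        finally show ?case by (auto intro: order_trans[OF _ abs_ge_self])
      qed
    qed
  qed
  define w where "w z = f z - H z" for z
  have "AE z in lborel. z \<in> open_square \<longrightarrow> w z = (LINT y|lborel. w (fst z, y))"
  proof (rule AE_eq_mean_if_test_zero)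
    show "integrable lborel w" unfolding w_def using f H by simp
    show "w z = 0" if "z \<notin> open_square" for z
      using f(2)[OF that] that by (auto simp: w_def H_def indicator_def mem_Times_iff)
    fix \<alpha> \<psi> :: "real \<Rightarrow> real"
    assume \<alpha>: "test_function {0<..<1} \<alpha>" and \<psi>: "test_function {0<..<1} \<psi>" and mean: "(LINT y|lborel. \<psi> y) = 0"
    have "integral {0..1} \<psi> = 0"
      using test_function_integral_Icc[OF \<psi>] mean by simp
    then obtain \<Theta> where \<Theta>: "test_function {0<..<1} \<Theta>" "\<And>x. (\<Theta> has_real_derivative \<psi> x) (at x)"
      using test_function_antiderivative[OF \<psi>] by blast
    have [measurable]: "\<alpha> \<in> borel_measurable borel" "\<psi> \<in> borel_measurable borel" "\<Theta> \<in> borel_measurable borel"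
      using test_function_measurable \<alpha> \<psi> \<Theta>(1) by blast+
    obtain Ca where Ca: "\<And>x. \<bar>\<alpha> x\<bar> \<le> Ca" "Ca > 0" using test_function_bounded[OF \<alpha>] by metis
    obtain Cp where Cp: "\<And>x. \<bar>\<psi> x\<bar> \<le> Cp" "Cp > 0" using test_function_bounded[OF \<psi>] by metis
    obtain Ct where Ct: "\<And>x. \<bar>\<Theta> x\<bar> \<le> Ct" "Ct > 0" using test_function_bounded[OF \<Theta>(1)] by metis
    have i: "integrable lborel (\<lambda>z. (\<alpha> (fst z) * \<psi> (snd z)) * g z)" "integrable lborel (\<lambda>z. (\<alpha> (fst z) * \<Theta> (snd z)) * g z)"
      if "integrable lborel g" for g
    proof -
      show "integrable lborel (\<lambda>z. (\<alpha> (fst z) * \<psi> (snd z)) * g z)"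
        by (rule integrable_bounded_mult[OF that, of _ "Ca * Cp"])
           (use Ca Cp in \<open>auto intro!: mult_mono simp: abs_mult simp flip: borel_prod\<close>)
      show "integrable lborel (\<lambda>z. (\<alpha> (fst z) * \<Theta> (snd z)) * g z)"
        by (rule integrable_bounded_mult[OF that, of _ "Ca * Ct"])
           (use Ca Ct in \<open>auto intro!: mult_mono simp: abs_mult simp flip: borel_prod\<close>)
    qed
    have sm: "smooth \<alpha>" "smooth \<Theta>" using \<alpha> \<Theta>(1) by (auto simp: test_function_def)
    have "partials [(0, 1)] (\<lambda>z. \<alpha> (fst z) * \<Theta> (snd z)) = (\<lambda>z. \<alpha> (fst z) * \<psi> (snd z))"
      unfolding partials_tensor(2)[OF sm] by (simp add: frechet_derivative_real[OF \<Theta>(2)])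
    then have "(LINT z|lborel. (\<alpha> (fst z) * \<psi> (snd z)) * f z) = - (LINT z|lborel. (\<alpha> (fst z) * \<Theta> (snd z)) * h z)"
      using weak[OF test_function_tensor[OF \<alpha> \<Theta>(1)]] by simp
    also have "(LINT z|lborel. (\<alpha> (fst z) * \<Theta> (snd z)) * h z) = (LINT x|lborel. LINT y|lborel. \<alpha> x * (\<Theta> y * h (x, y)))"
      using integral_lborel_fst[OF i(2)[OF h(1)]] by (simp add: mult.assoc)
    \<comment> \<open>Integration by parts on almost every slice, namely where
      \<open>h (x, _)\<close> is integrable; for \<open>x\<close> outside the unit interval both
      sides vanish with \<open>\<alpha> x\<close>.\<close>
    also have "\<dots> = (LINT x|lborel. LINT y|lborel. - ((\<alpha> x * \<psi> y) * H (x, y)))"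
    proof (rule integral_cong_AE)
      show "(\<lambda>x. LINT y|lborel. \<alpha> x * (\<Theta> y * h (x, y))) \<in> borel_measurable lborel"
        by (rule lborel.borel_measurable_lebesgue_integral) measurable
      show "(\<lambda>x. LINT y|lborel. - (\<alpha> x * \<psi> y * H (x, y))) \<in> borel_measurable lborel"
        by (rule lborel.borel_measurable_lebesgue_integral) measurable
      show "AE x in lborel. (LINT y|lborel. \<alpha> x * (\<Theta> y * h (x, y))) = (LINT y|lborel. - (\<alpha> x * \<psi> y * H (x, y)))"
        using hx
      proof eventually_elim
        case (elim x)
        show ?case
        proof (cases "x \<in> {0<..<1}")
          case True
          have "(LINT y|lborel. \<alpha> x * (\<Theta> y * h (x, y))) = \<alpha> x * - (LINT y|lborel. ?I y * \<psi> y * prim (\<lambda>s. h (x, s)) y)"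
            using integral_parts_prim[OF \<Theta> test_function_continuous[OF \<psi>] elim] h(2)[of "(x, _)"] by simp
          also have "\<dots> = (LINT y|lborel. - (\<alpha> x * (?I y * \<psi> y * prim (\<lambda>s. h (x, s)) y)))" by simp
          also have "(\<lambda>y. - (\<alpha> x * (?I y * \<psi> y * prim (\<lambda>s. h (x, s)) y))) = (\<lambda>y. - (\<alpha> x * \<psi> y * H (x, y)))"
            using True by (simp add: H_def fun_eq_iff)
          finally show ?thesis .
        next
          case False
          then show ?thesis using test_function_eq_0[OF \<alpha>, of x] by simp
        qed
      qed
    qed
    also have "\<dots> = - (LINT z|lborel. (\<alpha> (fst z) * \<psi> (snd z)) * H z)"
      using integral_lborel_fst[OF i(1)[OF H]] by simp
    finally show "(LINT z|lborel. (\<alpha> (fst z) * \<psi> (snd z)) * w z) = 0"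
      unfolding w_def using i(1)[OF H] i(1)[OF f(1)] by (simp add: right_diff_distrib)
  qed
  then have "AE x in lborel. AE y in lborel. (x, y) \<in> open_square \<longrightarrow> w (x, y) = (LINT s|lborel. w (x, s))"
    using AE_lborel_pair by fastforce
  then have "AE x in lborel. AE y in lborel. 0 < x \<and> x < 1 \<and> 0 < y \<and> y < 1 \<longrightarrow>
      f (x, y) = (LINT s|lborel. w (x, s)) + prim (\<lambda>s. h (x, s)) y"
  proof eventually_elim
    case (elim x)
    then show ?case
    proof eventually_elim
      case (elim y)
      show ?case
      proof (intro impI)
        assume xy: "0 < x \<and> x < 1 \<and> 0 < y \<and> y < 1"
        then have "H (x, y) = prim (\<lambda>s. h (x, s)) y" by (simp add: H_def)
        then show "f (x, y) = (LINT s|lborel. w (x, s)) + prim (\<lambda>s. h (x, s)) y"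
          using elim xy by (simp add: w_def[of "(x, y)"])
      qed
    qed
  qed
  then show ?thesis
    by (intro exI[of _ "\<lambda>x. LINT s|lborel. w (x, s)"])
qed

subsection \<open>The product rule integrated over the square\<close>

lemma borel_measurable_lebesgue_on_AE:
  fixes f g :: "'a::euclidean_space \<Rightarrow> 'b::euclidean_space"
  assumes U: "U \<in> sets lebesgue" and f: "f \<in> borel_measurable (lebesgue_on U)"
    and ae: "AE x in lebesgue_on U. f x = g x"
  shows "g \<in> borel_measurable (lebesgue_on U)"
proof -
  have "(\<lambda>x. if x \<in> U then f x else 0) \<in> borel_measurable lebesgue"
    using f U by (simp add: borel_measurable_if)
  moreover have "AE x in lebesgue. (if x \<in> U then f x else 0) = (if x \<in> U then g x else 0)"
  proof -
    have "AE x in lebesgue. x \<in> U \<longrightarrow> f x = g x"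
      using ae U by (simp add: AE_restrict_space_iff)
    then show ?thesis by eventually_elim simp
  qed
  ultimately have "(\<lambda>x. if x \<in> U then g x else 0) \<in> borel_measurable lebesgue"
    by (rule borel_measurable_AE)
  then show ?thesis using U by (simp add: borel_measurable_if)
qed

text \<open>Measurability of \<open>g\<close> follows from that of \<open>f\<close> because Lebesgue
  measure is complete. This permits replacing chosen representatives under an integral without a
  separate measurability proof.\<close>

lemma lebesgue_on_cong_AE:
  fixes f g :: "'a::euclidean_space \<Rightarrow> 'b::euclidean_space"
  assumes U: "U \<in> sets lebesgue" and f: "f \<in> borel_measurable (lebesgue_on U)"
    and ae: "AE x in lebesgue_on U. f x = g x"
  shows "integrable (lebesgue_on U) f \<longleftrightarrow> integrable (lebesgue_on U) g"
    and "(LINT x|lebesgue_on U. f x) = (LINT x|lebesgue_on U. g x)"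
  using integrable_cong_AE[OF f borel_measurable_lebesgue_on_AE[OF assms] ae]
    integral_cong_AE[OF f borel_measurable_lebesgue_on_AE[OF assms] ae] by auto

lemma lebesgue_on_lborel:
  fixes G :: "'a::euclidean_space \<Rightarrow> 'b::euclidean_space"
  assumes U: "U \<in> sets borel" and G: "G \<in> borel_measurable borel" and supp: "\<And>x. x \<notin> U \<Longrightarrow> G x = 0"
  shows "integrable (lebesgue_on U) G \<longleftrightarrow> integrable lborel G"
    and "(LINT x|lebesgue_on U. G x) = (LINT x|lborel. G x)"
proof -
  have "(\<lambda>x. indicat_real U x *\<^sub>R G x) = G"
    using supp by (auto simp: fun_eq_iff indicator_def)
  then show "integrable (lebesgue_on U) G \<longleftrightarrow> integrable lborel G"
    and "(LINT x|lebesgue_on U. G x) = (LINT x|lborel. G x)"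
    using U G by (simp_all add: integrable_restrict_space integral_restrict_space integrable_completion integral_completion)
qed

lemma integrable_lebesgue_on_representative:
  fixes f :: "'a::euclidean_space \<Rightarrow> real"
  assumes U: "open U" and f: "integrable (lebesgue_on U) f"
  obtains g where "integrable lborel g" "\<And>x. x \<notin> U \<Longrightarrow> g x = 0" "AE x in lebesgue_on U. f x = g x"
proof -
  have "integrable lebesgue (\<lambda>x. indicat_real U x *\<^sub>R f x)"
    using f U by (simp add: integrable_restrict_space)
  from lebesgue_integrable_representative[OF this] obtain g0 where
    g0: "integrable lborel g0" "AE x in lborel. indicat_real U x *\<^sub>R f x = g0 x" by blast
  show ?thesis
  proof (rule that[of "\<lambda>x. indicat_real U x *\<^sub>R g0 x"])
    show "integrable lborel (\<lambda>x. indicat_real U x *\<^sub>R g0 x)"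
      using U by (intro integrable_mult_indicator g0) auto
    have "AE x in lborel. x \<in> U \<longrightarrow> f x = indicat_real U x *\<^sub>R g0 x"
      using g0(2) by eventually_elim auto
    then show "AE x in lebesgue_on U. f x = indicat_real U x *\<^sub>R g0 x"
      using U by (subst AE_restrict_space_iff) (simp_all add: AE_completion)
  qed simp
qed

lemma open_open_square [simp]: "open open_square"
  by (intro open_Times) auto

lemma weak_deriv_y_lborel:
  fixes f h :: "real \<times> real \<Rightarrow> real"
  assumes weak: "has_weak_deriv open_square [(0, 1)] f h"
    and f: "integrable (lebesgue_on open_square) f" and h: "integrable (lebesgue_on open_square) h"
    and f': "integrable lborel f'" "\<And>x. x \<notin> open_square \<Longrightarrow> f' x = 0" "AE x in lebesgue_on open_square. f x = f' x"
    and h': "integrable lborel h'" "\<And>x. x \<notin> open_square \<Longrightarrow> h' x = 0" "AE x in lebesgue_on open_square. h x = h' x"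
    and \<phi>: "test_function open_square \<phi>"
  shows "(LINT z|lborel. partials [(0, 1)] \<phi> z * f' z) = - (LINT z|lborel. \<phi> z * h' z)"
proof -
  have eq: "(LINT z|lebesgue_on open_square. \<psi> z *\<^sub>R g z) = (LINT z|lborel. \<psi> z * g' z)"
    if \<psi>: "test_function open_square \<psi>" and g: "integrable (lebesgue_on open_square) g"
      and g': "integrable lborel g'" "\<And>x. x \<notin> open_square \<Longrightarrow> g' x = 0" "AE x in lebesgue_on open_square. g x = g' x"
    for \<psi> g g' :: "real \<times> real \<Rightarrow> real"
  proof -
    have [measurable]: "\<psi> \<in> borel_measurable borel" "g' \<in> borel_measurable borel"
      using test_function_measurable[OF \<psi>] g' by auto
    have \<psi>m: "\<psi> \<in> borel_measurable (lebesgue_on open_square)"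
      by (intro measurable_restrict_space1 measurable_completion) simp
    have "AE x in lebesgue_on open_square. \<psi> x *\<^sub>R g x = \<psi> x * g' x"
      using g'(3) by eventually_elim simp
    then have "(LINT z|lebesgue_on open_square. \<psi> z *\<^sub>R g z) = (LINT z|lebesgue_on open_square. \<psi> z * g' z)"
      by (intro lebesgue_on_cong_AE borel_measurable_scaleR \<psi>m borel_measurable_integrable[OF g]) auto
    also have "\<dots> = (LINT z|lborel. \<psi> z * g' z)"
      using g'(2) by (intro lebesgue_on_lborel) auto
    finally show ?thesis .
  qed
  have b: "[(0, 1)] \<in> lists (Basis :: (real \<times> real) set)"
    by (simp add: Basis_prod_def)
  have "(LINT z|lebesgue_on open_square. partials [(0, 1)] \<phi> z *\<^sub>R f z) =
      (- 1) ^ length [(0, 1) :: real \<times> real] *\<^sub>R (LINT z|lebesgue_on open_square. \<phi> z *\<^sub>R h z)"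
    using weak \<phi> unfolding has_weak_deriv_def by blast
  then show ?thesis
    using eq[OF test_function_partials[OF \<phi> b] f f'] eq[OF \<phi> h h'] by simp
qed

lemma AE_open_square_slices:
  assumes "AE z in lebesgue_on open_square. P z"
  shows "AE x in lborel. AE y in lborel. 0 < x \<and> x < 1 \<and> 0 < y \<and> y < 1 \<longrightarrow> P (x, y)"
proof -
  have "AE z in lebesgue. z \<in> open_square \<longrightarrow> P z"
    using assms by (subst (asm) AE_restrict_space_iff) auto
  then have "AE z in lborel. z \<in> open_square \<longrightarrow> P z"
    by (simp only: AE_completion_iff)
  from AE_lborel_pair[OF this] show ?thesis
    by (simp add: conj_ac)
qed

text \<open>On almost every vertical line \<open>f = c + prim h\<close> and
  \<open>g = d + prim k\<close>. The trace of \<open>f\<close> at the bottom gives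
  \<open>c = 0\<close>, the one at the top gives \<open>\<integral>h = 0\<close>. The line integral
  of \<open>f k + g h\<close> is then
  \<open>(\<integral>h) (\<integral>k) + d \<integral>h = 0\<close>, whatever the boundary value
  \<open>d\<close> of \<open>g\<close> is. Integrability of the combination is a separate
  hypothesis, as the four functions are only assumed integrable.\<close>

lemma integral_product_rule_zero_trace:
  fixes f g h k :: "real \<times> real \<Rightarrow> real"
  assumes fh: "has_weak_deriv open_square [(0, 1)] f h" and gk: "has_weak_deriv open_square [(0, 1)] g k"
    and f: "integrable (lebesgue_on open_square) f" and h: "integrable (lebesgue_on open_square) h"
    and g: "integrable (lebesgue_on open_square) g" and k: "integrable (lebesgue_on open_square) k"
    and prod: "integrable (lebesgue_on open_square) (\<lambda>z. f z * k z + g z * h z)"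
    and trace: "zero_at_top_and_bottom f"
  shows "(LINT z|lebesgue_on open_square. f z * k z + g z * h z) = 0"
proof -
  obtain f' where f': "integrable lborel f'" "\<And>x. x \<notin> open_square \<Longrightarrow> f' x = 0"
    "AE x in lebesgue_on open_square. f x = f' x"
    by (rule integrable_lebesgue_on_representative[OF open_open_square f]) (rule that)
  obtain h' where h': "integrable lborel h'" "\<And>x. x \<notin> open_square \<Longrightarrow> h' x = 0"
    "AE x in lebesgue_on open_square. h x = h' x"
    by (rule integrable_lebesgue_on_representative[OF open_open_square h]) (rule that)
  obtain g' where g': "integrable lborel g'" "\<And>x. x \<notin> open_square \<Longrightarrow> g' x = 0"
    "AE x in lebesgue_on open_square. g x = g' x"
    by (rule integrable_lebesgue_on_representative[OF open_open_square g]) (rule that)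
  obtain k' where k': "integrable lborel k'" "\<And>x. x \<notin> open_square \<Longrightarrow> k' x = 0"
    "AE x in lebesgue_on open_square. k x = k' x"
    by (rule integrable_lebesgue_on_representative[OF open_open_square k]) (rule that)
  obtain c where c: "AE x in lborel. AE y in lborel. 0 < x \<and> x < 1 \<and> 0 < y \<and> y < 1 \<longrightarrow>
      f' (x, y) = c x + prim (\<lambda>s. h' (x, s)) y"
    using weak_deriv_absolutely_continuous_on_lines[OF f'(1,2) h'(1,2) weak_deriv_y_lborel[OF fh f h f' h']] by blast
  obtain d where d: "AE x in lborel. AE y in lborel. 0 < x \<and> x < 1 \<and> 0 < y \<and> y < 1 \<longrightarrow>
      g' (x, y) = d x + prim (\<lambda>s. k' (x, s)) y"
    using weak_deriv_absolutely_continuous_on_lines[OF g'(1,2) k'(1,2) weak_deriv_y_lborel[OF gk g k g' k']] by blast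
  obtain G where G: "continuous_on unit_square G" "AE z in lebesgue_on open_square. f z = G z"
    "\<And>x. x \<in> {0..1} \<Longrightarrow> G (x, 0) = 0 \<and> G (x, 1) = 0"
    using trace unfolding zero_at_top_and_bottom_def by blast
  have "AE z in lebesgue_on open_square. f' z = G z"
    using f'(3) G(2) by eventually_elim simp
  note fG = AE_open_square_slices[OF this]
  have hx: "AE x in lborel. integrable lborel (\<lambda>y. h' (x, y))"
    by (rule AE_integrable_lborel_fst[OF h'(1)])
  have kx: "AE x in lborel. integrable lborel (\<lambda>y. k' (x, y))"
    by (rule AE_integrable_lborel_fst[OF k'(1)])
  let ?P = "\<lambda>z. f' z * k' z + g' z * h' z"
  have [measurable]: "f' \<in> borel_measurable (borel \<Otimes>\<^sub>M borel)" "h' \<in> borel_measurable (borel \<Otimes>\<^sub>M borel)"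
    "g' \<in> borel_measurable (borel \<Otimes>\<^sub>M borel)" "k' \<in> borel_measurable (borel \<Otimes>\<^sub>M borel)"
    using f' g' h' k' by (auto simp: borel_prod)
  have Pm: "?P \<in> borel_measurable borel" by (simp flip: borel_prod)
  have ae: "AE z in lebesgue_on open_square. f z * k z + g z * h z = ?P z"
    using f'(3) g'(3) h'(3) k'(3) by eventually_elim simp
  have sq: "open_square \<in> sets lebesgue" "open_square \<in> sets borel" by auto
  have P0: "?P z = 0" if "z \<notin> open_square" for z using f'(2)[OF that] g'(2)[OF that] by simp
  have Pint: "integrable lborel ?P"
    using prod lebesgue_on_cong_AE(1)[OF sq(1) borel_measurable_integrable[OF prod] ae]
      lebesgue_on_lborel(1)[OF sq(2) Pm P0] by blast
  have "(LINT z|lebesgue_on open_square. f z * k z + g z * h z) = (LINT z|lebesgue_on open_square. ?P z)"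
    by (rule lebesgue_on_cong_AE(2)[OF sq(1) borel_measurable_integrable[OF prod] ae])
  also have "\<dots> = (LINT z|lborel. ?P z)"
    by (rule lebesgue_on_lborel(2)[OF sq(2) Pm P0])
  also have "\<dots> = (LINT x|lborel. LINT y|lborel. ?P (x, y))"
    by (rule integral_lborel_fst[OF Pint, symmetric])
  also have "\<dots> = 0"
  proof (rule integral_eq_zero_AE)
    show "AE x in lborel. (LINT y|lborel. ?P (x, y)) = 0"
      using c d fG hx kx
    proof eventually_elim
      case (elim x)
      define hh kk where "hh s = h' (x, s)" and "kk s = k' (x, s)" for s
      have hh0: "hh y = 0" and kk0: "kk y = 0" if "y \<notin> {0<..<1}" for y
        using h'(2)[of "(x, y)"] k'(2)[of "(x, y)"] that by (auto simp: hh_def kk_def)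
      have hhi: "integrable lborel hh" and kki: "integrable lborel kk"
        using elim(4,5) by (simp_all add: hh_def[abs_def] kk_def[abs_def])
      show ?case
      proof (cases "0 < x \<and> x < 1")
        case False
        then have "?P (x, y) = 0" for y by (intro P0) auto
        then show ?thesis by simp
      next
        \<comment> \<open>The trace is available at every \<open>x\<close>, but the almost
          everywhere identities only on almost every line; continuity of \<open>G\<close> along the
          line links the two.\<close>
        case True
        have "AE y in lborel. 0 < y \<and> y < 1 \<longrightarrow> G (x, y) = c x + prim hh y"
          using elim(1,3) by eventually_elim (use True in \<open>auto simp: hh_def[abs_def]\<close>)
        moreover have "continuous_on {0..1} (\<lambda>y. G (x, y))"
          by (rule continuous_on_compose2[OF G(1)]) (use True in \<open>auto intro!: continuous_intros\<close>)
        ultimately have "G (x, 0) = c x" "G (x, 1) = c x + prim hh 1"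
          using boundary_values_if_AE_eq_prim[OF hhi] by blast+
        then have cx: "c x = 0" and "prim hh 1 = 0"
          using G(3)[of x] True by auto
        moreover have "prim hh 1 = (LINT y|lborel. hh y)"
          unfolding prim_def by (rule Bochner_Integration.integral_cong) (use hh0 in auto)
        ultimately have h0: "(LINT y|lborel. hh y) = 0" by simp
        note i1 = integral_prim_product(1)[OF hhi _ kki, OF hh0 kk0]
        have i2: "integrable lborel (\<lambda>y. d x * hh y)"
          using hhi by simp
        have "(LINT y|lborel. ?P (x, y)) = (LINT y|lborel. (prim hh y * kk y + prim kk y * hh y) + d x * hh y)"
        proof (rule integral_cong_AE)
          show "(\<lambda>y. ?P (x, y)) \<in> borel_measurable lborel" by simp
          show "(\<lambda>y. (prim hh y * kk y + prim kk y * hh y) + d x * hh y) \<in> borel_measurable lborel"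
            by (rule borel_measurable_integrable[OF Bochner_Integration.integrable_add[OF i1 i2]])
          show "AE y in lborel. ?P (x, y) = (prim hh y * kk y + prim kk y * hh y) + d x * hh y"
            using elim(1,2)
          proof eventually_elim
            case (elim y)
            show ?case
            proof (cases "0 < y \<and> y < 1")
              case True2: True
              then have "f' (x, y) = prim hh y" "g' (x, y) = d x + prim kk y"
                using elim True cx by (auto simp: hh_def[abs_def] kk_def[abs_def])
              then show ?thesis by (simp add: hh_def kk_def algebra_simps)
            next
              case False
              then have "hh y = 0" "kk y = 0" "?P (x, y) = 0" using hh0 kk0 by (auto intro!: P0)
              then show ?thesis by simp
            qed
          qed
        qed
        also have "\<dots> = (LINT y|lborel. prim hh y * kk y + prim kk y * hh y) + d x * (LINT y|lborel. hh y)"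
          using i1 i2 by simp
        also have "\<dots> = 0"
          using integral_prim_product(2)[OF hhi _ kki, OF hh0 kk0] h0 by simp
        finally show ?thesis .
      qed
    qed
  qed
  finally show ?thesis .
qed

subsection \<open>Families that are continuous in \<open>L\<^sup>2\<close>\<close>

lemma integrable_mult_L2:
  fixes f g :: "'a \<Rightarrow> real"
  assumes [measurable]: "f \<in> borel_measurable M" "g \<in> borel_measurable M"
    and f: "integrable M (\<lambda>x. (f x)\<^sup>2)" and g: "integrable M (\<lambda>x. (g x)\<^sup>2)"
  shows "integrable M (\<lambda>x. f x * g x)"
proof (rule Bochner_Integration.integrable_bound)
  show "integrable M (\<lambda>x. (f x)\<^sup>2 + (g x)\<^sup>2)" using f g by simp
  show "AE x in M. norm (f x * g x) \<le> norm ((f x)\<^sup>2 + (g x)\<^sup>2)"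
  proof (intro AE_I2)
    fix x
    have "2 * \<bar>f x\<bar> * \<bar>g x\<bar> \<le> (f x)\<^sup>2 + (g x)\<^sup>2"
      using sum_squares_bound[of "\<bar>f x\<bar>" "\<bar>g x\<bar>"] unfolding power2_abs .
    moreover have "0 \<le> \<bar>f x\<bar> * \<bar>g x\<bar>" by simp
    ultimately show "norm (f x * g x) \<le> norm ((f x)\<^sup>2 + (g x)\<^sup>2)"
      unfolding real_norm_def abs_mult by linarith
  qed
qed simp

lemma Cauchy_Schwarz_integral:
  fixes f g :: "'a \<Rightarrow> real"
  assumes [measurable]: "f \<in> borel_measurable M" "g \<in> borel_measurable M"
    and f: "integrable M (\<lambda>x. (f x)\<^sup>2)" and g: "integrable M (\<lambda>x. (g x)\<^sup>2)"
  shows "(LINT x|M. \<bar>f x * g x\<bar>) \<le> sqrt (LINT x|M. (f x)\<^sup>2) * sqrt (LINT x|M. (g x)\<^sup>2)"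
proof -
  have fg: "integrable M (\<lambda>x. \<bar>f x * g x\<bar>)"
    by (intro integrable_abs integrable_mult_L2 assms)
  have nn: "(\<integral>\<^sup>+x. (ennreal \<bar>h x\<bar>)\<^sup>2 \<partial>M) = ennreal (LINT x|M. (h x)\<^sup>2)"
    if "integrable M (\<lambda>x. (h x)\<^sup>2)" for h :: "'a \<Rightarrow> real"
  proof -
    have "(\<integral>\<^sup>+x. (ennreal \<bar>h x\<bar>)\<^sup>2 \<partial>M) = (\<integral>\<^sup>+x. ennreal ((h x)\<^sup>2) \<partial>M)"
      by (simp add: ennreal_power)
    also have "\<dots> = ennreal (LINT x|M. (h x)\<^sup>2)"
      by (rule nn_integral_eq_integral[OF that]) simp
    finally show ?thesis .
  qed
  have "(\<integral>\<^sup>+x. ennreal \<bar>f x\<bar> * ennreal \<bar>g x\<bar> \<partial>M) = (\<integral>\<^sup>+x. ennreal \<bar>f x * g x\<bar> \<partial>M)"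
    by (simp add: abs_mult ennreal_mult)
  also have "\<dots> = ennreal (LINT x|M. \<bar>f x * g x\<bar>)"
    by (rule nn_integral_eq_integral[OF fg]) simp
  finally have fgn: "(\<integral>\<^sup>+x. ennreal \<bar>f x\<bar> * ennreal \<bar>g x\<bar> \<partial>M) = ennreal (LINT x|M. \<bar>f x * g x\<bar>)" .
  have "(\<integral>\<^sup>+x. ennreal \<bar>f x\<bar> * ennreal \<bar>g x\<bar> \<partial>M)\<^sup>2 \<le>
      (\<integral>\<^sup>+x. (ennreal \<bar>f x\<bar>)\<^sup>2 \<partial>M) * (\<integral>\<^sup>+x. (ennreal \<bar>g x\<bar>)\<^sup>2 \<partial>M)"
    by (rule Cauchy_Schwarz_nn_integral) simp_all
  then have "ennreal ((LINT x|M. \<bar>f x * g x\<bar>)\<^sup>2) \<le> ennreal ((LINT x|M. (f x)\<^sup>2) * (LINT x|M. (g x)\<^sup>2))"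
    unfolding nn[OF f] nn[OF g] fgn by (simp only: ennreal_power ennreal_mult integral_nonneg_AE AE_I2 abs_ge_zero zero_le_power2 Bochner_Integration.integral_nonneg)
  then have "(LINT x|M. \<bar>f x * g x\<bar>)\<^sup>2 \<le> (LINT x|M. (f x)\<^sup>2) * (LINT x|M. (g x)\<^sup>2)"
    by (rule ennreal_le_iff[THEN iffD1, rotated]) (intro mult_nonneg_nonneg Bochner_Integration.integral_nonneg zero_le_power2)
  then show ?thesis
    unfolding real_sqrt_mult[symmetric] by (rule real_le_rsqrt)
qed

text \<open>Continuity of \<open>t \<mapsto> f t\<close> into \<open>L2\<close>, for scalar
  families. The induction term is a sum of products of two such families, a value and a first
  derivative, so Cauchy-Schwarz governs it.\<close>

definition L2_continuous :: "'a measure \<Rightarrow> real set \<Rightarrow> (real \<Rightarrow> 'a \<Rightarrow> real) \<Rightarrow> bool" where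
  "L2_continuous M I f \<longleftrightarrow>
     (\<forall>t\<in>I. f t \<in> borel_measurable M \<and> integrable M (\<lambda>x. (f t x)\<^sup>2)) \<and>
     (\<forall>t\<in>I. ((\<lambda>s. LINT x|M. (f s x - f t x)\<^sup>2) \<longlongrightarrow> 0) (at t within I))"

text \<open>On a finite measure space, pairing with the constant 1 turns each result about products
  into one about a single family.\<close>

lemma L2_continuous_const_1: "finite_measure M \<Longrightarrow> L2_continuous M I (\<lambda>t x. 1)"
  using finite_measure.integrable_const[of M "1::real"] by (simp add: L2_continuous_def)

lemma L2_continuous_integrable_mult:
  assumes "L2_continuous M I f" "L2_continuous M I g" "t \<in> I"
  shows "integrable M (\<lambda>x. f t x * g t x)"
  by (rule integrable_mult_L2) (use assms in \<open>simp_all add: L2_continuous_def\<close>)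

lemma L2_continuous_integrable:
  assumes "finite_measure M" "L2_continuous M I f" "t \<in> I"
  shows "integrable M (f t)"
  using L2_continuous_integrable_mult[OF assms(2) L2_continuous_const_1[OF assms(1)] assms(3)] by simp

text \<open>With \<open>df = f s - f t\<close> and \<open>dg = g s - g t\<close>, the difference of
  the products is \<open>df dg + df (g t) + (f t) dg\<close>. Cauchy-Schwarz bounds each integral by
  a product of \<open>L2\<close> norms that has a factor tending to 0.\<close>

lemma continuous_on_integral_mult_L2:
  assumes f: "L2_continuous M I f" and g: "L2_continuous M I g"
    and \<eta>[measurable]: "\<eta> \<in> borel_measurable M" and \<eta>1: "\<And>x. \<bar>\<eta> x\<bar> \<le> (1::real)"
  shows "continuous_on I (\<lambda>t. LINT x|M. \<eta> x * (f t x * g t x))"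
  unfolding continuous_on_def
proof
  fix t assume t: "t \<in> I"
  define N where "N h = sqrt (LINT x|M. (h x)\<^sup>2)" for h :: "'a \<Rightarrow> real"
  define \<alpha> where "\<alpha> s = N (\<lambda>x. f s x - f t x)" for s
  define \<beta> where "\<beta> s = N (\<lambda>x. g s x - g t x)" for s
  have ft: "f s \<in> borel_measurable M" "integrable M (\<lambda>x. (f s x)\<^sup>2)"
    and gt: "g s \<in> borel_measurable M" "integrable M (\<lambda>x. (g s x)\<^sup>2)" if "s \<in> I" for s
    using f g that by (auto simp: L2_continuous_def)
  have diff: "(\<lambda>x. h x - k x) \<in> borel_measurable M" "integrable M (\<lambda>x. (h x - k x)\<^sup>2)"
    if h: "h \<in> borel_measurable M" "integrable M (\<lambda>x. (h x)\<^sup>2)"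
      and k: "k \<in> borel_measurable M" "integrable M (\<lambda>x. (k x)\<^sup>2)" for h k :: "'a \<Rightarrow> real"
  proof -
    show "(\<lambda>x. h x - k x) \<in> borel_measurable M" using h k by simp
    have "integrable M (\<lambda>x. h x * k x)" by (intro integrable_mult_L2 h k)
    then have "integrable M (\<lambda>x. (h x)\<^sup>2 + (k x)\<^sup>2 - 2 * (h x * k x))" using h k by simp
    then show "integrable M (\<lambda>x. (h x - k x)\<^sup>2)"
      by (simp add: power2_diff mult.assoc)
  qed
  have prod_le: "\<bar>LINT x|M. \<eta> x * (h x * k x)\<bar> \<le> N h * N k"
    "integrable M (\<lambda>x. \<eta> x * (h x * k x))"
    if h: "h \<in> borel_measurable M" "integrable M (\<lambda>x. (h x)\<^sup>2)"
      and k: "k \<in> borel_measurable M" "integrable M (\<lambda>x. (k x)\<^sup>2)" for h k :: "'a \<Rightarrow> real"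
  proof -
    have i: "integrable M (\<lambda>x. h x * k x)" by (intro integrable_mult_L2 h k)
    show i2: "integrable M (\<lambda>x. \<eta> x * (h x * k x))"
      by (rule integrable_bounded_mult[OF i \<eta> \<eta>1])
    have "\<bar>LINT x|M. \<eta> x * (h x * k x)\<bar> \<le> (LINT x|M. \<bar>\<eta> x * (h x * k x)\<bar>)"
      by (rule integral_abs_bound)
    also have "\<dots> \<le> (LINT x|M. \<bar>h x * k x\<bar>)"
    proof (rule integral_mono)
      fix x
      have "\<bar>\<eta> x\<bar> * \<bar>h x * k x\<bar> \<le> 1 * \<bar>h x * k x\<bar>"
        using \<eta>1[of x] by (rule mult_right_mono) simp
      then show "\<bar>\<eta> x * (h x * k x)\<bar> \<le> \<bar>h x * k x\<bar>" by (simp add: abs_mult)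
    qed (use i i2 in \<open>auto intro: integrable_abs\<close>)
    also have "\<dots> \<le> N h * N k"
      unfolding N_def by (rule Cauchy_Schwarz_integral[OF h(1) k(1) h(2) k(2)])
    finally show "\<bar>LINT x|M. \<eta> x * (h x * k x)\<bar> \<le> N h * N k" .
  qed
  have bound: "\<bar>(LINT x|M. \<eta> x * (f s x * g s x)) - (LINT x|M. \<eta> x * (f t x * g t x))\<bar> \<le>
      \<alpha> s * \<beta> s + \<alpha> s * N (g t) + N (f t) * \<beta> s" if s: "s \<in> I" for s
  proof -
    let ?df = "\<lambda>x. f s x - f t x" and ?dg = "\<lambda>x. g s x - g t x"
    note df = diff[OF ft[OF s] ft[OF t]] and dg = diff[OF gt[OF s] gt[OF t]]
    note t1 = prod_le[OF df dg] and t2 = prod_le[OF df gt[OF t]] and t3 = prod_le[OF ft[OF t] dg]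
      and t4 = prod_le[OF ft[OF t] gt[OF t]]
    have "(\<lambda>x. \<eta> x * (f s x * g s x)) =
      (\<lambda>x. \<eta> x * (?df x * ?dg x) + \<eta> x * (?df x * g t x) + \<eta> x * (f t x * ?dg x) + \<eta> x * (f t x * g t x))"
      by (simp add: fun_eq_iff algebra_simps)
    then have "(LINT x|M. \<eta> x * (f s x * g s x)) - (LINT x|M. \<eta> x * (f t x * g t x)) =
      (LINT x|M. \<eta> x * (?df x * ?dg x)) + (LINT x|M. \<eta> x * (?df x * g t x)) + (LINT x|M. \<eta> x * (f t x * ?dg x))"
      using t1(2) t2(2) t3(2) t4(2) by simp
    then show ?thesis
      using t1(1) t2(1) t3(1) unfolding \<alpha>_def \<beta>_def by linarith
  qed
  have "((\<lambda>s. LINT x|M. (f s x - f t x)\<^sup>2) \<longlongrightarrow> 0) (at t within I)"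
    using f t by (auto simp: L2_continuous_def)
  from tendsto_real_sqrt[OF this] have \<alpha>: "(\<alpha> \<longlongrightarrow> 0) (at t within I)" by (simp add: \<alpha>_def[abs_def] N_def)
  have "((\<lambda>s. LINT x|M. (g s x - g t x)\<^sup>2) \<longlongrightarrow> 0) (at t within I)"
    using g t by (auto simp: L2_continuous_def)
  from tendsto_real_sqrt[OF this] have \<beta>: "(\<beta> \<longlongrightarrow> 0) (at t within I)" by (simp add: \<beta>_def[abs_def] N_def)
  have "((\<lambda>s. \<alpha> s * \<beta> s + \<alpha> s * N (g t) + N (f t) * \<beta> s) \<longlongrightarrow> 0 * 0 + 0 * N (g t) + N (f t) * 0) (at t within I)"
    by (intro tendsto_add tendsto_mult \<alpha> \<beta> tendsto_const)
  then have lim: "((\<lambda>s. \<alpha> s * \<beta> s + \<alpha> s * N (g t) + N (f t) * \<beta> s) \<longlongrightarrow> 0) (at t within I)" by simp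
  have "((\<lambda>s. (LINT x|M. \<eta> x * (f s x * g s x)) - (LINT x|M. \<eta> x * (f t x * g t x))) \<longlongrightarrow> 0) (at t within I)"
    by (rule Lim_null_comparison[OF _ lim]) (use bound in \<open>auto simp: eventually_at_filter\<close>)
  then show "((\<lambda>t. LINT x|M. \<eta> x * (f t x * g t x)) \<longlongrightarrow> (LINT x|M. \<eta> x * (f t x * g t x))) (at t within I)"
    by (simp only: LIM_zero_iff)
qed

text \<open>The squared \<open>L2\<close> norm is the case \<open>f = g\<close>,
  \<open>\<eta> = 1\<close> of the preceding continuity, hence bounded on a compact time interval.
  The uniform bound provides the majorant in time for \<open>mean_tested\<close>.\<close>

lemma L2_continuous_mult_bounded:
  assumes f: "L2_continuous M I f" and g: "L2_continuous M I g" and I: "compact I"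
  shows "\<exists>C. \<forall>t\<in>I. (LINT x|M. \<bar>f t x * g t x\<bar>) \<le> C"
proof -
  have "\<exists>C. \<forall>t\<in>I. (LINT x|M. (h t x)\<^sup>2) \<le> C" if h: "L2_continuous M I h" for h
  proof -
    have "continuous_on I (\<lambda>t. LINT x|M. 1 * (h t x * h t x))"
      by (rule continuous_on_integral_mult_L2[OF h h]) auto
    from compact_continuous_image[OF this I] have "bounded ((\<lambda>t. LINT x|M. 1 * (h t x * h t x)) ` I)"
      by (rule compact_imp_bounded)
    then obtain C where "\<And>t. t \<in> I \<Longrightarrow> \<bar>LINT x|M. 1 * (h t x * h t x)\<bar> \<le> C"
      by (auto simp: bounded_iff)
    then show ?thesis by (auto simp: power2_eq_square intro!: exI[of _ C] dest: abs_le_D1)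
  qed
  from this[OF f] this[OF g] obtain A B where
    A: "\<And>t. t \<in> I \<Longrightarrow> (LINT x|M. (f t x)\<^sup>2) \<le> A" and B: "\<And>t. t \<in> I \<Longrightarrow> (LINT x|M. (g t x)\<^sup>2) \<le> B"
    by blast
  have "(LINT x|M. \<bar>f t x * g t x\<bar>) \<le> sqrt A * sqrt B" if t: "t \<in> I" for t
  proof -
    have "(LINT x|M. \<bar>f t x * g t x\<bar>) \<le> sqrt (LINT x|M. (f t x)\<^sup>2) * sqrt (LINT x|M. (g t x)\<^sup>2)"
      using f g t by (intro Cauchy_Schwarz_integral) (auto simp: L2_continuous_def)
    also have "\<dots> \<le> sqrt A * sqrt B"
      using A[OF t] B[OF t] by (intro mult_mono) (auto intro: order_trans[OF _ A[OF t]])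
    finally show ?thesis .
  qed
  then show ?thesis by blast
qed

subsection \<open>Continuity in the Sobolev norm\<close>

lemma finite_words: "finite (words r :: 'a::euclidean_space list set)"
  unfolding words_def by (rule finite_lists_length_le) simp

text \<open>The space only promises that some weak derivative is square integrable; uniqueness
  transfers this to the one selected by \<open>weak_deriv\<close>.\<close>

lemma sobolev_space_weak_deriv:
  fixes f :: "real \<times> real \<Rightarrow> 'b::euclidean_space"
  assumes U: "open U" and f: "f \<in> sobolev_space r U" and vs: "vs \<in> words r"
  shows "has_weak_deriv U vs f (weak_deriv U vs f)" "square_integrable U (weak_deriv U vs f)"
proof -
  obtain g where g: "has_weak_deriv U vs f g" "square_integrable U g"
    using f vs unfolding sobolev_space_def by blast
  show w: "has_weak_deriv U vs f (weak_deriv U vs f)"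
    by (rule has_weak_deriv_weak_deriv[OF g(1)])
  have U': "U \<in> sets lebesgue" using U by auto
  have ae: "AE x in lebesgue_on U. g x = weak_deriv U vs f x"
    by (rule has_weak_deriv_unique[OF U g(1) w])
  have gm: "g \<in> borel_measurable (lebesgue_on U)" and gi: "integrable (lebesgue_on U) (\<lambda>x. (norm (g x))\<^sup>2)"
    using g(2) by (auto simp: square_integrable_def)
  have "AE x in lebesgue_on U. (norm (g x))\<^sup>2 = (norm (weak_deriv U vs f x))\<^sup>2"
    using ae by eventually_elim simp
  from lebesgue_on_cong_AE(1)[OF U' borel_measurable_integrable[OF gi] this] gi
  show "square_integrable U (weak_deriv U vs f)"
    unfolding square_integrable_def
    using borel_measurable_lebesgue_on_AE[OF U' gm ae] by blast
qed

lemma has_weak_deriv_Nil: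
  assumes "has_weak_deriv U [] f g"
  shows "has_weak_deriv U [] f f"
proof -
  have "locally_integrable U f" using assms unfolding has_weak_deriv_def by blast
  then show ?thesis unfolding has_weak_deriv_def by simp
qed

text \<open>The Sobolev norm of \<open>f s - f t\<close> contains the derivative chosen for the
  difference, not the difference of the chosen derivatives. The two agree almost everywhere, and a
  single summand is at most the whole sum.\<close>

lemma tendsto_L2_weak_deriv:
  fixes f :: "real \<Rightarrow> real \<times> real \<Rightarrow> 'b::euclidean_space"
  assumes U: "open U" and f: "continuous_into_sobolev I r U f" and vs: "vs \<in> words r" and t: "t \<in> I"
  shows "((\<lambda>s. LINT x|lebesgue_on U. (norm (weak_deriv U vs (f s) x - weak_deriv U vs (f t) x))\<^sup>2) \<longlongrightarrow> 0) (at t within I)"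
proof -
  have U': "U \<in> sets lebesgue" using U by auto
  have vs': "vs \<in> lists Basis" using vs by (auto simp: words_def)
  have ft: "f s \<in> sobolev_space r U" if "s \<in> I" for s
    using f that by (auto simp: continuous_into_sobolev_def)
  have lim: "((\<lambda>s. (sobolev_norm r U (\<lambda>x. f s x - f t x))\<^sup>2) \<longlongrightarrow> 0\<^sup>2) (at t within I)"
    using f t by (intro tendsto_power) (auto simp: continuous_into_sobolev_def)
  have le: "(LINT x|lebesgue_on U. (norm (weak_deriv U vs (f s) x - weak_deriv U vs (f t) x))\<^sup>2) \<le>
      (sobolev_norm r U (\<lambda>x. f s x - f t x))\<^sup>2" if s: "s \<in> I" for s
  proof -
    let ?d = "\<lambda>x. weak_deriv U vs (f s) x - weak_deriv U vs (f t) x"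
    note ws = sobolev_space_weak_deriv[OF U ft[OF s] vs] and wt = sobolev_space_weak_deriv[OF U ft[OF t] vs]
    have w: "has_weak_deriv U vs (\<lambda>x. f s x - f t x) ?d"
      by (rule has_weak_deriv_diff[OF U vs' ws(1) wt(1)])
    have ae: "AE x in lebesgue_on U. ?d x = weak_deriv U vs (\<lambda>x. f s x - f t x) x"
      by (rule has_weak_deriv_unique[OF U w has_weak_deriv_weak_deriv[OF w]])
    have "?d \<in> borel_measurable (lebesgue_on U)"
      using ws(2) wt(2) by (intro borel_measurable_diff) (auto simp: square_integrable_def)
    then have m: "(\<lambda>x. (norm (?d x))\<^sup>2) \<in> borel_measurable (lebesgue_on U)" by simp
    have "(LINT x|lebesgue_on U. (norm (?d x))\<^sup>2) = (LINT x|lebesgue_on U. (norm (weak_deriv U vs (\<lambda>x. f s x - f t x) x))\<^sup>2)"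
    proof (rule lebesgue_on_cong_AE(2)[OF U' m])
      show "AE x in lebesgue_on U. (norm (?d x))\<^sup>2 = (norm (weak_deriv U vs (\<lambda>x. f s x - f t x) x))\<^sup>2"
        using ae by eventually_elim simp
    qed
    also have "\<dots> \<le> (\<Sum>vs \<in> words r. LINT x|lebesgue_on U. (norm (weak_deriv U vs (\<lambda>x. f s x - f t x) x))\<^sup>2)"
      by (rule member_le_sum[OF vs _ finite_words]) simp
    also have "\<dots> = (sobolev_norm r U (\<lambda>x. f s x - f t x))\<^sup>2"
      unfolding sobolev_norm_def by (subst real_sqrt_pow2) (auto intro: sum_nonneg)
    finally show ?thesis .
  qed
  show ?thesis
  proof (rule tendsto_sandwich[OF _ _ tendsto_const])
    show "((\<lambda>s. (sobolev_norm r U (\<lambda>x. f s x - f t x))\<^sup>2) \<longlongrightarrow> 0) (at t within I)"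
      using lim by simp
    show "\<forall>\<^sub>F s in at t within I. (LINT x|lebesgue_on U. (norm (weak_deriv U vs (f s) x - weak_deriv U vs (f t) x))\<^sup>2)
        \<le> (sobolev_norm r U (\<lambda>x. f s x - f t x))\<^sup>2"
      using le by (simp add: eventually_at_filter)
  qed simp
qed

section \<open>Scalar components of families that are continuous into a Sobolev space\<close>

lemma L2_continuous_functional:
  fixes D :: "real \<Rightarrow> 'a \<Rightarrow> 'b::euclidean_space" and L :: "'b \<Rightarrow> real"
  assumes L: "bounded_linear L" "\<And>v. \<bar>L v\<bar> \<le> norm v"
    and D: "\<And>t. t \<in> I \<Longrightarrow> D t \<in> borel_measurable M" "\<And>t. t \<in> I \<Longrightarrow> integrable M (\<lambda>x. (norm (D t x))\<^sup>2)"
    and lim: "\<And>t. t \<in> I \<Longrightarrow> ((\<lambda>s. LINT x|M. (norm (D s x - D t x))\<^sup>2) \<longlongrightarrow> 0) (at t within I)"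
  shows "L2_continuous M I (\<lambda>t x. L (D t x))"
proof -
  interpret L: bounded_linear L by (rule L(1))
  have sq: "(L v)\<^sup>2 \<le> (norm v)\<^sup>2" for v
    using power_mono[OF L(2)[of v], of 2] by (simp only: power2_abs abs_ge_zero)
  have sqd: "(L v - L w)\<^sup>2 \<le> (norm (v - w))\<^sup>2" for v w
    using sq[of "v - w"] by (simp only: L.diff)
  have m: "(\<lambda>x. L (D t x)) \<in> borel_measurable M" if "t \<in> I" for t
    by (rule borel_measurable_continuous_on[OF linear_continuous_on[OF L(1)] D(1)[OF that]])
  have i: "integrable M (\<lambda>x. (L (D t x))\<^sup>2)" if "t \<in> I" for t
    by (rule Bochner_Integration.integrable_bound[OF D(2)[OF that]]) (use m[OF that] sq in simp_all)
  \<comment> \<open>The comparison of integrals needs an integrable majorant: if it were not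
    integrable, its integral would be 0 by convention.\<close>
  have id: "integrable M (\<lambda>x. (norm (D s x - D t x))\<^sup>2)" if s: "s \<in> I" and t: "t \<in> I" for s t
  proof (rule Bochner_Integration.integrable_bound)
    show "integrable M (\<lambda>x. 2 * (norm (D s x))\<^sup>2 + 2 * (norm (D t x))\<^sup>2)"
      using D(2)[OF s] D(2)[OF t] by simp
    show "(\<lambda>x. (norm (D s x - D t x))\<^sup>2) \<in> borel_measurable M"
      using D(1)[OF s] D(1)[OF t] by simp
    show "AE x in M. norm ((norm (D s x - D t x))\<^sup>2) \<le> norm (2 * (norm (D s x))\<^sup>2 + 2 * (norm (D t x))\<^sup>2)"
    proof (intro AE_I2)
      fix x
      have "(norm (D s x - D t x))\<^sup>2 \<le> (norm (D s x) + norm (D t x))\<^sup>2"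
        by (intro power_mono norm_triangle_ineq4) simp
      also have "\<dots> \<le> 2 * (norm (D s x))\<^sup>2 + 2 * (norm (D t x))\<^sup>2"
        using sum_squares_bound[of "norm (D s x)" "norm (D t x)"] by (simp add: power2_sum)
      finally show "norm ((norm (D s x - D t x))\<^sup>2) \<le> norm (2 * (norm (D s x))\<^sup>2 + 2 * (norm (D t x))\<^sup>2)" by simp
    qed
  qed
  have "((\<lambda>s. LINT x|M. (L (D s x) - L (D t x))\<^sup>2) \<longlongrightarrow> 0) (at t within I)" if t: "t \<in> I" for t
  proof (rule tendsto_sandwich[OF _ _ tendsto_const lim[OF t]])
    have "(LINT x|M. (L (D s x) - L (D t x))\<^sup>2) \<le> (LINT x|M. (norm (D s x - D t x))\<^sup>2)" if s: "s \<in> I" for s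
    proof (rule integral_mono[OF _ id[OF s t]])
      show "integrable M (\<lambda>x. (L (D s x) - L (D t x))\<^sup>2)"
        by (rule Bochner_Integration.integrable_bound[OF id[OF s t]]) (use m[OF s] m[OF t] sqd in simp_all)
    qed (rule sqd)
    then show "\<forall>\<^sub>F s in at t within I. (LINT x|M. (L (D s x) - L (D t x))\<^sup>2) \<le> (LINT x|M. (norm (D s x - D t x))\<^sup>2)"
      by (simp add: eventually_at_filter)
  qed simp
  then show ?thesis
    unfolding L2_continuous_def using m i by blast
qed

lemma continuous_into_sobolev_L2_continuous_deriv:
  fixes f :: "real \<Rightarrow> real \<times> real \<Rightarrow> 'b::euclidean_space"
  assumes U: "open U" and f: "continuous_into_sobolev I r U f" and vs: "vs \<in> words r"
    and L: "bounded_linear L" "\<And>v. \<bar>L v\<bar> \<le> norm v"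
  shows "L2_continuous (lebesgue_on U) I (\<lambda>t x. L (weak_deriv U vs (f t) x))"
proof (rule L2_continuous_functional[OF L])
  fix t assume t: "t \<in> I"
  have "f t \<in> sobolev_space r U"
    using f t by (auto simp: continuous_into_sobolev_def)
  note * = sobolev_space_weak_deriv[OF U this vs]
  show "weak_deriv U vs (f t) \<in> borel_measurable (lebesgue_on U)"
    "integrable (lebesgue_on U) (\<lambda>x. (norm (weak_deriv U vs (f t) x))\<^sup>2)"
    using *(2) by (auto simp: square_integrable_def)
  show "((\<lambda>s. LINT x|lebesgue_on U. (norm (weak_deriv U vs (f s) x - weak_deriv U vs (f t) x))\<^sup>2) \<longlongrightarrow> 0) (at t within I)"
    by (rule tendsto_L2_weak_deriv[OF U f vs t])
qed

lemma L2_continuous_cong_AE: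
  fixes f g :: "real \<Rightarrow> 'a::euclidean_space \<Rightarrow> real"
  assumes U: "U \<in> sets lebesgue" and f: "L2_continuous (lebesgue_on U) I f"
    and ae: "\<And>t. t \<in> I \<Longrightarrow> AE x in lebesgue_on U. f t x = g t x"
  shows "L2_continuous (lebesgue_on U) I g"
proof -
  have fm: "f t \<in> borel_measurable (lebesgue_on U)" "integrable (lebesgue_on U) (\<lambda>x. (f t x)\<^sup>2)" if "t \<in> I" for t
    using f that by (auto simp: L2_continuous_def)
  have gm: "g t \<in> borel_measurable (lebesgue_on U)" if "t \<in> I" for t
    by (rule borel_measurable_lebesgue_on_AE[OF U fm(1)[OF that] ae[OF that]])
  have gi: "integrable (lebesgue_on U) (\<lambda>x. (g t x)\<^sup>2)" if t: "t \<in> I" for t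
  proof -
    have "AE x in lebesgue_on U. (f t x)\<^sup>2 = (g t x)\<^sup>2"
      using ae[OF t] by eventually_elim simp
    from lebesgue_on_cong_AE(1)[OF U borel_measurable_integrable[OF fm(2)[OF t]] this] fm(2)[OF t]
    show ?thesis by (simp only:)
  qed
  have "(LINT x|lebesgue_on U. (f s x - f t x)\<^sup>2) = (LINT x|lebesgue_on U. (g s x - g t x)\<^sup>2)"
    if s: "s \<in> I" and t: "t \<in> I" for s t
  proof (rule lebesgue_on_cong_AE(2)[OF U])
    show "(\<lambda>x. (f s x - f t x)\<^sup>2) \<in> borel_measurable (lebesgue_on U)"
      using fm(1)[OF s] fm(1)[OF t] by simp
    show "AE x in lebesgue_on U. (f s x - f t x)\<^sup>2 = (g s x - g t x)\<^sup>2"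
      using ae[OF s] ae[OF t] by eventually_elim simp
  qed
  then have eq: "((\<lambda>s. LINT x|lebesgue_on U. (g s x - g t x)\<^sup>2) \<longlongrightarrow> 0) (at t within I) \<longleftrightarrow>
      ((\<lambda>s. LINT x|lebesgue_on U. (f s x - f t x)\<^sup>2) \<longlongrightarrow> 0) (at t within I)" if "t \<in> I" for t
    using that by (intro Lim_cong_within) auto
  show ?thesis
    unfolding L2_continuous_def using gm gi eq f by (auto simp: L2_continuous_def)
qed

text \<open>The order-zero term of the norm involves \<open>weak_deriv U []\<close>, itself a choice
  that agrees with the function only almost everywhere.\<close>

lemma continuous_into_sobolev_L2_continuous:
  fixes f :: "real \<Rightarrow> real \<times> real \<Rightarrow> 'b::euclidean_space"
  assumes U: "open U" and f: "continuous_into_sobolev I r U f"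
    and L: "bounded_linear L" "\<And>v. \<bar>L v\<bar> \<le> norm v"
  shows "L2_continuous (lebesgue_on U) I (\<lambda>t x. L (f t x))"
proof (rule L2_continuous_cong_AE)
  have Nil: "[] \<in> words r" by (simp add: words_def)
  show "L2_continuous (lebesgue_on U) I (\<lambda>t x. L (weak_deriv U [] (f t) x))"
    by (rule continuous_into_sobolev_L2_continuous_deriv[OF U f Nil L])
  fix t assume "t \<in> I"
  then have "f t \<in> sobolev_space r U"
    using f by (auto simp: continuous_into_sobolev_def)
  from sobolev_space_weak_deriv(1)[OF U this Nil]
  have "AE x in lebesgue_on U. weak_deriv U [] (f t) x = f t x"
    using has_weak_deriv_unique[OF U] has_weak_deriv_Nil by blast
  then show "AE x in lebesgue_on U. L (weak_deriv U [] (f t) x) = L (f t x)"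
    by eventually_elim simp
qed (use U in auto)

subsection \<open>The induction equation\<close>

text \<open>The first component of \<open>F\<close> is \<open>u\<close>, the second is
  \<open>B\<close>, and the value is \<open>u . grad B - B . grad u\<close>. The derivatives are
  taken of the pair, because continuity in time is assumed for the pair; \<open>advect\<close> uses
  derivatives chosen for \<open>u\<close> and \<open>B\<close> separately.\<close>

definition induction_term :: "(real \<times> real \<Rightarrow> (real \<times> real) \<times> (real \<times> real)) \<Rightarrow> real \<times> real \<Rightarrow> real \<times> real" where
  "induction_term F z =
     fst (fst (F z)) *\<^sub>R snd (Dx F z) + snd (fst (F z)) *\<^sub>R snd (Dy F z) -
     (fst (snd (F z)) *\<^sub>R fst (Dx F z) + snd (snd (F z)) *\<^sub>R fst (Dy F z))"

lemma in_words:
  "1 \<le> r \<Longrightarrow> [(1, 0)] \<in> (words r :: (real \<times> real) list set)"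
  "1 \<le> r \<Longrightarrow> [(0, 1)] \<in> (words r :: (real \<times> real) list set)"
  by (auto simp: words_def Basis_prod_def)

lemma in_lists_Basis: "[(1, 0)] \<in> lists (Basis :: (real \<times> real) set)" "[(0, 1)] \<in> lists (Basis :: (real \<times> real) set)"
  by (auto simp: Basis_prod_def)

lemma finite_measure_open_square: "finite_measure (lebesgue_on open_square)"
proof (rule finite_measureI)
  have "emeasure (lebesgue_on open_square) (space (lebesgue_on open_square)) = emeasure lborel open_square"
    by (simp add: emeasure_restrict_space)
  also have "\<dots> \<le> emeasure lborel (cbox (0, 0) (1, 1) :: (real \<times> real) set)"
  proof (rule emeasure_mono)
    show "open_square \<subseteq> cbox (0, 0) (1, 1 :: real)" by (auto simp: cbox_Pair_eq)
  qed simp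
  also have "\<dots> < \<infinity>" by (rule emeasure_lborel_cbox_finite)
  finally show "emeasure (lebesgue_on open_square) (space (lebesgue_on open_square)) \<noteq> \<infinity>" by simp
qed

text \<open>Two independent choices are compared: the derivative chosen for a component and the
  component of the derivative chosen for the pair.\<close>

lemma weak_deriv_bounded_linear_AE:
  fixes F :: "real \<times> real \<Rightarrow> 'b::euclidean_space" and L :: "'b \<Rightarrow> 'c::euclidean_space"
  assumes F: "F \<in> sobolev_space r open_square" and vs: "vs \<in> words r" and L: "bounded_linear L"
  shows "AE z in lebesgue_on open_square. weak_deriv open_square vs (\<lambda>z. L (F z)) z = L (weak_deriv open_square vs F z)"
proof -
  have vs': "vs \<in> lists Basis" using vs by (auto simp: words_def)
  have w: "has_weak_deriv open_square vs (\<lambda>z. L (F z)) (\<lambda>z. L (weak_deriv open_square vs F z))"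
    by (rule has_weak_deriv_bounded_linear[OF open_open_square vs' sobolev_space_weak_deriv(1)[OF open_open_square F vs] L])
  show ?thesis
    by (rule has_weak_deriv_unique[OF open_open_square has_weak_deriv_weak_deriv[OF w] w])
qed

lemma advect_eq_induction_term:
  assumes F: "F \<in> sobolev_space r open_square" and r: "1 \<le> r"
  shows "AE z in lebesgue_on open_square.
    advect (\<lambda>z. fst (F z)) (\<lambda>z. snd (F z)) z - advect (\<lambda>z. snd (F z)) (\<lambda>z. fst (F z)) z = induction_term F z"
  using weak_deriv_bounded_linear_AE[OF F in_words(1)[OF r] bounded_linear_fst]
    weak_deriv_bounded_linear_AE[OF F in_words(1)[OF r] bounded_linear_snd]
    weak_deriv_bounded_linear_AE[OF F in_words(2)[OF r] bounded_linear_fst]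
    weak_deriv_bounded_linear_AE[OF F in_words(2)[OF r] bounded_linear_snd]
proof eventually_elim
  case (elim z)
  then show ?case unfolding advect_def induction_term_def by (simp only:)
qed

lemma bounded_linear_components:
  "bounded_linear (\<lambda>v :: (real \<times> real) \<times> (real \<times> real). fst (fst v))"
  "bounded_linear (\<lambda>v :: (real \<times> real) \<times> (real \<times> real). snd (fst v))"
  "bounded_linear (\<lambda>v :: (real \<times> real) \<times> (real \<times> real). fst (snd v))"
  "bounded_linear (\<lambda>v :: (real \<times> real) \<times> (real \<times> real). snd (snd v))"
  by (intro bounded_linear_compose[OF bounded_linear_fst] bounded_linear_compose[OF bounded_linear_snd]
      bounded_linear_fst bounded_linear_snd)+

lemma abs_fst_le: "\<bar>fst v\<bar> \<le> norm (v :: real \<times> real)"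
  and abs_snd_le: "\<bar>snd v\<bar> \<le> norm (v :: real \<times> real)"
  using norm_fst_le[of "fst v" "snd v"] norm_snd_le[of "snd v" "fst v"] by auto

lemma norm_fst_snd_le:
  fixes v :: "'a::real_normed_vector \<times> 'b::real_normed_vector"
  shows "norm (fst v) \<le> norm v" "norm (snd v) \<le> norm v"
  using norm_fst_le[of "fst v" "snd v"] norm_snd_le[of "snd v" "fst v"] by auto

text \<open>For a coordinate \<open>\<pi>\<close>, the term is a signed sum of four products of a
  value and a derivative, each factor continuous in time into \<open>L2\<close>. Integrability,
  continuity of weighted integrals and uniform \<open>L1\<close> bounds then follow summand by
  summand.\<close>

lemma induction_term_L2:
  fixes F :: "real \<Rightarrow> real \<times> real \<Rightarrow> (real \<times> real) \<times> (real \<times> real)" and \<pi> :: "real \<times> real \<Rightarrow> real"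
  assumes F: "continuous_into_sobolev I r open_square F" and r: "1 \<le> r"
    and \<pi>: "bounded_linear \<pi>" "\<And>v. \<bar>\<pi> v\<bar> \<le> norm v"
  shows "\<And>t. t \<in> I \<Longrightarrow> integrable (lebesgue_on open_square) (\<lambda>z. \<pi> (induction_term (F t) z))"
    and "\<And>\<eta>. \<eta> \<in> borel_measurable (lebesgue_on open_square) \<Longrightarrow> (\<And>z. \<bar>\<eta> z\<bar> \<le> 1) \<Longrightarrow>
      continuous_on I (\<lambda>t. LINT z|lebesgue_on open_square. \<eta> z * \<pi> (induction_term (F t) z))"
    and "compact I \<Longrightarrow> \<exists>C. \<forall>t\<in>I. (LINT z|lebesgue_on open_square. \<bar>\<pi> (induction_term (F t) z)\<bar>) \<le> C"
proof -
  interpret \<pi>: bounded_linear \<pi> by (rule \<pi>(1))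
  let ?M = "lebesgue_on open_square"
  note val = continuous_into_sobolev_L2_continuous[OF open_open_square F]
  note der = continuous_into_sobolev_L2_continuous_deriv[OF open_open_square F]
  have le: "\<bar>fst (fst v)\<bar> \<le> norm v" "\<bar>snd (fst v)\<bar> \<le> norm v" "\<bar>fst (snd v)\<bar> \<le> norm v" "\<bar>snd (snd v)\<bar> \<le> norm v"
    for v :: "(real \<times> real) \<times> (real \<times> real)"
    using abs_fst_le abs_snd_le norm_fst_snd_le[of v] order_trans by blast+
  have a1: "L2_continuous ?M I (\<lambda>t z. fst (fst (F t z)))"
    by (rule val[OF bounded_linear_components(1)]) (rule le)
  have a2: "L2_continuous ?M I (\<lambda>t z. snd (fst (F t z)))"
    by (rule val[OF bounded_linear_components(2)]) (rule le)
  have a3: "L2_continuous ?M I (\<lambda>t z. fst (snd (F t z)))"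
    by (rule val[OF bounded_linear_components(3)]) (rule le)
  have a4: "L2_continuous ?M I (\<lambda>t z. snd (snd (F t z)))"
    by (rule val[OF bounded_linear_components(4)]) (rule le)
  have lef: "\<bar>\<pi> (fst v)\<bar> \<le> norm v" and les: "\<bar>\<pi> (snd v)\<bar> \<le> norm v" for v :: "(real \<times> real) \<times> (real \<times> real)"
    using \<pi>(2) norm_fst_snd_le[of v] order_trans by blast+
  have d1: "L2_continuous ?M I (\<lambda>t z. \<pi> (snd (Dx (F t) z)))"
    by (rule der[OF in_words(1)[OF r] bounded_linear_compose[OF \<pi>(1) bounded_linear_snd]]) (rule les)
  have d2: "L2_continuous ?M I (\<lambda>t z. \<pi> (snd (Dy (F t) z)))"
    by (rule der[OF in_words(2)[OF r] bounded_linear_compose[OF \<pi>(1) bounded_linear_snd]]) (rule les)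
  have d3: "L2_continuous ?M I (\<lambda>t z. \<pi> (fst (Dx (F t) z)))"
    by (rule der[OF in_words(1)[OF r] bounded_linear_compose[OF \<pi>(1) bounded_linear_fst]]) (rule lef)
  have d4: "L2_continuous ?M I (\<lambda>t z. \<pi> (fst (Dy (F t) z)))"
    by (rule der[OF in_words(2)[OF r] bounded_linear_compose[OF \<pi>(1) bounded_linear_fst]]) (rule lef)
  \<comment> \<open>Indexing the four products lets each property be proved for all of them at
    once.\<close>
  define P where "P i =
    (if i = 0 then (\<lambda>t z. fst (fst (F t z)) * \<pi> (snd (Dx (F t) z)))
     else if i = 1 then (\<lambda>t z. snd (fst (F t z)) * \<pi> (snd (Dy (F t) z)))
     else if i = 2 then (\<lambda>t z. fst (snd (F t z)) * \<pi> (fst (Dx (F t) z)))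
     else (\<lambda>t z. snd (snd (F t z)) * \<pi> (fst (Dy (F t) z))))" for i :: nat
  have eq: "\<pi> (induction_term (F t) z) = P 0 t z + P 1 t z - (P 2 t z + P 3 t z)" for t z
    by (simp add: induction_term_def P_def \<pi>.add \<pi>.diff \<pi>.scaleR)
  have Pi: "integrable ?M (\<lambda>z. P i t z)" if "t \<in> I" for i t
    unfolding P_def
    using L2_continuous_integrable_mult[OF a1 d1 that] L2_continuous_integrable_mult[OF a2 d2 that]
      L2_continuous_integrable_mult[OF a3 d3 that] L2_continuous_integrable_mult[OF a4 d4 that] by auto
  show "integrable ?M (\<lambda>z. \<pi> (induction_term (F t) z))" if "t \<in> I" for t
    unfolding eq using Pi[OF that] by simp
  show "continuous_on I (\<lambda>t. LINT z|?M. \<eta> z * \<pi> (induction_term (F t) z))"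
    if \<eta>: "\<eta> \<in> borel_measurable ?M" "\<And>z. \<bar>\<eta> z\<bar> \<le> 1" for \<eta>
  proof -
    have Pc: "continuous_on I (\<lambda>t. LINT z|?M. \<eta> z * P i t z)" for i
      unfolding P_def
      using continuous_on_integral_mult_L2[OF a1 d1 \<eta>] continuous_on_integral_mult_L2[OF a2 d2 \<eta>]
        continuous_on_integral_mult_L2[OF a3 d3 \<eta>] continuous_on_integral_mult_L2[OF a4 d4 \<eta>] by simp
    have "(LINT z|?M. \<eta> z * \<pi> (induction_term (F t) z)) =
        (LINT z|?M. \<eta> z * P 0 t z) + (LINT z|?M. \<eta> z * P 1 t z) - ((LINT z|?M. \<eta> z * P 2 t z) + (LINT z|?M. \<eta> z * P 3 t z))"
      if "t \<in> I" for t
      unfolding eq right_diff_distrib distrib_left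
      using integrable_bounded_mult[OF Pi[OF that] \<eta>] by simp
    then show ?thesis
      by (subst continuous_on_cong[OF refl]) (auto intro!: continuous_on_diff continuous_on_add Pc)
  qed
  show "\<exists>C. \<forall>t\<in>I. (LINT z|?M. \<bar>\<pi> (induction_term (F t) z)\<bar>) \<le> C" if I: "compact I"
  proof -
    have "\<exists>C. \<forall>t\<in>I. (LINT z|?M. \<bar>P i t z\<bar>) \<le> C" for i
      unfolding P_def
      using L2_continuous_mult_bounded[OF a1 d1 I] L2_continuous_mult_bounded[OF a2 d2 I]
        L2_continuous_mult_bounded[OF a3 d3 I] L2_continuous_mult_bounded[OF a4 d4 I] by simp
    then obtain C where C: "\<And>i t. t \<in> I \<Longrightarrow> (LINT z|?M. \<bar>P i t z\<bar>) \<le> C i" by metis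
    have "(LINT z|?M. \<bar>\<pi> (induction_term (F t) z)\<bar>) \<le> C 0 + C 1 + C 2 + C 3" if t: "t \<in> I" for t
    proof -
      have "(LINT z|?M. \<bar>\<pi> (induction_term (F t) z)\<bar>) \<le> (LINT z|?M. \<bar>P 0 t z\<bar> + \<bar>P 1 t z\<bar> + \<bar>P 2 t z\<bar> + \<bar>P 3 t z\<bar>)"
        unfolding eq
        by (rule integral_mono) (auto intro!: integrable_abs Bochner_Integration.integrable_add
            Bochner_Integration.integrable_diff Pi[OF t])
      also have "\<dots> = (LINT z|?M. \<bar>P 0 t z\<bar>) + (LINT z|?M. \<bar>P 1 t z\<bar>) + (LINT z|?M. \<bar>P 2 t z\<bar>) + (LINT z|?M. \<bar>P 3 t z\<bar>)"
        using integrable_abs[OF Pi[OF t]] by simp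
      finally show ?thesis using C[OF t, of 0] C[OF t, of 1] C[OF t, of 2] C[OF t, of 3] by linarith
    qed
    then show ?thesis by blast
  qed
qed

text \<open>Since \<open>u\<close> and \<open>B\<close> are divergence free, the first component of the induction term equals
  \<open>\<partial>\<^sub>y (u\<^sup>2 B\<^sup>1 - B\<^sup>2 u\<^sup>1)\<close>: no \<open>x\<close>-derivative is left, which is why
  no boundary condition on the sides \<open>x = 0\<close> and \<open>x = 1\<close> is needed.\<close>

lemma integral_induction_term_eq_0:
  assumes F: "F \<in> sobolev_space r open_square" and r: "1 \<le> r"
    and divu: "divergence_free (\<lambda>z. fst (F z))" and divB: "divergence_free (\<lambda>z. snd (F z))"
    and u2: "zero_at_top_and_bottom (\<lambda>z. snd (fst (F z)))" and B2: "zero_at_top_and_bottom (\<lambda>z. snd (snd (F z)))"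
  shows "(LINT z|lebesgue_on open_square. fst (induction_term F z)) = 0"
proof -
  let ?M = "lebesgue_on open_square"
  \<comment> \<open>A single function is treated as a family over the one-point time set
    \<open>{0}\<close>, where continuity is trivial, so that the integrability results for families
    apply.\<close>
  have cont: "continuous_into_sobolev {0} r open_square (\<lambda>t. F)"
    using F by (simp add: continuous_into_sobolev_def at_within_def)
  have sq: "open_square \<in> sets lebesgue" by auto
  note val = continuous_into_sobolev_L2_continuous[OF open_open_square cont]
  note der = continuous_into_sobolev_L2_continuous_deriv[OF open_open_square cont in_words(2)[OF r]]
  have le: "\<bar>fst (fst v)\<bar> \<le> norm v" "\<bar>snd (fst v)\<bar> \<le> norm v" "\<bar>fst (snd v)\<bar> \<le> norm v" "\<bar>snd (snd v)\<bar> \<le> norm v"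
    for v :: "(real \<times> real) \<times> (real \<times> real)"
    using abs_fst_le abs_snd_le norm_fst_snd_le[of v] order_trans by blast+
  note bl = bounded_linear_components
  note a = val[OF bl(1) le(1)] val[OF bl(2) le(2)] val[OF bl(3) le(3)] val[OF bl(4) le(4)]
  note d = der[OF bl(1) le(1)] der[OF bl(2) le(2)] der[OF bl(3) le(3)] der[OF bl(4) le(4)]
  note int = L2_continuous_integrable[OF finite_measure_open_square _ singletonI]
  note prod = L2_continuous_integrable_mult[OF _ _ singletonI]
  note wd = has_weak_deriv_bounded_linear[OF open_open_square in_lists_Basis(2)
      sobolev_space_weak_deriv(1)[OF open_open_square F in_words(2)[OF r]]]
  have i1: "integrable ?M (\<lambda>z. snd (fst (F z)) * fst (snd (Dy F z)) + fst (snd (F z)) * snd (fst (Dy F z)))"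
    by (intro Bochner_Integration.integrable_add prod[OF a(2) d(3)] prod[OF a(3) d(2)])
  have i2: "integrable ?M (\<lambda>z. snd (snd (F z)) * fst (fst (Dy F z)) + fst (fst (F z)) * snd (snd (Dy F z)))"
    by (intro Bochner_Integration.integrable_add prod[OF a(4) d(1)] prod[OF a(1) d(4)])
  \<comment> \<open>The product with vanishing trace is \<open>u2 * B1\<close> here, through the
    trace of \<open>u2\<close>, and \<open>B2 * u1\<close> in \<open>e2\<close>, through the trace
    of \<open>B2\<close>.\<close>
  have e1: "(LINT z|?M. snd (fst (F z)) * fst (snd (Dy F z)) + fst (snd (F z)) * snd (fst (Dy F z))) = 0"
    by (rule integral_product_rule_zero_trace[OF wd[OF bl(2)] wd[OF bl(3)]
          int[OF a(2)] int[OF d(2)] int[OF a(3)] int[OF d(3)] i1 u2])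
  have e2: "(LINT z|?M. snd (snd (F z)) * fst (fst (Dy F z)) + fst (fst (F z)) * snd (snd (Dy F z))) = 0"
    by (rule integral_product_rule_zero_trace[OF wd[OF bl(4)] wd[OF bl(1)]
          int[OF a(4)] int[OF d(4)] int[OF a(1)] int[OF d(1)] i2 B2])
  have ae: "AE z in ?M. (snd (fst (F z)) * fst (snd (Dy F z)) + fst (snd (F z)) * snd (fst (Dy F z))) -
      (snd (snd (F z)) * fst (fst (Dy F z)) + fst (fst (F z)) * snd (snd (Dy F z))) = fst (induction_term F z)"
    using weak_deriv_bounded_linear_AE[OF F in_words(1)[OF r] bl(1)] weak_deriv_bounded_linear_AE[OF F in_words(2)[OF r] bl(2)]
      weak_deriv_bounded_linear_AE[OF F in_words(1)[OF r] bl(3)] weak_deriv_bounded_linear_AE[OF F in_words(2)[OF r] bl(4)]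
      divu[unfolded divergence_free_def] divB[unfolded divergence_free_def]
  proof eventually_elim
    case (elim z)
    \<comment> \<open>The two divergence conditions trade the only \<open>x\<close>-derivatives in
      the first component, those of \<open>u1\<close> and \<open>B1\<close>, for
      \<open>y\<close>-derivatives of \<open>u2\<close> and \<open>B2\<close>.\<close>
    have "fst (fst (Dx F z)) = - snd (fst (Dy F z))" "fst (snd (Dx F z)) = - snd (snd (Dy F z))"
      using elim by linarith+
    then show ?case by (simp add: induction_term_def algebra_simps)
  qed
  have "(LINT z|?M. (snd (fst (F z)) * fst (snd (Dy F z)) + fst (snd (F z)) * snd (fst (Dy F z))) -
      (snd (snd (F z)) * fst (fst (Dy F z)) + fst (fst (F z)) * snd (snd (Dy F z)))) = (LINT z|?M. fst (induction_term F z))"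
    by (rule lebesgue_on_cong_AE(2)[OF sq borel_measurable_integrable[OF Bochner_Integration.integrable_diff[OF i1 i2]] ae])
  then show ?thesis
    unfolding Bochner_Integration.integral_diff[OF i1 i2] e1 e2 by simp
qed

subsection \<open>Conservation of the mean\<close>

lemma continuous_on_imp_integrable_Ioo:
  fixes f :: "real \<Rightarrow> real"
  assumes "continuous_on {a..b} f"
  shows "integrable (lebesgue_on {a<..<b}) f"
proof -
  have "integrable (lebesgue_on {a..b}) f"
    by (rule continuous_imp_integrable_real[OF assms])
  then have "set_integrable lebesgue {a..b} f"
    unfolding set_integrable_def by (simp add: integrable_restrict_space)
  then have "set_integrable lebesgue {a<..<b} f"
    by (rule set_integrable_subset) auto
  then show ?thesis
    unfolding set_integrable_def by (simp add: integrable_restrict_space)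
qed

lemma integrable_pair_real:
  fixes f g :: "'a \<Rightarrow> real"
  assumes "integrable M f" "integrable M g"
  shows "integrable M (\<lambda>x. (f x, g x))"
proof -
  have "integrable M (\<lambda>x. f x *\<^sub>R (1 :: real, 0 :: real) + g x *\<^sub>R (0 :: real, 1 :: real))"
    by (intro Bochner_Integration.integrable_add integrable_scaleR_left assms)
  then show ?thesis by simp
qed

lemma finite_measure_Ioo: "finite_measure (lebesgue_on {a<..<b :: real})"
proof (rule finite_measureI)
  show "emeasure (lebesgue_on {a<..<b}) (space (lebesgue_on {a<..<b})) \<noteq> \<infinity>"
    by (cases "a \<le> b") (simp_all add: emeasure_restrict_space)
qed

lemma partials_1_real:
  fixes \<Theta> :: "real \<Rightarrow> real"
  assumes "\<And>x. (\<Theta> has_real_derivative \<psi> x) (at x)"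
  shows "partials [1] \<Theta> = \<psi>"
  using frechet_derivative_real[OF assms] by auto

text \<open>Testing with mean-zero functions that tend to \<open>T\<close> times the indicator of
  \<open>(0, b)\<close> minus \<open>b\<close> shows that the integral of \<open>m\<close> over
  \<open>[0, b]\<close> is proportional to \<open>b\<close>. Differentiating in \<open>b\<close>
  gives the constant, at every point because \<open>m\<close> is continuous.\<close>

lemma du_Bois_Reymond:
  fixes m :: "real \<Rightarrow> real"
  assumes T: "T > 0" and m: "continuous_on {0..T} m"
    and weak: "\<And>\<theta>. test_function {0<..<T} \<theta> \<Longrightarrow> (LINT t|lebesgue_on {0<..<T}. partials [1] \<theta> t * m t) = 0"
  shows "m constant_on {0..T}"
proof -
  let ?N = "lebesgue_on {0<..<T}"
  define A where "A = (LINT t|?N. m t)"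
  have mi: "integrable ?N m" by (rule continuous_on_imp_integrable_Ioo[OF m])
  obtain \<gamma> where \<gamma>: "\<And>n. test_function {0<..<T} (\<gamma> n)"
    "\<And>n x. 0 \<le> \<gamma> n x" "\<And>n x. \<gamma> n x \<le> (1::real)" "\<And>x. (\<lambda>n. \<gamma> n x) \<longlonglongrightarrow> indicator {0<..<T} x"
    using bump_sequence[of 0 T] by metis
  define C where "C n = (LINT y|lborel. \<gamma> n y)" for n
  have C: "C \<longlonglongrightarrow> T" "\<bar>C n\<bar> \<le> T" for n
    using test_functions_tendsto_indicator_integral(1)[OF \<gamma>]
      test_functions_tendsto_indicator_integral(2)[OF \<gamma>, of n] T
    unfolding C_def by auto
  have avg: "integral {0..b} m = b * (A / T)" if b: "b \<in> {0..T}" for b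
  proof -
    obtain \<beta> where \<beta>: "\<And>n. test_function {0<..<b} (\<beta> n)"
      "\<And>n x. 0 \<le> \<beta> n x" "\<And>n x. \<beta> n x \<le> (1::real)" "\<And>x. (\<lambda>n. \<beta> n x) \<longlonglongrightarrow> indicator {0<..<b} x"
      using bump_sequence[of 0 b] by metis
    define B where "B n = (LINT y|lborel. \<beta> n y)" for n
    have B: "B \<longlonglongrightarrow> b" "\<bar>B n\<bar> \<le> T" for n
      using test_functions_tendsto_indicator_integral(1)[OF \<beta>]
        test_functions_tendsto_indicator_integral(2)[OF \<beta>, of n] b
      unfolding B_def by auto
    \<comment> \<open>The mean is exactly zero, so \<open>\<psi> n\<close> is the derivative of a
      test function and the hypothesis applies before passing to the limit.\<close>
    define \<psi> where "\<psi> n y = C n * \<beta> n y + (- B n) * \<gamma> n y" for n y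
    have \<beta>t: "test_function {0<..<T} (\<beta> n)" for n
      by (rule test_function_mono[OF \<beta>(1)]) (use b in auto)
    have \<psi>t: "test_function {0<..<T} (\<psi> n)" for n
      unfolding \<psi>_def by (rule test_function_lincomb[OF \<beta>t \<gamma>(1)])
    have "(LINT y|lborel. \<psi> n y) = 0" for n
      unfolding \<psi>_def using test_function_integrable[OF \<beta>t[of n]] test_function_integrable[OF \<gamma>(1)[of n]]
      by (simp add: B_def C_def)
    then have mean: "integral {0..T} (\<psi> n) = 0" for n
      using test_function_integral_Icc[OF \<psi>t] by simp
    have z: "(LINT t|?N. \<psi> n t * m t) = 0" for n
    proof -
      obtain \<Theta> where \<Theta>: "test_function {0<..<T} \<Theta>" "\<And>x. (\<Theta> has_real_derivative \<psi> n x) (at x)"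
        using test_function_antiderivative[OF \<psi>t mean] by blast
      show ?thesis using weak[OF \<Theta>(1)] unfolding partials_1_real[OF \<Theta>(2)] .
    qed
    have \<psi>2: "\<bar>\<psi> n y\<bar> \<le> 2 * T" for n y
    proof -
      have "\<bar>C n * \<beta> n y\<bar> \<le> T * 1" "\<bar>B n * \<gamma> n y\<bar> \<le> T * 1"
        using B(2)[of n] C(2)[of n] \<beta>(2,3)[of n y] \<gamma>(2,3)[of n y] T
        unfolding abs_mult by (intro mult_mono; simp)+
      then show ?thesis unfolding \<psi>_def by linarith
    qed
    have \<psi>m: "\<psi> n \<in> borel_measurable ?N" for n
      using test_function_measurable[OF \<psi>t, of n]
      by (intro measurable_restrict_space1 measurable_completion) simp
    have ind: "indicat_real {0<..<b} \<in> borel_measurable ?N"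
      by (intro measurable_restrict_space1 measurable_completion) simp
    have lm: "(\<lambda>t. T * indicator {0<..<b} t - b) \<in> borel_measurable ?N"
      using ind by simp
    have "(\<lambda>n. LINT t|?N. \<psi> n t * m t) \<longlonglongrightarrow> (LINT t|?N. (T * indicator {0<..<b} t - b) * m t)"
    proof (rule integral_dominated_convergence[where w = "\<lambda>t. (2 * T) * \<bar>m t\<bar>"])
      show "AE t in ?N. norm (\<psi> n t * m t) \<le> 2 * T * \<bar>m t\<bar>" for n
        using \<psi>2 by (intro AE_I2) (simp add: abs_mult mult_right_mono)
      show "AE t in ?N. (\<lambda>n. \<psi> n t * m t) \<longlonglongrightarrow> (T * indicator {0<..<b} t - b) * m t"
      proof (intro AE_I2 tendsto_mult tendsto_const)
        fix t assume "t \<in> space ?N"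
        then have t: "indicator {0<..<T} t = (1::real)" by simp
        have "(\<lambda>n. C n * \<beta> n t + (- B n) * \<gamma> n t) \<longlonglongrightarrow> T * indicator {0<..<b} t + (- b) * indicator {0<..<T} t"
          by (intro tendsto_add tendsto_mult tendsto_minus B C \<beta>(4) \<gamma>(4))
        then show "(\<lambda>n. \<psi> n t) \<longlonglongrightarrow> T * indicator {0<..<b} t - b"
          unfolding \<psi>_def t by simp
      qed
      show "(\<lambda>t. \<psi> n t * m t) \<in> borel_measurable ?N" for n
        by (intro borel_measurable_times \<psi>m borel_measurable_integrable[OF mi])
      show "(\<lambda>t. (T * indicator {0<..<b} t - b) * m t) \<in> borel_measurable ?N"
        by (intro borel_measurable_times lm borel_measurable_integrable[OF mi])
      show "integrable ?N (\<lambda>t. 2 * T * \<bar>m t\<bar>)" using mi by simp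
    qed
    then have lim0: "(LINT t|?N. (T * indicator {0<..<b} t - b) * m t) = 0"
      by (simp add: z LIMSEQ_const_iff)
    have bm: "integrable ?N (\<lambda>t. indicat_real {0<..<b} t * m t)"
      by (rule integrable_bounded_mult[OF mi ind, of 1]) (simp add: indicator_def)
    have "(LINT t|?N. (T * indicator {0<..<b} t - b) * m t) = (LINT t|?N. T * (indicat_real {0<..<b} t * m t) - b * m t)"
      by (simp only: left_diff_distrib mult.assoc)
    also have "\<dots> = T * (LINT t|?N. indicat_real {0<..<b} t * m t) - b * A"
      unfolding A_def using bm mi by simp
    also have "(LINT t|?N. indicat_real {0<..<b} t * m t) = (LINT t|?N. (if t \<in> {0<..<b} then m t else 0))"
      by (rule Bochner_Integration.integral_cong) (auto simp: indicator_def)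
    also have "\<dots> = (LINT t|lebesgue_on {0<..<b}. m t)"
      using b by (intro integral_restrict) auto
    also have "\<dots> = integral {0<..<b} m"
      by (rule lebesgue_integral_eq_integral[OF continuous_on_imp_integrable_Ioo])
         (use b in \<open>auto intro: continuous_on_subset[OF m]\<close>)
    also have "\<dots> = integral {0..b} m"
      by (rule integral_open_interval_real[symmetric])
    finally have "T * integral {0..b} m = b * A" using lim0 by simp
    then have "integral {0..b} m = (b * A) / T"
      using T by (metis less_irrefl nonzero_mult_div_cancel_left)
    then show ?thesis by simp
  qed
  have "m b = A / T" if b: "b \<in> {0..T}" for b
  \<comment> \<open>Derivatives within the closed interval are one-sided at 0 and \<open>T\<close>,
    so the endpoints are covered as well.\<close>
  proof (rule vector_derivative_unique_within_closed_interval[where a = 0 and b = T])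
    show "((\<lambda>b. integral {0..b} m) has_vector_derivative m b) (at b within cbox 0 T)"
      using integral_has_vector_derivative[OF m b] by simp
    have "((\<lambda>b. b * k) has_real_derivative k) (at b within cbox 0 T)" for k
      by (auto intro!: derivative_eq_intros)
    then have "((\<lambda>b. b * (A / T)) has_vector_derivative A / T) (at b within cbox 0 T)"
      unfolding has_real_derivative_iff_has_vector_derivative[symmetric] .
    then show "((\<lambda>b. integral {0..b} m) has_vector_derivative A / T) (at b within cbox 0 T)"
      by (rule has_vector_derivative_transform[rotated 2]) (use b avg in auto)
  qed (use T b in auto)
  then show ?thesis unfolding constant_on_def by blast
qed

lemma integral_unit_square_eq_open_square:
  fixes f :: "real \<times> real \<Rightarrow> real"
  assumes f: "f \<in> borel_measurable (lebesgue_on open_square)"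
  shows "(LINT z|lebesgue_on unit_square. f z) = (LINT z|lebesgue_on open_square. f z)"
proof -
  have sq: "open_square \<in> sets lebesgue" "unit_square \<in> sets lebesgue"
    by (auto intro!: lmeasurable_compact fmeasurableD compact_Times)
  have box: "open_square = box (0, 0) (1, 1)" "unit_square = cbox (0, 0) (1, 1 :: real)"
    by (auto simp: box_def Basis_prod_def cbox_Pair_eq)
  have "AE z in lebesgue. z \<notin> unit_square - open_square"
    unfolding box
    by (intro AE_not_in) (simp add: negligible_iff_null_sets[symmetric] negligible_frontier_interval)
  then have ae: "AE z in lebesgue. (if z \<in> open_square then f z else 0) = (if z \<in> unit_square then f z else 0)"
    by eventually_elim auto
  have m: "(\<lambda>z. if z \<in> open_square then f z else 0) \<in> borel_measurable lebesgue"
    using f sq by (simp add: borel_measurable_if)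
  have "(LINT z|lebesgue. (if z \<in> open_square then f z else 0)) = (LINT z|lebesgue. (if z \<in> unit_square then f z else 0))"
    by (rule integral_cong_AE[OF m borel_measurable_AE[OF m ae] ae])
  then show ?thesis
    using sq by (simp only: Lebesgue_Measure.integral_restrict_UNIV)
qed

text \<open>The inner integrals have to be shown continuous in \<open>t\<close>: for a non-integrable function of \<open>t\<close> the
  outer integral is \<open>0\<close> by convention, and the weak equation would say nothing.\<close>

lemma induction_equation_tested:
  fixes u B :: "real \<Rightarrow> real \<times> real \<Rightarrow> real \<times> real"
  assumes r: "1 \<le> r"
    and cont: "continuous_into_sobolev {0..T} r open_square (\<lambda>t z. (u t z, B t z))"
    and sol: "solves_ideal_MHD T u B p"
    and \<theta>: "test_function {0<..<T} \<theta>" and \<eta>: "test_function open_square \<eta>" and \<eta>1: "\<And>z. \<bar>\<eta> z\<bar> \<le> 1"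
  shows "(LINT t|lebesgue_on {0<..<T}. - partials [1] \<theta> t * (LINT z|lebesgue_on open_square. \<eta> z * fst (B t z))
     + \<theta> t * (LINT z|lebesgue_on open_square. \<eta> z * fst (induction_term (\<lambda>z. (u t z, B t z)) z))) = 0"
proof -
  let ?M = "lebesgue_on open_square" and ?N = "lebesgue_on {0<..<T}"
  let ?F = "\<lambda>t z. (u t z, B t z)"
  have sq: "open_square \<in> sets lebesgue" by auto
  have \<eta>m: "\<eta> \<in> borel_measurable ?M"
    using test_function_measurable[OF \<eta>] by (intro measurable_restrict_space1 measurable_completion) simp
  have one: "[1] \<in> lists (Basis :: real set)" by simp
  have \<theta>c: "continuous_on S \<theta>" "continuous_on S (partials [1] \<theta>)" for S
    using test_function_continuous[OF \<theta>] test_function_continuous[OF test_function_partials[OF \<theta> one]] by blast+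
  \<comment> \<open>\<open>V\<close> is the integrand of the weak equation for the tensor product of
    \<open>\<theta>\<close> and \<open>\<eta>\<close>, with the advection terms replaced by
    \<open>induction_term\<close>. \<open>W \<pi>\<close> is its spatial integral in the coordinate
    \<open>\<pi>\<close>, with the factors depending on time taken out.\<close>
  define V where "V t z = - (partials [1] \<theta> t * \<eta> z) *\<^sub>R B t z + (\<theta> t * \<eta> z) *\<^sub>R induction_term (?F t) z" for t z
  define W where "W \<pi> t = - partials [1] \<theta> t * (LINT z|?M. \<eta> z * \<pi> (B t z)) + \<theta> t * (LINT z|?M. \<eta> z * \<pi> (induction_term (?F t) z))"
    for \<pi> :: "real \<times> real \<Rightarrow> real" and t
  have W: "continuous_on {0..T} (W \<pi>)"
    and V\<pi>: "\<And>t. t \<in> {0..T} \<Longrightarrow> integrable ?M (\<lambda>z. \<pi> (V t z)) \<and> (LINT z|?M. \<pi> (V t z)) = W \<pi> t"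
    if \<pi>: "bounded_linear \<pi>" "\<And>v. \<bar>\<pi> v\<bar> \<le> norm v" for \<pi> :: "real \<times> real \<Rightarrow> real"
  proof -
    interpret \<pi>: bounded_linear \<pi> by (rule \<pi>(1))
    have le: "\<bar>\<pi> (snd v)\<bar> \<le> norm v" for v :: "(real \<times> real) \<times> (real \<times> real)"
      using \<pi>(2) norm_fst_snd_le[of v] order_trans by blast
    have "L2_continuous ?M {0..T} (\<lambda>t z. \<pi> (snd (?F t z)))"
      by (rule continuous_into_sobolev_L2_continuous[OF open_open_square cont
            bounded_linear_compose[OF \<pi>(1) bounded_linear_snd] le])
    then have bL: "L2_continuous ?M {0..T} (\<lambda>t z. \<pi> (B t z))" by simp
    have "continuous_on {0..T} (\<lambda>t. LINT z|?M. \<eta> z * (\<pi> (B t z) * 1))"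
      by (rule continuous_on_integral_mult_L2[OF bL L2_continuous_const_1[OF finite_measure_open_square] \<eta>m \<eta>1])
    then have c1: "continuous_on {0..T} (\<lambda>t. LINT z|?M. \<eta> z * \<pi> (B t z))" by simp
    have c2: "continuous_on {0..T} (\<lambda>t. LINT z|?M. \<eta> z * \<pi> (induction_term (?F t) z))"
      by (rule induction_term_L2(2)[OF cont r \<pi> \<eta>m \<eta>1])
    show "continuous_on {0..T} (W \<pi>)"
      unfolding W_def by (intro continuous_on_add continuous_on_mult continuous_on_minus \<theta>c c1 c2)
    fix t assume t: "t \<in> {0..T}"
    have i1: "integrable ?M (\<lambda>z. \<eta> z * \<pi> (B t z))"
      by (rule integrable_bounded_mult[OF L2_continuous_integrable[OF finite_measure_open_square bL t] \<eta>m \<eta>1])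
    have i2: "integrable ?M (\<lambda>z. \<eta> z * \<pi> (induction_term (?F t) z))"
      by (rule integrable_bounded_mult[OF induction_term_L2(1)[OF cont r \<pi> t] \<eta>m \<eta>1])
    have eq: "(\<lambda>z. \<pi> (V t z)) = (\<lambda>z. (- partials [1] \<theta> t) * (\<eta> z * \<pi> (B t z)) + \<theta> t * (\<eta> z * \<pi> (induction_term (?F t) z)))"
      by (simp add: V_def fun_eq_iff \<pi>.add \<pi>.scaleR \<pi>.neg \<pi>.diff)
    show "integrable ?M (\<lambda>z. \<pi> (V t z)) \<and> (LINT z|?M. \<pi> (V t z)) = W \<pi> t"
      unfolding eq W_def
      using Bochner_Integration.integrable_add[OF integrable_mult_right[OF i1] integrable_mult_right[OF i2]]
        Bochner_Integration.integral_add[OF integrable_mult_right[OF i1] integrable_mult_right[OF i2]]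
      by (simp only: integral_mult_right_zero)
  qed
  note Wf = W[OF bounded_linear_fst abs_fst_le] and Ws = W[OF bounded_linear_snd abs_snd_le]
  note Vf = V\<pi>[OF bounded_linear_fst abs_fst_le] and Vs = V\<pi>[OF bounded_linear_snd abs_snd_le]
  let ?\<phi> = "\<lambda>x :: real \<times> real \<times> real. \<theta> (fst x) * \<eta> (snd x)"
  have \<phi>: "test_function ({0<..<T} \<times> open_square) ?\<phi>"
    by (rule test_function_tensor[OF \<theta> \<eta>])
  have sm: "smooth \<theta>" "smooth \<eta>" using \<theta> \<eta> by (auto simp: test_function_def)
  have p\<phi>: "partials [(1, 0, 0)] ?\<phi> = (\<lambda>x. partials [1] \<theta> (fst x) * \<eta> (snd x))"
    using partials_tensor(1)[OF sm, of 1] by (simp only: zero_prod_def)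
  have inner: "(LINT z|?M. - partials [(1, 0, 0)] ?\<phi> (t, z) *\<^sub>R B t z
      + ?\<phi> (t, z) *\<^sub>R (advect (u t) (B t) z - advect (B t) (u t) z)) = (W fst t, W snd t)"
    if t: "t \<in> {0<..<T}" for t
  proof -
    have t': "t \<in> {0..T}" using t by auto
    then have F: "?F t \<in> sobolev_space r open_square"
      using cont by (auto simp: continuous_into_sobolev_def)
    have Vi: "integrable ?M (V t)"
      using integrable_pair_real[of ?M "\<lambda>z. fst (V t z)" "\<lambda>z. snd (V t z)"] Vf[OF t'] Vs[OF t'] by simp
    have ae: "AE z in ?M. V t z = - partials [(1, 0, 0)] ?\<phi> (t, z) *\<^sub>R B t z
      + ?\<phi> (t, z) *\<^sub>R (advect (u t) (B t) z - advect (B t) (u t) z)"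
      using advect_eq_induction_term[OF F r]
    proof eventually_elim
      case (elim z)
      then have "advect (u t) (B t) z - advect (B t) (u t) z = induction_term (?F t) z" by simp
      then show ?case unfolding V_def p\<phi> by simp
    qed
    have "(LINT z|?M. V t z) = (LINT z|?M. - partials [(1, 0, 0)] ?\<phi> (t, z) *\<^sub>R B t z
      + ?\<phi> (t, z) *\<^sub>R (advect (u t) (B t) z - advect (B t) (u t) z))"
      by (rule lebesgue_on_cong_AE(2)[OF sq borel_measurable_integrable[OF Vi] ae])
    moreover have "fst (LINT z|?M. V t z) = W fst t" "snd (LINT z|?M. V t z) = W snd t"
      using Vf[OF t'] Vs[OF t'] integral_bounded_linear[OF bounded_linear_fst Vi]
        integral_bounded_linear[OF bounded_linear_snd Vi] by simp_all
    ultimately show ?thesis by (metis prod.collapse)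
  qed
  have "(LINT t|?N. LINT z|?M. - partials [(1, 0, 0)] ?\<phi> (t, z) *\<^sub>R B t z
      + ?\<phi> (t, z) *\<^sub>R (advect (u t) (B t) z - advect (B t) (u t) z)) = 0"
    using sol \<phi> unfolding solves_ideal_MHD_def by blast
  moreover have "(LINT t|?N. LINT z|?M. - partials [(1, 0, 0)] ?\<phi> (t, z) *\<^sub>R B t z
      + ?\<phi> (t, z) *\<^sub>R (advect (u t) (B t) z - advect (B t) (u t) z)) = (LINT t|?N. (W fst t, W snd t))"
    by (rule Bochner_Integration.integral_cong[OF refl inner]) simp
  \<comment> \<open>The first component can be extracted from the time integral only if the pair is
    integrable in time, which is why continuity was shown for the second coordinate too.\<close>
  ultimately have "(LINT t|?N. (W fst t, W snd t)) = 0" by simp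
  moreover have "integrable ?N (\<lambda>t. (W fst t, W snd t))"
    by (intro integrable_pair_real continuous_on_imp_integrable_Ioo Wf Ws)
  ultimately have "(LINT t|?N. W fst t) = 0"
    using integral_bounded_linear[OF bounded_linear_fst, of ?N "\<lambda>t. (W fst t, W snd t)"] by simp
  then show ?thesis unfolding W_def .
qed

text \<open>Two successive limits: for fixed \<open>t\<close> dominated convergence in space turns
  \<open>\<eta> n\<close> into 1, and then dominated convergence in time acts on the outer integral.
  For each fixed \<open>t\<close> the induction term has integral zero, so only the term with the
  mean survives.\<close>

lemma mean_tested:
  fixes u B :: "real \<Rightarrow> real \<times> real \<Rightarrow> real \<times> real"
  assumes r: "1 \<le> r"
    and cont: "continuous_into_sobolev {0..T} r open_square (\<lambda>t z. (u t z, B t z))"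
    and sol: "solves_ideal_MHD T u B p"
    and u2: "\<And>t. t \<in> {0..T} \<Longrightarrow> zero_at_top_and_bottom (\<lambda>z. snd (u t z))"
    and B2: "\<And>t. t \<in> {0..T} \<Longrightarrow> zero_at_top_and_bottom (\<lambda>z. snd (B t z))"
    and \<theta>: "test_function {0<..<T} \<theta>"
  shows "(LINT t|lebesgue_on {0<..<T}. partials [1] \<theta> t * (LINT z|lebesgue_on open_square. fst (B t z))) = 0"
proof -
  let ?M = "lebesgue_on open_square" and ?N = "lebesgue_on {0<..<T}"
  let ?F = "\<lambda>t z. (u t z, B t z)"
  obtain \<eta> :: "nat \<Rightarrow> real \<times> real \<Rightarrow> real" where \<eta>0: "\<And>n. test_function (box (0, 0) (1, 1)) (\<eta> n)"
    "\<And>n x. 0 \<le> \<eta> n x" "\<And>n x. \<eta> n x \<le> 1" "\<And>x. (\<lambda>n. \<eta> n x) \<longlonglongrightarrow> indicator (box (0, 0) (1, 1)) x"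
    using bump_sequence_box[of "(0, 0)" "(1, 1)"] by metis
  have box: "box (0, 0) (1, 1) = open_square"
    by (auto simp: box_def Basis_prod_def)
  note \<eta> = \<eta>0[unfolded box]
  have \<eta>1: "\<bar>\<eta> n z\<bar> \<le> 1" for n z using \<eta>(2,3)[of n z] by simp
  have \<eta>m: "\<eta> n \<in> borel_measurable ?M" for n
    using test_function_measurable[OF \<eta>(1)[of n]] by (intro measurable_restrict_space1 measurable_completion) simp
  have one: "[1] \<in> lists (Basis :: real set)" by simp
  obtain C\<theta> where C\<theta>: "\<And>t. \<bar>\<theta> t\<bar> \<le> C\<theta>" "C\<theta> > 0"
    using test_function_bounded[OF \<theta>] by metis
  obtain C\<theta>' where C\<theta>': "\<And>t. \<bar>partials [1] \<theta> t\<bar> \<le> C\<theta>'" "C\<theta>' > 0"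
    using test_function_bounded[OF test_function_partials[OF \<theta> one]] by metis
  have \<theta>c: "continuous_on S \<theta>" "continuous_on S (partials [1] \<theta>)" for S
    using test_function_continuous[OF \<theta>] test_function_continuous[OF test_function_partials[OF \<theta> one]] by blast+
  have le: "\<bar>fst (snd v)\<bar> \<le> norm v" for v :: "(real \<times> real) \<times> (real \<times> real)"
    using abs_fst_le norm_fst_snd_le[of v] order_trans by blast
  have "L2_continuous ?M {0..T} (\<lambda>t z. fst (snd (?F t z)))"
    by (rule continuous_into_sobolev_L2_continuous[OF open_open_square cont bounded_linear_components(3) le])
  then have bL: "L2_continuous ?M {0..T} (\<lambda>t z. fst (B t z))" by simp
  have L1: "L2_continuous ?M {0..T} (\<lambda>t z. 1)"
    by (rule L2_continuous_const_1[OF finite_measure_open_square])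
  have bi: "integrable ?M (\<lambda>z. fst (B t z))" if "t \<in> {0..T}" for t
    by (rule L2_continuous_integrable[OF finite_measure_open_square bL that])
  note ind = induction_term_L2[OF cont r bounded_linear_fst abs_fst_le]
  have bc: "continuous_on {0..T} (\<lambda>t. LINT z|?M. \<kappa> z * fst (B t z))"
    if "\<kappa> \<in> borel_measurable ?M" "\<And>z. \<bar>\<kappa> z\<bar> \<le> 1" for \<kappa>
    using continuous_on_integral_mult_L2[OF bL L1 that] by simp
  \<comment> \<open>\<open>C1\<close> and \<open>C2\<close> bound the spatial \<open>L1\<close>
    norms uniformly in time. As \<open>\<eta> n\<close> is bounded by 1, they combine with the
    bounds of \<open>\<theta>\<close> and its derivative into a constant majorant independent of
    \<open>n\<close>.\<close>
  obtain C1 where C1: "\<And>t. t \<in> {0..T} \<Longrightarrow> (LINT z|?M. \<bar>fst (B t z)\<bar>) \<le> C1"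
    using L2_continuous_mult_bounded[OF bL L1 compact_Icc] unfolding mult_1_right by blast
  obtain C2 where C2: "\<And>t. t \<in> {0..T} \<Longrightarrow> (LINT z|?M. \<bar>fst (induction_term (?F t) z)\<bar>) \<le> C2"
    using ind(3)[OF compact_Icc] by blast
  have lim: "(\<lambda>n. LINT z|?M. \<eta> n z * g z) \<longlonglongrightarrow> (LINT z|?M. g z)"
    and bd: "\<And>n. \<bar>LINT z|?M. \<eta> n z * g z\<bar> \<le> (LINT z|?M. \<bar>g z\<bar>)" if g: "integrable ?M g" for g
  proof -
    have pw: "\<bar>\<eta> n z * g z\<bar> \<le> \<bar>g z\<bar>" for n z
      using mult_right_mono[OF \<eta>1[of n z], of "\<bar>g z\<bar>"] by (simp add: abs_mult)
    show "(\<lambda>n. LINT z|?M. \<eta> n z * g z) \<longlonglongrightarrow> (LINT z|?M. g z)"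
    proof (rule integral_dominated_convergence[where w = "\<lambda>z. \<bar>g z\<bar>"])
      show "AE z in ?M. (\<lambda>n. \<eta> n z * g z) \<longlonglongrightarrow> g z"
      proof (intro AE_I2)
        fix z assume "z \<in> space ?M"
        then have "indicator open_square z = (1::real)" by simp
        then have "(\<lambda>n. \<eta> n z) \<longlonglongrightarrow> 1" using \<eta>(4)[of z] by (simp only:)
        from tendsto_mult[OF this tendsto_const[of "g z"]] show "(\<lambda>n. \<eta> n z * g z) \<longlonglongrightarrow> g z" by simp
      qed
      show "AE z in ?M. norm (\<eta> n z * g z) \<le> \<bar>g z\<bar>" for n
        using pw by (intro AE_I2) (simp only: real_norm_def)
      show "(\<lambda>z. \<eta> n z * g z) \<in> borel_measurable ?M" for n
        by (intro borel_measurable_times \<eta>m borel_measurable_integrable[OF g])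
    qed (use g in auto)
    show "\<bar>LINT z|?M. \<eta> n z * g z\<bar> \<le> (LINT z|?M. \<bar>g z\<bar>)" for n
    proof -
      have "\<bar>LINT z|?M. \<eta> n z * g z\<bar> \<le> (LINT z|?M. \<bar>\<eta> n z * g z\<bar>)"
        by (rule integral_abs_bound)
      also have "\<dots> \<le> (LINT z|?M. \<bar>g z\<bar>)"
        by (rule integral_mono[OF integrable_abs[OF integrable_bounded_mult[OF g \<eta>m \<eta>1]] integrable_abs[OF g] pw])
      finally show ?thesis .
    qed
  qed
  define J where "J n t = - partials [1] \<theta> t * (LINT z|?M. \<eta> n z * fst (B t z))
     + \<theta> t * (LINT z|?M. \<eta> n z * fst (induction_term (?F t) z))" for n t
  have Jm: "J n \<in> borel_measurable ?N" for n
  proof (rule borel_measurable_integrable[OF continuous_on_imp_integrable_Ioo])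
    show "continuous_on {0..T} (J n)"
      unfolding J_def
      by (intro continuous_on_add continuous_on_mult continuous_on_minus \<theta>c bc[OF \<eta>m \<eta>1] ind(2)[OF \<eta>m \<eta>1])
  qed
  have "continuous_on {0..T} (\<lambda>t. LINT z|?M. 1 * fst (B t z))"
    by (rule bc) auto
  then have mc: "continuous_on {0..T} (\<lambda>t. LINT z|?M. fst (B t z))" by simp
  have "(\<lambda>n. LINT t|?N. J n t) \<longlonglongrightarrow> (LINT t|?N. - (partials [1] \<theta> t * (LINT z|?M. fst (B t z))))"
  proof (rule integral_dominated_convergence[where w = "\<lambda>t. C\<theta>' * C1 + C\<theta> * C2"])
    show "(\<lambda>t. - (partials [1] \<theta> t * (LINT z|?M. fst (B t z)))) \<in> borel_measurable ?N"
      by (intro borel_measurable_integrable[OF continuous_on_imp_integrable_Ioo] continuous_on_minus continuous_on_mult \<theta>c mc)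
    show "integrable ?N (\<lambda>t. C\<theta>' * C1 + C\<theta> * C2)"
      by (rule finite_measure.integrable_const[OF finite_measure_Ioo])
    show "AE t in ?N. (\<lambda>n. J n t) \<longlonglongrightarrow> - (partials [1] \<theta> t * (LINT z|?M. fst (B t z)))"
    proof (intro AE_I2)
      fix t assume "t \<in> space ?N"
      then have t: "t \<in> {0..T}" by simp
      have F: "?F t \<in> sobolev_space r open_square"
        using cont t by (auto simp: continuous_into_sobolev_def)
      have dv: "divergence_free (u t)" "divergence_free (B t)"
        using sol t by (auto simp: solves_ideal_MHD_def)
      have "(LINT z|?M. fst (induction_term (?F t) z)) = 0"
        using integral_induction_term_eq_0[OF F r] dv u2[OF t] B2[OF t] by simp
      then have "(\<lambda>n. J n t) \<longlonglongrightarrow> - partials [1] \<theta> t * (LINT z|?M. fst (B t z)) + \<theta> t * 0"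
        unfolding J_def using lim[OF bi[OF t]] lim[OF ind(1)[OF t]]
        by (intro tendsto_add tendsto_mult tendsto_const) simp_all
      then show "(\<lambda>n. J n t) \<longlonglongrightarrow> - (partials [1] \<theta> t * (LINT z|?M. fst (B t z)))" by simp
    qed
    show "AE t in ?N. norm (J n t) \<le> C\<theta>' * C1 + C\<theta> * C2" for n
    proof (intro AE_I2)
      fix t assume "t \<in> space ?N"
      then have t: "t \<in> {0..T}" by simp
      have "\<bar>partials [1] \<theta> t\<bar> * \<bar>LINT z|?M. \<eta> n z * fst (B t z)\<bar> \<le> C\<theta>' * C1"
        using C\<theta>' order_trans[OF bd[OF bi[OF t]] C1[OF t]] by (intro mult_mono) (auto simp: less_imp_le)
      moreover have "\<bar>\<theta> t\<bar> * \<bar>LINT z|?M. \<eta> n z * fst (induction_term (?F t) z)\<bar> \<le> C\<theta> * C2"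
        using C\<theta> order_trans[OF bd[OF ind(1)[OF t]] C2[OF t]] by (intro mult_mono) (auto simp: less_imp_le)
      ultimately show "norm (J n t) \<le> C\<theta>' * C1 + C\<theta> * C2"
        unfolding J_def real_norm_def
        by (intro order_trans[OF abs_triangle_ineq] add_mono) (simp_all only: abs_mult abs_minus_cancel)
    qed
  qed (rule Jm)
  moreover have "(LINT t|?N. J n t) = 0" for n
    unfolding J_def by (rule induction_equation_tested[OF r cont sol \<theta> \<eta>(1) \<eta>1])
  ultimately show ?thesis by (simp add: LIMSEQ_const_iff)
qed

theorem mainTheorem2:
  fixes r :: nat and T :: real
    and u B :: "real \<Rightarrow> real \<times> real \<Rightarrow> real \<times> real"
    and p :: "(real \<times> real \<times> real \<Rightarrow> real) \<Rightarrow> real"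
  assumes "r \<ge> 3" and "T > 0"
    and "continuous_into_sobolev {0..T} r open_square (\<lambda>t z. (u t z, B t z))"
    and "solves_ideal_MHD T u B p"
    and "\<And>t. t \<in> {0..T} \<Longrightarrow> zero_at_top_and_bottom (\<lambda>z. snd (u t z))"
    and "\<And>t. t \<in> {0..T} \<Longrightarrow> zero_at_top_and_bottom (\<lambda>z. snd (B t z))"
  shows "(\<lambda>t. LINT z|lebesgue_on unit_square. fst (B t z)) constant_on {0..T}"
proof -
  let ?M = "lebesgue_on open_square"
  have r: "1 \<le> r" using assms(1) by simp
  have le: "\<bar>fst (snd v)\<bar> \<le> norm v" for v :: "(real \<times> real) \<times> (real \<times> real)"
    using abs_fst_le norm_fst_snd_le[of v] order_trans by blast
  have "L2_continuous ?M {0..T} (\<lambda>t z. fst (snd (u t z, B t z)))"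
    by (rule continuous_into_sobolev_L2_continuous[OF open_open_square assms(3) bounded_linear_components(3) le])
  then have bL: "L2_continuous ?M {0..T} (\<lambda>t z. fst (B t z))" by simp
  \<comment> \<open>The two factors 1 are the weight \<open>\<eta>\<close> and the second family in
    \<open>continuous_on_integral_mult_L2\<close>. Continuity of the mean upgrades weak constancy to
    constancy at every time, endpoints included.\<close>
  have "continuous_on {0..T} (\<lambda>t. LINT z|?M. 1 * (fst (B t z) * 1))"
    by (rule continuous_on_integral_mult_L2[OF bL L2_continuous_const_1[OF finite_measure_open_square]]) auto
  then have "continuous_on {0..T} (\<lambda>t. LINT z|?M. fst (B t z))" by simp
  then have "(\<lambda>t. LINT z|?M. fst (B t z)) constant_on {0..T}"
    by (rule du_Bois_Reymond[OF assms(2)]) (rule mean_tested[OF r assms(3-6)])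
  moreover have "(LINT z|lebesgue_on unit_square. fst (B t z)) = (LINT z|?M. fst (B t z))" if "t \<in> {0..T}" for t
    using bL that by (intro integral_unit_square_eq_open_square) (auto simp: L2_continuous_def)
  ultimately show ?thesis unfolding constant_on_def by auto
qed

end
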